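(* (Witt's Theorem) Let $(X,\mathcal{A})$ be an ordered algebraized space, with $\mathcal{A}$ a sheaf of unital commutative $\mathbb{C}$-algebras, such that every nowhere-zero section of $\mathcal{A}$ over any open subset of $X$ is invertible. Let $(\mathcal{E},\phi)$ and $(\mathcal{E}',\phi')$ be isometric non-isotropic skew-symmetric convenient $\mathcal{A}$-modules, let $(\mathcal{F},\widetilde{\phi})$, where $\widetilde{\phi}:=\phi|_{\mathcal{F}}$, be a free sub-$\mathcal{A}$-module of $\mathcal{E}$, and let $\sigma\equiv(\sigma_U):\mathcal{F}\longrightarrow\mathcal{E}'$ be an $\mathcal{A}$-isometry of $\mathcal{F}$ into $\mathcal{E}'$. Then $\sigma$ extends to an $\mathcal{A}$-isometry of $\mathcal{E}$ onto $\mathcal{E}'$.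
   Context: $X$ is a topological space. $(X,\mathcal{A})$ is an ordered algebraized space if $\mathcal{A}$ is equipped with an order, i.e. a subsheaf of sets $\mathcal{P}\subseteq\mathcal{A}$ (positive cone) whose stalks are closed under addition, multiplication and multiplication by non-negative reals and satisfy $\mathcal{P}_x\cap(-\mathcal{P}_x)=0$. A section $s\in\mathcal{A}(U)$ ($U$ open) is nowhere-zero if $s|_V\neq 0$ for every non-empty open $V\subseteq U$; it is invertible if it is a unit of $\mathcal{A}(U)$. An $\mathcal{A}$-module is a sheaf of $\mathcal{A}$-modules on $X$; it is free if isomorphic to a direct sum of copies of $\mathcal{A}$, and free of finite rank $m$ if isomorphic to $\mathcal{A}^m$. An $\mathcal{A}$-bilinear form $\phi=(\phi_U):\mathcal{E}\oplus\mathcal{E}\to\mathcal{A}$ is a morphism of sheaves with every $\phi_U$ $\mathcal{A}(U)$-bilinear; it is orthosymmetric if $\phi_U(r,s)=0\Leftrightarrow\phi_U(s,r)=0$ for all open $U$ and $r,s\in\mathcal{E}(U)$. For a sub-$\mathcal{A}$-module $\mathcal{F}\subseteq\mathcal{E}$ and $\phi$ orthosymmetric, the orthogonal $\mathcal{F}^\perp$ is the sub-$\mathcal{A}$-module with $\mathcal{F}^\perp(U)=\{t\in\mathcal{E}(U):\phi_V(\mathcal{F}(V),t|_V)=0\text{ for all open }V\subseteq U\}$, and $\mathrm{rad}\,\mathcal{F}:=\mathcal{F}\cap\mathcal{F}^\perp$; $\mathcal{F}$ is non-isotropic if $\mathrm{rad}\,\mathcal{F}=0$ (in particular $\mathcal{E}$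 is non-isotropic iff $\mathcal{E}^\perp=0$). A convenient $\mathcal{A}$-module is a pair $(\mathcal{E},\phi)$ with $\mathcal{E}$ a free $\mathcal{A}$-module of finite rank and $\phi$ an orthosymmetric $\mathcal{A}$-bilinear form on $\mathcal{E}$ such that: (1) if $\mathcal{F}$ is a free sub-$\mathcal{A}$-module of $\mathcal{E}$, then $\mathcal{F}^\perp$ and $\mathrm{rad}\,\mathcal{F}$ are free sub-$\mathcal{A}$-modules of $\mathcal{E}$; (2) every free sub-$\mathcal{A}$-module $\mathcal{F}$ of $\mathcal{E}$ satisfies $(\mathcal{F}^\perp)^\perp=\mathcal{F}$; (3) the intersection of any two free sub-$\mathcal{A}$-modules of $\mathcal{E}$ is a free sub-$\mathcal{A}$-module. $(\mathcal{E},\phi)$ is skew-symmetric if $\phi_U(r,s)=-\phi_U(s,r)$ for all open $U$ and $r,s\in\mathcal{E}(U)$. An $\mathcal{A}$-isometry of $(\mathcal{F},\widetilde\phi)$ into $(\mathcal{E}',\phi')$ is an injective $\mathcal{A}$-morphism $\sigma$ with $\phi'_U(\sigma_U(r),\sigma_U(s))=\widetilde\phi_U(r,s)$ for all open $U$ and $r,s\in\mathcal{F}(U)$; it is onto if it is moreover an isomorphism; two modules with forms are isometric if there is an isometry of one onto the other. *)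

theory Defs
  imports "HOL-Analysis.Abstract_Topology" "HOL-Algebra.Module" "HOL-Algebra.Algebraic_Closure_Type"
begin

text \<open>The values of all data at non-open sets are irrelevant throughout.  For a sheaf of algebras the
  scalar type \<open>'r\<close> is \<^typ>\<open>complex\<close>; for a sheaf of modules over a sheaf of algebras \<open>A\<close> it is
  the type of the sections of \<open>A\<close>, and the ring fields \<open>mult\<close> and \<open>one\<close> carry no meaning.\<close>

record ('x, 'r, 'm) sheaf_data =
  Sec :: "'x set \<Rightarrow> ('r, 'm) module"
  Res :: "'x set \<Rightarrow> 'x set \<Rightarrow> 'm \<Rightarrow> 'm"  \<comment> \<open>\<open>Res S U V\<close> restricts from \<open>U\<close> to \<open>V \<subseteq> U\<close>\<close>

locale sheaf_of_sets =
  fixes T :: "'x topology" and S :: "'x set \<Rightarrow> 'm set" and \<rho> :: "'x set \<Rightarrow> 'x set \<Rightarrow> 'm \<Rightarrow> 'm"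
  assumes res_closed: "\<lbrakk>openin T U; openin T V; V \<subseteq> U; s \<in> S U\<rbrakk> \<Longrightarrow> \<rho> U V s \<in> S V"
    and res_id: "\<lbrakk>openin T U; s \<in> S U\<rbrakk> \<Longrightarrow> \<rho> U U s = s"
    and res_comp: "\<lbrakk>openin T U; openin T V; openin T W; W \<subseteq> V; V \<subseteq> U; s \<in> S U\<rbrakk>
      \<Longrightarrow> \<rho> V W (\<rho> U V s) = \<rho> U W s"
    and glue: "\<lbrakk>\<And>V. V \<in> \<C> \<Longrightarrow> openin T V; \<And>V. V \<in> \<C> \<Longrightarrow> f V \<in> S V;
        \<And>V W. \<lbrakk>V \<in> \<C>; W \<in> \<C>\<rbrakk> \<Longrightarrow> \<rho> V (V \<inter> W) (f V) = \<rho> W (V \<inter> W) (f W)\<rbrakk>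
      \<Longrightarrow> \<exists>!t. t \<in> S (\<Union>\<C>) \<and> (\<forall>V\<in>\<C>. \<rho> (\<Union>\<C>) V t = f V)"

locale algebraized_space =
  sheaf_of_sets T "\<lambda>U. carrier (Sec A U)" "Res A"
  for T :: "'x topology" and A :: "('x, complex, 'a) sheaf_data" +
  assumes sec_algebra: "openin T U \<Longrightarrow> algebra ring_of_type_algebra (Sec A U)"
    and res_ring_hom: "\<lbrakk>openin T U; openin T V; V \<subseteq> U\<rbrakk> \<Longrightarrow> Res A U V \<in> ring_hom (Sec A U) (Sec A V)"
    and res_scale: "\<lbrakk>openin T U; openin T V; V \<subseteq> U; s \<in> carrier (Sec A U)\<rbrakk>
      \<Longrightarrow> Res A U V (c \<odot>\<^bsub>Sec A U\<^esub> s) = c \<odot>\<^bsub>Sec A V\<^esub> Res A U V s"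

definition germ ::
  "'x topology \<Rightarrow> ('x, 'r, 'm) sheaf_data \<Rightarrow> 'x \<Rightarrow> 'x set \<Rightarrow> 'm \<Rightarrow> ('x set \<times> 'm) set" where
  "germ T S x U s = {(V, t). openin T V \<and> x \<in> V \<and> t \<in> carrier (Sec S V) \<and>
     (\<exists>W. openin T W \<and> x \<in> W \<and> W \<subseteq> U \<inter> V \<and> Res S U W s = Res S V W t)}"

text \<open>The stalk at \<open>x\<close>.  Any two germs have representatives over a common open neighbourhood, so
  the descriptions below determine the operations on the carrier.\<close>

definition stalk ::
  "'x topology \<Rightarrow> ('x, 'r, 'm) sheaf_data \<Rightarrow> 'x \<Rightarrow> ('r, ('x set \<times> 'm) set) module" where
  "stalk T S x =
    \<lparr>carrier = {germ T S x U s |U s. openin T U \<and> x \<in> U \<and> s \<in> carrier (Sec S U)},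
     monoid.mult = (\<lambda>a b. THE c. \<exists>U s t. openin T U \<and> x \<in> U \<and> s \<in> carrier (Sec S U) \<and>
       t \<in> carrier (Sec S U) \<and> a = germ T S x U s \<and> b = germ T S x U t \<and>
       c = germ T S x U (s \<otimes>\<^bsub>Sec S U\<^esub> t)),
     one = germ T S x (topspace T) \<one>\<^bsub>Sec S (topspace T)\<^esub>,
     ring.zero = germ T S x (topspace T) \<zero>\<^bsub>Sec S (topspace T)\<^esub>,
     add = (\<lambda>a b. THE c. \<exists>U s t. openin T U \<and> x \<in> U \<and> s \<in> carrier (Sec S U) \<and>
       t \<in> carrier (Sec S U) \<and> a = germ T S x U s \<and> b = germ T S x U t \<and>
       c = germ T S x U (s \<oplus>\<^bsub>Sec S U\<^esub> t)),
     module.smult = (\<lambda>k a. THE c. \<exists>U s. openin T U \<and> x \<in> U \<and> s \<in> carrier (Sec S U) \<and>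
       a = germ T S x U s \<and> c = germ T S x U (k \<odot>\<^bsub>Sec S U\<^esub> s))\<rparr>"

definition substalk ::
  "'x topology \<Rightarrow> ('x, 'r, 'm) sheaf_data \<Rightarrow> ('x set \<Rightarrow> 'm set) \<Rightarrow> 'x \<Rightarrow> ('x set \<times> 'm) set set" where
  "substalk T S P x = {germ T S x U s |U s. openin T U \<and> x \<in> U \<and> s \<in> P U}"

locale ordered_algebraized_space =
  algebraized_space T A + P: sheaf_of_sets T P "Res A"
  for T :: "'x topology" and A :: "('x, complex, 'a) sheaf_data" and P :: "'x set \<Rightarrow> 'a set" +
  assumes cone_subset: "openin T U \<Longrightarrow> P U \<subseteq> carrier (Sec A U)"
    and cone_add: "\<lbrakk>x \<in> topspace T; a \<in> substalk T A P x; b \<in> substalk T A P x\<rbrakk>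
      \<Longrightarrow> a \<oplus>\<^bsub>stalk T A x\<^esub> b \<in> substalk T A P x"
    and cone_mult: "\<lbrakk>x \<in> topspace T; a \<in> substalk T A P x; b \<in> substalk T A P x\<rbrakk>
      \<Longrightarrow> a \<otimes>\<^bsub>stalk T A x\<^esub> b \<in> substalk T A P x"
    and cone_scale: "\<lbrakk>x \<in> topspace T; a \<in> substalk T A P x; (r::real) \<ge> 0\<rbrakk>
      \<Longrightarrow> complex_of_real r \<odot>\<^bsub>stalk T A x\<^esub> a \<in> substalk T A P x"
    and cone_pointed: "x \<in> topspace T \<Longrightarrow>
      substalk T A P x \<inter> (\<lambda>a. \<ominus>\<^bsub>stalk T A x\<^esub> a) ` substalk T A P x = {\<zero>\<^bsub>stalk T A x\<^esub>}"

definition nowhere_zero ::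
  "'x topology \<Rightarrow> ('x, complex, 'a) sheaf_data \<Rightarrow> 'x set \<Rightarrow> 'a \<Rightarrow> bool" where
  "nowhere_zero T A U s \<longleftrightarrow>
     (\<forall>V. openin T V \<and> V \<noteq> {} \<and> V \<subseteq> U \<longrightarrow> Res A U V s \<noteq> \<zero>\<^bsub>Sec A V\<^esub>)"

locale sheaf_of_modules =
  algebraized_space T A + E: sheaf_of_sets T "\<lambda>U. carrier (Sec E U)" "Res E"
  for T :: "'x topology" and A :: "('x, complex, 'a) sheaf_data"
    and E :: "('x, 'a, 'm) sheaf_data" +
  assumes sec_module: "openin T U \<Longrightarrow> module (Sec A U) (Sec E U)"
    and res_add: "\<lbrakk>openin T U; openin T V; V \<subseteq> U; s \<in> carrier (Sec E U); t \<in> carrier (Sec E U)\<rbrakk>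
      \<Longrightarrow> Res E U V (s \<oplus>\<^bsub>Sec E U\<^esub> t) = Res E U V s \<oplus>\<^bsub>Sec E V\<^esub> Res E U V t"
    and res_smult: "\<lbrakk>openin T U; openin T V; V \<subseteq> U; a \<in> carrier (Sec A U); s \<in> carrier (Sec E U)\<rbrakk>
      \<Longrightarrow> Res E U V (a \<odot>\<^bsub>Sec E U\<^esub> s) = Res A U V a \<odot>\<^bsub>Sec E V\<^esub> Res E U V s"

definition sheaf_morphism :: "'x topology \<Rightarrow> ('x, complex, 'a) sheaf_data \<Rightarrow>
    ('x, 'a, 'm) sheaf_data \<Rightarrow> ('x, 'a, 'n) sheaf_data \<Rightarrow> ('x set \<Rightarrow> 'm \<Rightarrow> 'n) \<Rightarrow> bool" where
  "sheaf_morphism T A E E' \<sigma> \<longleftrightarrow>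
    (\<forall>U. openin T U \<longrightarrow>
       \<sigma> U \<in> carrier (Sec E U) \<rightarrow> carrier (Sec E' U) \<and>
       (\<forall>s\<in>carrier (Sec E U). \<forall>t\<in>carrier (Sec E U).
          \<sigma> U (s \<oplus>\<^bsub>Sec E U\<^esub> t) = \<sigma> U s \<oplus>\<^bsub>Sec E' U\<^esub> \<sigma> U t) \<and>
       (\<forall>a\<in>carrier (Sec A U). \<forall>s\<in>carrier (Sec E U).
          \<sigma> U (a \<odot>\<^bsub>Sec E U\<^esub> s) = a \<odot>\<^bsub>Sec E' U\<^esub> \<sigma> U s)) \<and>
    (\<forall>U V. openin T U \<and> openin T V \<and> V \<subseteq> U \<longrightarrow>
       (\<forall>s\<in>carrier (Sec E U). \<sigma> V (Res E U V s) = Res E' U V (\<sigma> U s)))"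

definition sheaf_mono :: "'x topology \<Rightarrow> ('x, complex, 'a) sheaf_data \<Rightarrow>
    ('x, 'a, 'm) sheaf_data \<Rightarrow> ('x, 'a, 'n) sheaf_data \<Rightarrow> ('x set \<Rightarrow> 'm \<Rightarrow> 'n) \<Rightarrow> bool" where
  "sheaf_mono T A E E' \<sigma> \<longleftrightarrow> sheaf_morphism T A E E' \<sigma> \<and>
    (\<forall>U. openin T U \<longrightarrow> inj_on (\<sigma> U) (carrier (Sec E U)))"

definition sheaf_iso :: "'x topology \<Rightarrow> ('x, complex, 'a) sheaf_data \<Rightarrow>
    ('x, 'a, 'm) sheaf_data \<Rightarrow> ('x, 'a, 'n) sheaf_data \<Rightarrow> ('x set \<Rightarrow> 'm \<Rightarrow> 'n) \<Rightarrow> bool" where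
  "sheaf_iso T A E E' \<sigma> \<longleftrightarrow> sheaf_morphism T A E E' \<sigma> \<and>
    (\<forall>U. openin T U \<longrightarrow> bij_betw (\<sigma> U) (carrier (Sec E U)) (carrier (Sec E' U)))"

text \<open>The direct sum of copies of \<open>A\<close> indexed by \<open>I\<close>.  The presheaf of families with finite support
  is in general not a sheaf; its sheafification consists of the families whose support is locally
  finite.  For finite \<open>I\<close> the support condition is void and this is the power of \<open>A\<close>.\<close>

definition direct_sum :: "'x topology \<Rightarrow> ('x, complex, 'a) sheaf_data \<Rightarrow> 'i set \<Rightarrow>
    ('x, 'a, 'i \<Rightarrow> 'a) sheaf_data" where
  "direct_sum T A I =
    \<lparr>Sec = (\<lambda>U.
      \<lparr>carrier = {f \<in> I \<rightarrow>\<^sub>E carrier (Sec A U).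
         \<forall>x\<in>U. \<exists>V. openin T V \<and> x \<in> V \<and> V \<subseteq> U \<and> finite {i \<in> I. Res A U V (f i) \<noteq> \<zero>\<^bsub>Sec A V\<^esub>}},
       monoid.mult = undefined, one = undefined,
       ring.zero = (\<lambda>i\<in>I. \<zero>\<^bsub>Sec A U\<^esub>),
       add = (\<lambda>f g. \<lambda>i\<in>I. f i \<oplus>\<^bsub>Sec A U\<^esub> g i),
       module.smult = (\<lambda>a f. \<lambda>i\<in>I. a \<otimes>\<^bsub>Sec A U\<^esub> f i)\<rparr>),
     Res = (\<lambda>U V f. \<lambda>i\<in>I. Res A U V (f i))\<rparr>"

text \<open>Index sets of the section type suffice: if \<open>A\<close> is nonzero, a basis is a family of distinct
  global sections of \<open>E\<close>; if \<open>A\<close> is zero, so is every direct sum.\<close>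

definition free_sheaf :: "'x topology \<Rightarrow> ('x, complex, 'a) sheaf_data \<Rightarrow>
    ('x, 'a, 'm) sheaf_data \<Rightarrow> bool" where
  "free_sheaf T A E \<longleftrightarrow> (\<exists>(I :: 'm set) \<tau>. sheaf_iso T A (direct_sum T A I) E \<tau>)"

definition free_of_rank :: "'x topology \<Rightarrow> ('x, complex, 'a) sheaf_data \<Rightarrow>
    ('x, 'a, 'm) sheaf_data \<Rightarrow> nat \<Rightarrow> bool" where
  "free_of_rank T A E m \<longleftrightarrow> (\<exists>\<tau>. sheaf_iso T A (direct_sum T A {..<m}) E \<tau>)"

definition sub_sheaf_of_modules :: "'x topology \<Rightarrow> ('x, complex, 'a) sheaf_data \<Rightarrow>
    ('x, 'a, 'm) sheaf_data \<Rightarrow> ('x set \<Rightarrow> 'm set) \<Rightarrow> bool" where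
  "sub_sheaf_of_modules T A E F \<longleftrightarrow>
    (\<forall>U. openin T U \<longrightarrow> submodule (F U) (Sec A U) (Sec E U)) \<and> sheaf_of_sets T F (Res E)"

definition sub_sheaf :: "('x, 'a, 'm) sheaf_data \<Rightarrow> ('x set \<Rightarrow> 'm set) \<Rightarrow> ('x, 'a, 'm) sheaf_data" where
  "sub_sheaf E F = E\<lparr>Sec := \<lambda>U. (Sec E U)\<lparr>carrier := F U\<rparr>\<rparr>"

definition free_submodule :: "'x topology \<Rightarrow> ('x, complex, 'a) sheaf_data \<Rightarrow>
    ('x, 'a, 'm) sheaf_data \<Rightarrow> ('x set \<Rightarrow> 'm set) \<Rightarrow> bool" where
  "free_submodule T A E F \<longleftrightarrow> sub_sheaf_of_modules T A E F \<and> free_sheaf T A (sub_sheaf E F)"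

type_synonym ('x, 'm, 'a) sheaf_form = "'x set \<Rightarrow> 'm \<Rightarrow> 'm \<Rightarrow> 'a"

locale bilinear_sheaf_form = sheaf_of_modules T A E
  for T :: "'x topology" and A :: "('x, complex, 'a) sheaf_data"
    and E :: "('x, 'a, 'm) sheaf_data" +
  fixes \<phi> :: "('x, 'm, 'a) sheaf_form"
  assumes form_closed: "\<lbrakk>openin T U; r \<in> carrier (Sec E U); s \<in> carrier (Sec E U)\<rbrakk>
      \<Longrightarrow> \<phi> U r s \<in> carrier (Sec A U)"
    and form_add_left:
      "\<lbrakk>openin T U; r \<in> carrier (Sec E U); s \<in> carrier (Sec E U); t \<in> carrier (Sec E U)\<rbrakk>
      \<Longrightarrow> \<phi> U (r \<oplus>\<^bsub>Sec E U\<^esub> s) t = \<phi> U r t \<oplus>\<^bsub>Sec A U\<^esub> \<phi> U s t"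
    and form_add_right:
      "\<lbrakk>openin T U; r \<in> carrier (Sec E U); s \<in> carrier (Sec E U); t \<in> carrier (Sec E U)\<rbrakk>
      \<Longrightarrow> \<phi> U r (s \<oplus>\<^bsub>Sec E U\<^esub> t) = \<phi> U r s \<oplus>\<^bsub>Sec A U\<^esub> \<phi> U r t"
    and form_smult_left:
      "\<lbrakk>openin T U; a \<in> carrier (Sec A U); r \<in> carrier (Sec E U); s \<in> carrier (Sec E U)\<rbrakk>
      \<Longrightarrow> \<phi> U (a \<odot>\<^bsub>Sec E U\<^esub> r) s = a \<otimes>\<^bsub>Sec A U\<^esub> \<phi> U r s"
    and form_smult_right:
      "\<lbrakk>openin T U; a \<in> carrier (Sec A U); r \<in> carrier (Sec E U); s \<in> carrier (Sec E U)\<rbrakk>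
      \<Longrightarrow> \<phi> U r (a \<odot>\<^bsub>Sec E U\<^esub> s) = a \<otimes>\<^bsub>Sec A U\<^esub> \<phi> U r s"
    and form_res:
      "\<lbrakk>openin T U; openin T V; V \<subseteq> U; r \<in> carrier (Sec E U); s \<in> carrier (Sec E U)\<rbrakk>
      \<Longrightarrow> \<phi> V (Res E U V r) (Res E U V s) = Res A U V (\<phi> U r s)"

definition orthosymmetric :: "'x topology \<Rightarrow> ('x, complex, 'a) sheaf_data \<Rightarrow>
    ('x, 'a, 'm) sheaf_data \<Rightarrow> ('x, 'm, 'a) sheaf_form \<Rightarrow> bool" where
  "orthosymmetric T A E \<phi> \<longleftrightarrow>
    (\<forall>U. openin T U \<longrightarrow> (\<forall>r\<in>carrier (Sec E U). \<forall>s\<in>carrier (Sec E U).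
       \<phi> U r s = \<zero>\<^bsub>Sec A U\<^esub> \<longleftrightarrow> \<phi> U s r = \<zero>\<^bsub>Sec A U\<^esub>))"

definition skew_symmetric :: "'x topology \<Rightarrow> ('x, complex, 'a) sheaf_data \<Rightarrow>
    ('x, 'a, 'm) sheaf_data \<Rightarrow> ('x, 'm, 'a) sheaf_form \<Rightarrow> bool" where
  "skew_symmetric T A E \<phi> \<longleftrightarrow>
    (\<forall>U. openin T U \<longrightarrow> (\<forall>r\<in>carrier (Sec E U). \<forall>s\<in>carrier (Sec E U).
       \<phi> U r s = \<ominus>\<^bsub>Sec A U\<^esub> \<phi> U s r))"

definition orthogonal_sheaf :: "'x topology \<Rightarrow> ('x, complex, 'a) sheaf_data \<Rightarrow>
    ('x, 'a, 'm) sheaf_data \<Rightarrow> ('x, 'm, 'a) sheaf_form \<Rightarrow> ('x set \<Rightarrow> 'm set) \<Rightarrow> 'x set \<Rightarrow> 'm set" where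
  "orthogonal_sheaf T A E \<phi> F U = {t \<in> carrier (Sec E U).
     \<forall>V. openin T V \<and> V \<subseteq> U \<longrightarrow> (\<forall>s\<in>F V. \<phi> V s (Res E U V t) = \<zero>\<^bsub>Sec A V\<^esub>)}"

definition radical :: "'x topology \<Rightarrow> ('x, complex, 'a) sheaf_data \<Rightarrow>
    ('x, 'a, 'm) sheaf_data \<Rightarrow> ('x, 'm, 'a) sheaf_form \<Rightarrow> ('x set \<Rightarrow> 'm set) \<Rightarrow> 'x set \<Rightarrow> 'm set" where
  "radical T A E \<phi> F U = F U \<inter> orthogonal_sheaf T A E \<phi> F U"

definition non_isotropic :: "'x topology \<Rightarrow> ('x, complex, 'a) sheaf_data \<Rightarrow>
    ('x, 'a, 'm) sheaf_data \<Rightarrow> ('x, 'm, 'a) sheaf_form \<Rightarrow> ('x set \<Rightarrow> 'm set) \<Rightarrow> bool" where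
  "non_isotropic T A E \<phi> F \<longleftrightarrow>
    (\<forall>U. openin T U \<longrightarrow> radical T A E \<phi> F U = {\<zero>\<^bsub>Sec E U\<^esub>})"

definition convenient_module :: "'x topology \<Rightarrow> ('x, complex, 'a) sheaf_data \<Rightarrow>
    ('x, 'a, 'm) sheaf_data \<Rightarrow> ('x, 'm, 'a) sheaf_form \<Rightarrow> bool" where
  "convenient_module T A E \<phi> \<longleftrightarrow>
    bilinear_sheaf_form T A E \<phi> \<and> orthosymmetric T A E \<phi> \<and> (\<exists>m. free_of_rank T A E m) \<and>
    (\<forall>F. free_submodule T A E F \<longrightarrow>
       free_submodule T A E (orthogonal_sheaf T A E \<phi> F) \<and>
       free_submodule T A E (radical T A E \<phi> F)) \<and>
    (\<forall>F. free_submodule T A E F \<longrightarrow>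
       (\<forall>U. openin T U \<longrightarrow>
          orthogonal_sheaf T A E \<phi> (orthogonal_sheaf T A E \<phi> F) U = F U)) \<and>
    (\<forall>F G. free_submodule T A E F \<and> free_submodule T A E G \<longrightarrow>
       free_submodule T A E (\<lambda>U. F U \<inter> G U))"

definition isometry :: "'x topology \<Rightarrow> ('x, complex, 'a) sheaf_data \<Rightarrow>
    ('x, 'a, 'm) sheaf_data \<Rightarrow> ('x, 'm, 'a) sheaf_form \<Rightarrow>
    ('x, 'a, 'n) sheaf_data \<Rightarrow> ('x, 'n, 'a) sheaf_form \<Rightarrow> ('x set \<Rightarrow> 'm \<Rightarrow> 'n) \<Rightarrow> bool" where
  "isometry T A E \<phi> E' \<phi>' \<sigma> \<longleftrightarrow> sheaf_mono T A E E' \<sigma> \<and>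
    (\<forall>U. openin T U \<longrightarrow> (\<forall>r\<in>carrier (Sec E U). \<forall>s\<in>carrier (Sec E U).
       \<phi>' U (\<sigma> U r) (\<sigma> U s) = \<phi> U r s))"

definition isometry_onto :: "'x topology \<Rightarrow> ('x, complex, 'a) sheaf_data \<Rightarrow>
    ('x, 'a, 'm) sheaf_data \<Rightarrow> ('x, 'm, 'a) sheaf_form \<Rightarrow>
    ('x, 'a, 'n) sheaf_data \<Rightarrow> ('x, 'n, 'a) sheaf_form \<Rightarrow> ('x set \<Rightarrow> 'm \<Rightarrow> 'n) \<Rightarrow> bool" where
  "isometry_onto T A E \<phi> E' \<phi>' \<sigma> \<longleftrightarrow> isometry T A E \<phi> E' \<phi>' \<sigma> \<and> sheaf_iso T A E E' \<sigma>"

definition isometric :: "'x topology \<Rightarrow> ('x, complex, 'a) sheaf_data \<Rightarrow>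
    ('x, 'a, 'm) sheaf_data \<Rightarrow> ('x, 'm, 'a) sheaf_form \<Rightarrow>
    ('x, 'a, 'n) sheaf_data \<Rightarrow> ('x, 'n, 'a) sheaf_form \<Rightarrow> bool" where
  "isometric T A E \<phi> E' \<phi>' \<longleftrightarrow> (\<exists>\<sigma>. isometry_onto T A E \<phi> E' \<phi>' \<sigma>)"

end

theory Submission
  imports Defs
begin

text \<open>Unless \<open>E\<close> is zero, the ring of global sections of \<open>A\<close> is a field, and the theorem becomes
  symplectic linear algebra over it.

  That every global \<open>a \<noteq> 0\<close> is a unit is forced by convenience (\<open>nonzero_global_unit\<close>).  A nonzero \<open>E\<close>
  contains two independent global sections \<open>e0\<close> and \<open>e1\<close>, because a skew-symmetric form on a module
  of rank one vanishes.  The free submodules \<open>A e0\<close> and \<open>A (e0 + a e1)\<close> meet in the multiples \<open>c e0\<close> with \<open>c a = 0\<close>;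
  as this intersection is free, the annihilator of \<open>a\<close> is zero.  Then \<open>A (a e0)\<close> is free too and has the same
  orthogonal as \<open>e0\<close>, so it contains \<open>e0\<close> by biorthogonality.

  A free submodule \<open>F\<close> is spanned by a frame of global sections \<open>f i\<close>, which is finite by a dimension
  count (\<open>finite_frame\<close>), so a morphism on \<open>F\<close> is determined by its values on the frame.  Composition
  with the inverse of an isometry of \<open>E\<close> onto \<open>E'\<close> reduces the claim to \<open>E' = E\<close>.  There the task is to
  find an isometry of \<open>E\<close> onto itself that sends each \<open>f i\<close> to \<open>g i = \<sigma>(f i)\<close>, two independent families
  with the same values of the form.  The vectors are matched one at a time
  (\<open>isometry_matching_families\<close>) by symplectic transvections, which are isometries of the whole sheaf
  with explicit inverses: if \<open>v\<close> and \<open>w\<close> pair equally with the vectors \<open>h i\<close> that are already in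
  place and lie outside their span, a product of at most two transvections moves \<open>v\<close> to \<open>w\<close> and fixes all \<open>h i\<close>
  (\<open>exchange_isometry\<close>).  The second transvection is needed when \<open>\<phi>(v, w) = 0\<close>; the intermediate
  vector comes from \<open>separating_section\<close>, which is biorthogonality of the span of the \<open>h i\<close> together
  with freeness of its orthogonal.\<close>

section \<open>Linear combinations of global sections\<close>

context algebraized_space
begin

lemma sec_cring: "openin T U \<Longrightarrow> cring (Sec A U)"
  using sec_algebra algebra.M_cring by blast

lemma res_ring_hom_cring:
  "\<lbrakk>openin T U; openin T V; V \<subseteq> U\<rbrakk> \<Longrightarrow> ring_hom_cring (Sec A U) (Sec A V) (Res A U V)"
  by (simp add: ring_hom_cring.intro ring_hom_cring_axioms.intro res_ring_hom sec_cring)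

lemma res_zero: "\<lbrakk>openin T U; openin T V; V \<subseteq> U\<rbrakk> \<Longrightarrow> Res A U V \<zero>\<^bsub>Sec A U\<^esub> = \<zero>\<^bsub>Sec A V\<^esub>"
  by (simp add: ring_hom_cring.hom_zero res_ring_hom_cring)

lemma res_one: "\<lbrakk>openin T U; openin T V; V \<subseteq> U\<rbrakk> \<Longrightarrow> Res A U V \<one>\<^bsub>Sec A U\<^esub> = \<one>\<^bsub>Sec A V\<^esub>"
  using res_ring_hom ring_hom_one by metis

text \<open>The complex scalar \<open>1/2\<close> acts on every ring of sections; this turns skew-symmetry into
  \<open>\<phi>(s, s) = 0\<close>.\<close>

lemma double_eq_zero_imp:
  assumes U: "openin T U" and x: "x \<in> carrier (Sec A U)"
    and xx: "x \<oplus>\<^bsub>Sec A U\<^esub> x = \<zero>\<^bsub>Sec A U\<^esub>"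
  shows "x = \<zero>\<^bsub>Sec A U\<^esub>"
proof -
  interpret algebra "ring_of_type_algebra :: complex ring" "Sec A U"
    by (rule sec_algebra[OF U])
  let ?h = "1/2 :: complex"
  have c: "k \<in> carrier (ring_of_type_algebra :: complex ring)" for k
    by (simp add: ring_of_type_algebra_def)
  have "x = (?h + ?h) \<odot>\<^bsub>Sec A U\<^esub> x"
    using smult_one[OF x] by (simp add: ring_of_type_algebra_def)
  also have "\<dots> = ?h \<odot>\<^bsub>Sec A U\<^esub> x \<oplus>\<^bsub>Sec A U\<^esub> ?h \<odot>\<^bsub>Sec A U\<^esub> x"
    using smult_l_distr[OF c c x, of ?h ?h] by (simp add: ring_of_type_algebra_def)
  also have "\<dots> = ?h \<odot>\<^bsub>Sec A U\<^esub> (x \<oplus>\<^bsub>Sec A U\<^esub> x)"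
    by (rule smult_r_distr[OF c x x, symmetric])
  also have "\<dots> = \<zero>\<^bsub>Sec A U\<^esub>"
    using xx smult_r_null[OF c] by simp
  finally show ?thesis .
qed

end

lemma (in sheaf_of_sets) separated:
  assumes U: "openin T U" and s: "s \<in> S U" and t: "t \<in> S U"
    and loc: "\<And>x. x \<in> U \<Longrightarrow> \<exists>V. openin T V \<and> x \<in> V \<and> V \<subseteq> U \<and> \<rho> U V s = \<rho> U V t"
  shows "s = t"
proof -
  define C where "C = {V. openin T V \<and> V \<subseteq> U \<and> \<rho> U V s = \<rho> U V t}"
  have UC: "\<Union>C = U"
    unfolding C_def using loc by auto
  have "\<exists>!t. t \<in> S (\<Union>C) \<and> (\<forall>V\<in>C. \<rho> (\<Union>C) V t = \<rho> U V s)"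
  proof (rule glue)
    fix V assume "V \<in> C"
    then have V: "openin T V" "V \<subseteq> U"
      by (auto simp: C_def)
    then show "openin T V" "\<rho> U V s \<in> S V"
      using res_closed[OF U _ _ s] by blast+
  next
    fix V W assume "V \<in> C" "W \<in> C"
    then have "openin T V" "V \<subseteq> U" "openin T W" "W \<subseteq> U"
      by (auto simp: C_def)
    then show "\<rho> V (V \<inter> W) (\<rho> U V s) = \<rho> W (V \<inter> W) (\<rho> U W s)"
      using res_comp[OF U _ _ _ _ s] by (metis Int_lower1 Int_lower2 openin_Int)
  qed
  moreover have "\<forall>V\<in>C. \<rho> U V t = \<rho> U V s"
    by (auto simp: C_def)
  ultimately show ?thesis
    using s t UC by metis
qed

context sheaf_of_modules
begin

abbreviation restr :: "'x set \<Rightarrow> 'm \<Rightarrow> 'm" where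
  "restr U \<equiv> Res E (topspace T) U"

lemma restr_closed: "\<lbrakk>openin T U; t \<in> carrier (Sec E (topspace T))\<rbrakk> \<Longrightarrow> restr U t \<in> carrier (Sec E U)"
  by (meson E.res_closed openin_subset openin_topspace)

lemma restr_restr: "\<lbrakk>openin T U; openin T V; V \<subseteq> U; t \<in> carrier (Sec E (topspace T))\<rbrakk>
    \<Longrightarrow> Res E U V (restr U t) = restr V t"
  by (meson E.res_comp openin_subset openin_topspace)

lemma res_zero_module:
  assumes "openin T U" "openin T V" "V \<subseteq> U"
  shows "Res E U V \<zero>\<^bsub>Sec E U\<^esub> = \<zero>\<^bsub>Sec E V\<^esub>"
proof -
  interpret U: module "Sec A U" "Sec E U" by (rule sec_module) fact
  interpret V: module "Sec A V" "Sec E V" by (rule sec_module) fact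
  have "Res E U V \<zero>\<^bsub>Sec E U\<^esub> \<oplus>\<^bsub>Sec E V\<^esub> Res E U V \<zero>\<^bsub>Sec E U\<^esub> = Res E U V \<zero>\<^bsub>Sec E U\<^esub>"
    using res_add[OF assms, of "\<zero>\<^bsub>Sec E U\<^esub>" "\<zero>\<^bsub>Sec E U\<^esub>"] by simp
  then show ?thesis
    using E.res_closed[OF assms U.M.zero_closed] by simp
qed

lemma zero_ring_imp_zero_module:
  assumes one: "\<one>\<^bsub>Sec A (topspace T)\<^esub> = \<zero>\<^bsub>Sec A (topspace T)\<^esub>" and U: "openin T U"
  shows "carrier (Sec E U) = {\<zero>\<^bsub>Sec E U\<^esub>}"
proof -
  interpret module "Sec A U" "Sec E U" by (rule sec_module[OF U])
  have *: "\<one>\<^bsub>Sec A U\<^esub> = \<zero>\<^bsub>Sec A U\<^esub>"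
    using res_zero[OF openin_topspace U openin_subset[OF U]]
      res_one[OF openin_topspace U openin_subset[OF U]] one by simp
  have "x = \<zero>\<^bsub>Sec E U\<^esub>" if "x \<in> carrier (Sec E U)" for x
    using smult_one[OF that] smult_l_null[OF that] * by simp
  then show ?thesis by auto
qed

definition lincomb :: "'x set \<Rightarrow> 'i set \<Rightarrow> ('i \<Rightarrow> 'a) \<Rightarrow> ('i \<Rightarrow> 'm) \<Rightarrow> 'm" where
  "lincomb U J c h = (\<Oplus>\<^bsub>Sec E U\<^esub>i\<in>J. c i \<odot>\<^bsub>Sec E U\<^esub> restr U (h i))"

text \<open>Coefficients over every open set are tested, not only global ones.  This is the condition under
  which finitely many global sections are a basis of the sheaf that they span.\<close>

definition lin_indep :: "'i set \<Rightarrow> ('i \<Rightarrow> 'm) \<Rightarrow> bool" where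
  "lin_indep J h \<longleftrightarrow> (\<forall>U c. openin T U \<longrightarrow> c \<in> J \<rightarrow> carrier (Sec A U) \<longrightarrow>
     lincomb U J c h = \<zero>\<^bsub>Sec E U\<^esub> \<longrightarrow> (\<forall>i\<in>J. c i = \<zero>\<^bsub>Sec A U\<^esub>))"

definition span_sheaf :: "'i set \<Rightarrow> ('i \<Rightarrow> 'm) \<Rightarrow> 'x set \<Rightarrow> 'm set" where
  "span_sheaf J h U = {lincomb U J c h |c. c \<in> J \<rightarrow> carrier (Sec A U)}"

lemma res_finsum:
  assumes U: "openin T U" and V: "openin T V" and VU: "V \<subseteq> U" and "finite K"
    and g: "g \<in> K \<rightarrow> carrier (Sec E U)"
  shows "Res E U V (\<Oplus>\<^bsub>Sec E U\<^esub>i\<in>K. g i) = (\<Oplus>\<^bsub>Sec E V\<^esub>i\<in>K. Res E U V (g i))"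
  using \<open>finite K\<close> g
proof (induction K)
  case empty
  interpret U: module "Sec A U" "Sec E U" by (rule sec_module[OF U])
  interpret V: module "Sec A V" "Sec E V" by (rule sec_module[OF V])
  show ?case using res_zero_module[OF U V VU] by simp
next
  case (insert i K)
  interpret U: module "Sec A U" "Sec E U" by (rule sec_module[OF U])
  interpret V: module "Sec A V" "Sec E V" by (rule sec_module[OF V])
  have "(\<lambda>i. Res E U V (g i)) \<in> K \<rightarrow> carrier (Sec E V)"
    using insert.prems E.res_closed[OF U V VU] by auto
  then show ?case
    using insert E.res_closed[OF U V VU] by (simp add: res_add[OF U V VU] Pi_iff)
qed

context
  fixes J :: "'i set" and h :: "'i \<Rightarrow> 'm"
  assumes J: "finite J" and h: "h \<in> J \<rightarrow> carrier (Sec E (topspace T))"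
begin

lemma lincomb_term_closed:
  assumes U: "openin T U" and c: "c \<in> J \<rightarrow> carrier (Sec A U)"
  shows "(\<lambda>i. c i \<odot>\<^bsub>Sec E U\<^esub> restr U (h i)) \<in> J \<rightarrow> carrier (Sec E U)"
proof
  fix i assume "i \<in> J"
  then show "c i \<odot>\<^bsub>Sec E U\<^esub> restr U (h i) \<in> carrier (Sec E U)"
    using c h restr_closed[OF U] module.smult_closed[OF sec_module[OF U]] by (simp add: Pi_iff)
qed

lemma lincomb_closed:
  assumes U: "openin T U" and c: "c \<in> J \<rightarrow> carrier (Sec A U)"
  shows "lincomb U J c h \<in> carrier (Sec E U)"
proof -
  interpret module "Sec A U" "Sec E U" by (rule sec_module[OF U])
  show ?thesis
    unfolding lincomb_def by (rule M.finsum_closed[OF lincomb_term_closed[OF U c]])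
qed

lemma lincomb_cong:
  assumes U: "openin T U" and c: "c \<in> J \<rightarrow> carrier (Sec A U)" and "\<And>i. i \<in> J \<Longrightarrow> d i = c i"
  shows "lincomb U J d h = lincomb U J c h"
proof -
  interpret module "Sec A U" "Sec E U" by (rule sec_module[OF U])
  show ?thesis
    unfolding lincomb_def
    by (rule M.finsum_cong') (use assms lincomb_term_closed[OF U c] in auto)
qed

lemma lincomb_family_cong:
  assumes U: "openin T U" and c: "c \<in> J \<rightarrow> carrier (Sec A U)" and eq: "\<And>i. i \<in> J \<Longrightarrow> h' i = h i"
  shows "lincomb U J c h' = lincomb U J c h"
proof -
  interpret module "Sec A U" "Sec E U" by (rule sec_module[OF U])
  show ?thesis
    unfolding lincomb_def
    by (rule M.finsum_cong') (use eq lincomb_term_closed[OF U c] in auto)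
qed

lemma lincomb_add:
  assumes U: "openin T U" and c: "c \<in> J \<rightarrow> carrier (Sec A U)" and d: "d \<in> J \<rightarrow> carrier (Sec A U)"
  shows "lincomb U J (\<lambda>i. c i \<oplus>\<^bsub>Sec A U\<^esub> d i) h = lincomb U J c h \<oplus>\<^bsub>Sec E U\<^esub> lincomb U J d h"
proof -
  interpret module "Sec A U" "Sec E U" by (rule sec_module[OF U])
  note cl = lincomb_term_closed[OF U c] lincomb_term_closed[OF U d]
  have "lincomb U J c h \<oplus>\<^bsub>Sec E U\<^esub> lincomb U J d h =
      (\<Oplus>\<^bsub>Sec E U\<^esub>i\<in>J. c i \<odot>\<^bsub>Sec E U\<^esub> restr U (h i) \<oplus>\<^bsub>Sec E U\<^esub> d i \<odot>\<^bsub>Sec E U\<^esub> restr U (h i))"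
    unfolding lincomb_def using cl by (subst M.finsum_addf) auto
  also have "\<dots> = lincomb U J (\<lambda>i. c i \<oplus>\<^bsub>Sec A U\<^esub> d i) h"
    unfolding lincomb_def
    by (rule M.finsum_cong')
      (use c d h cl U in \<open>auto simp: smult_l_distr restr_closed Pi_iff\<close>)
  finally show ?thesis by simp
qed

lemma lincomb_smult:
  assumes U: "openin T U" and a: "a \<in> carrier (Sec A U)" and c: "c \<in> J \<rightarrow> carrier (Sec A U)"
  shows "lincomb U J (\<lambda>i. a \<otimes>\<^bsub>Sec A U\<^esub> c i) h = a \<odot>\<^bsub>Sec E U\<^esub> lincomb U J c h"
proof -
  interpret module "Sec A U" "Sec E U" by (rule sec_module[OF U])
  note cl = lincomb_term_closed[OF U c]
  have "a \<odot>\<^bsub>Sec E U\<^esub> lincomb U J c h =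
      (\<Oplus>\<^bsub>Sec E U\<^esub>i\<in>J. a \<odot>\<^bsub>Sec E U\<^esub> (c i \<odot>\<^bsub>Sec E U\<^esub> restr U (h i)))"
    unfolding lincomb_def using cl a J by (subst finsum_smult_ldistr) auto
  also have "\<dots> = lincomb U J (\<lambda>i. a \<otimes>\<^bsub>Sec A U\<^esub> c i) h"
    unfolding lincomb_def
    by (rule M.finsum_cong')
      (use a c h cl U in \<open>auto simp: smult_assoc1 restr_closed Pi_iff\<close>)
  finally show ?thesis by simp
qed

lemma lincomb_zero:
  assumes U: "openin T U"
  shows "lincomb U J (\<lambda>i. \<zero>\<^bsub>Sec A U\<^esub>) h = \<zero>\<^bsub>Sec E U\<^esub>"
proof -
  interpret module "Sec A U" "Sec E U" by (rule sec_module[OF U])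
  have "lincomb U J (\<lambda>i. \<zero>\<^bsub>Sec A U\<^esub> \<otimes>\<^bsub>Sec A U\<^esub> \<zero>\<^bsub>Sec A U\<^esub>) h = \<zero>\<^bsub>Sec E U\<^esub>"
    using lincomb_closed[OF U, of "\<lambda>i. \<zero>\<^bsub>Sec A U\<^esub>"]
    by (subst lincomb_smult[OF U]) auto
  then show ?thesis by simp
qed

lemma lincomb_diff:
  assumes U: "openin T U" and c: "c \<in> J \<rightarrow> carrier (Sec A U)" and d: "d \<in> J \<rightarrow> carrier (Sec A U)"
  shows "lincomb U J (\<lambda>i. c i \<ominus>\<^bsub>Sec A U\<^esub> d i) h = lincomb U J c h \<ominus>\<^bsub>Sec E U\<^esub> lincomb U J d h"
proof -
  interpret module "Sec A U" "Sec E U" by (rule sec_module[OF U])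
  have "lincomb U J (\<lambda>i. c i \<ominus>\<^bsub>Sec A U\<^esub> d i) h \<oplus>\<^bsub>Sec E U\<^esub> lincomb U J d h =
      lincomb U J (\<lambda>i. (c i \<ominus>\<^bsub>Sec A U\<^esub> d i) \<oplus>\<^bsub>Sec A U\<^esub> d i) h"
    using c d by (intro lincomb_add[OF U, symmetric]) auto
  also have "\<dots> = lincomb U J c h"
    by (rule lincomb_cong[OF U c]) (use c d in \<open>auto simp: Pi_iff R.minus_eq R.a_assoc R.l_neg\<close>)
  finally have *: "lincomb U J (\<lambda>i. c i \<ominus>\<^bsub>Sec A U\<^esub> d i) h \<oplus>\<^bsub>Sec E U\<^esub> lincomb U J d h = lincomb U J c h" .
  have "lincomb U J (\<lambda>i. c i \<ominus>\<^bsub>Sec A U\<^esub> d i) h \<in> carrier (Sec E U)"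
    using c d by (intro lincomb_closed[OF U]) auto
  then show ?thesis
    using lincomb_closed[OF U d] by (simp add: M.minus_eq M.a_assoc M.r_neg flip: *)
qed

lemma res_lincomb:
  assumes U: "openin T U" and V: "openin T V" and VU: "V \<subseteq> U" and c: "c \<in> J \<rightarrow> carrier (Sec A U)"
  shows "Res E U V (lincomb U J c h) = lincomb V J (\<lambda>i. Res A U V (c i)) h"
proof -
  interpret V: module "Sec A V" "Sec E V" by (rule sec_module[OF V])
  have cV: "(\<lambda>i. Res A U V (c i)) \<in> J \<rightarrow> carrier (Sec A V)"
    using c res_closed[OF U V VU] by auto
  have "Res E U V (lincomb U J c h) =
      (\<Oplus>\<^bsub>Sec E V\<^esub>i\<in>J. Res E U V (c i \<odot>\<^bsub>Sec E U\<^esub> restr U (h i)))"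
    unfolding lincomb_def by (rule res_finsum[OF U V VU J lincomb_term_closed[OF U c]])
  also have "\<dots> = lincomb V J (\<lambda>i. Res A U V (c i)) h"
    unfolding lincomb_def
    by (rule V.M.finsum_cong')
      (use c h lincomb_term_closed[OF V cV] U in
        \<open>auto simp: res_smult[OF U V VU] restr_closed Pi_iff restr_restr[OF U V VU]\<close>)
  finally show ?thesis .
qed

end

lemma lincomb_singleton:
  assumes U: "openin T U" and "c i \<in> carrier (Sec A U)" "h i \<in> carrier (Sec E (topspace T))"
  shows "lincomb U {i} c h = c i \<odot>\<^bsub>Sec E U\<^esub> restr U (h i)"
proof -
  interpret module "Sec A U" "Sec E U" by (rule sec_module[OF U])
  show ?thesis
    unfolding lincomb_def using assms restr_closed[OF U] by simp
qed

lemma lincomb_insert: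
  assumes J: "finite J" "j \<notin> J" and h: "h \<in> insert j J \<rightarrow> carrier (Sec E (topspace T))"
    and U: "openin T U" and c: "c \<in> insert j J \<rightarrow> carrier (Sec A U)"
  shows "lincomb U (insert j J) c h = c j \<odot>\<^bsub>Sec E U\<^esub> restr U (h j) \<oplus>\<^bsub>Sec E U\<^esub> lincomb U J c h"
proof -
  interpret module "Sec A U" "Sec E U" by (rule sec_module[OF U])
  show ?thesis
    unfolding lincomb_def using lincomb_term_closed[of "insert j J" h U c] assms
    by (subst M.finsum_insert) (auto simp: Pi_iff)
qed

lemma lincomb_empty: "openin T U \<Longrightarrow> lincomb U {} c h = \<zero>\<^bsub>Sec E U\<^esub>"
proof -
  assume U: "openin T U"
  interpret module "Sec A U" "Sec E U" by (rule sec_module[OF U])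
  show ?thesis by (simp add: lincomb_def)
qed

lemma lincomb_mono_neutral:
  assumes K: "finite K" "J \<subseteq> K" and h: "h \<in> K \<rightarrow> carrier (Sec E (topspace T))"
    and U: "openin T U" and c: "c \<in> J \<rightarrow> carrier (Sec A U)"
  shows "lincomb U K (\<lambda>i. if i \<in> J then c i else \<zero>\<^bsub>Sec A U\<^esub>) h = lincomb U J c h"
proof -
  interpret module "Sec A U" "Sec E U" by (rule sec_module[OF U])
  show ?thesis
    unfolding lincomb_def
    using assms restr_closed[OF U] by (intro M.add.finprod_mono_neutral_cong_right) (auto simp: Pi_iff)
qed

lemma lin_indep_subset:
  assumes K: "finite K" "J \<subseteq> K" and h: "h \<in> K \<rightarrow> carrier (Sec E (topspace T))"
    and ind: "lin_indep K h"
  shows "lin_indep J h"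
  unfolding lin_indep_def
proof (intro allI impI)
  fix U c
  assume U: "openin T U" and c: "c \<in> J \<rightarrow> carrier (Sec A U)" and 0: "lincomb U J c h = \<zero>\<^bsub>Sec E U\<^esub>"
  interpret module "Sec A U" "Sec E U" by (rule sec_module[OF U])
  let ?c = "\<lambda>i. if i \<in> J then c i else \<zero>\<^bsub>Sec A U\<^esub>"
  have "?c \<in> K \<rightarrow> carrier (Sec A U)" using c by auto
  moreover have "lincomb U K ?c h = \<zero>\<^bsub>Sec E U\<^esub>"
    using lincomb_mono_neutral[OF K h U c] 0 by simp
  ultimately have "\<forall>i\<in>K. ?c i = \<zero>\<^bsub>Sec A U\<^esub>"
    using ind U unfolding lin_indep_def by blast
  then show "\<forall>i\<in>J. c i = \<zero>\<^bsub>Sec A U\<^esub>" using K(2) by (metis subsetD)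
qed

lemma lin_indep_singletonI:
  assumes "h i \<in> carrier (Sec E (topspace T))"
    and "\<And>U a. \<lbrakk>openin T U; a \<in> carrier (Sec A U); a \<odot>\<^bsub>Sec E U\<^esub> restr U (h i) = \<zero>\<^bsub>Sec E U\<^esub>\<rbrakk> \<Longrightarrow> a = \<zero>\<^bsub>Sec A U\<^esub>"
  shows "lin_indep {i} h"
  unfolding lin_indep_def
proof (intro allI impI ballI)
  fix U c j
  assume U: "openin T U" and c: "c \<in> {i} \<rightarrow> carrier (Sec A U)"
    and 0: "lincomb U {i} c h = \<zero>\<^bsub>Sec E U\<^esub>" and j: "j \<in> {i}"
  have "c i \<in> carrier (Sec A U)" using c by simp
  with assms(2)[OF U this] 0 j show "c j = \<zero>\<^bsub>Sec A U\<^esub>"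
    using lincomb_singleton[of U c i h] U assms(1) by simp
qed

lemma span_sheaf_singleton:
  assumes "openin T U" "h i \<in> carrier (Sec E (topspace T))"
  shows "span_sheaf {i} h U = {a \<odot>\<^bsub>Sec E U\<^esub> restr U (h i) |a. a \<in> carrier (Sec A U)}"
  unfolding span_sheaf_def
proof (intro subset_antisym subsetI)
  fix x assume "x \<in> {a \<odot>\<^bsub>Sec E U\<^esub> restr U (h i) |a. a \<in> carrier (Sec A U)}"
  then obtain a where a: "x = a \<odot>\<^bsub>Sec E U\<^esub> restr U (h i)" "a \<in> carrier (Sec A U)" by blast
  then have "x = lincomb U {i} (\<lambda>_. a) h"
    using assms by (subst lincomb_singleton) auto
  then show "x \<in> {lincomb U {i} c h |c. c \<in> {i} \<rightarrow> carrier (Sec A U)}" using a by auto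
qed (use assms in \<open>auto simp: lincomb_singleton\<close>)

end

lemma (in sheaf_of_modules) lincomb_induct:
  assumes U: "openin T U" and J: "finite J" and h: "h \<in> J \<rightarrow> carrier (Sec E (topspace T))"
    and c: "c \<in> J \<rightarrow> carrier (Sec A U)"
    and zero: "\<zero>\<^bsub>Sec E U\<^esub> \<in> N"
    and add: "\<And>s t. \<lbrakk>s \<in> N; t \<in> N\<rbrakk> \<Longrightarrow> s \<oplus>\<^bsub>Sec E U\<^esub> t \<in> N"
    and smult: "\<And>a s. \<lbrakk>a \<in> carrier (Sec A U); s \<in> N\<rbrakk> \<Longrightarrow> a \<odot>\<^bsub>Sec E U\<^esub> s \<in> N"
    and gen: "\<And>i. i \<in> J \<Longrightarrow> restr U (h i) \<in> N"
  shows "lincomb U J c h \<in> N"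
  using J h c gen
proof (induction J rule: finite_induct)
  case empty
  show ?case using zero by (simp add: lincomb_empty[OF U])
next
  case (insert j J)
  have "c j \<odot>\<^bsub>Sec E U\<^esub> restr U (h j) \<oplus>\<^bsub>Sec E U\<^esub> lincomb U J c h \<in> N"
    using insert by (intro add smult) auto
  then show ?case
    using lincomb_insert[OF insert.hyps insert.prems(1) U insert.prems(2)] by simp
qed

section \<open>Submodules spanned by independent families\<close>

lemma (in algebraized_space) direct_sum_carrier_finite:
  assumes "finite I" and "openin T U"
  shows "carrier (Sec (direct_sum T A I) U) = (I \<rightarrow>\<^sub>E carrier (Sec A U))"
  using assms by (auto simp: direct_sum_def)

context sheaf_of_modules
begin

lemma lin_indepD:
  "\<lbrakk>lin_indep J h; openin T U; c \<in> J \<rightarrow> carrier (Sec A U); lincomb U J c h = \<zero>\<^bsub>Sec E U\<^esub>; i \<in> J\<rbrakk>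
    \<Longrightarrow> c i = \<zero>\<^bsub>Sec A U\<^esub>"
  unfolding lin_indep_def by simp

lemma lin_indep_lincomb_inj:
  assumes J: "finite J" and h: "h \<in> J \<rightarrow> carrier (Sec E (topspace T))" and ind: "lin_indep J h"
    and U: "openin T U" and c: "c \<in> J \<rightarrow> carrier (Sec A U)" and d: "d \<in> J \<rightarrow> carrier (Sec A U)"
    and eq: "lincomb U J c h = lincomb U J d h" and i: "i \<in> J"
  shows "c i = d i"
proof -
  interpret module "Sec A U" "Sec E U" by (rule sec_module[OF U])
  have "lincomb U J (\<lambda>i. c i \<ominus>\<^bsub>Sec A U\<^esub> d i) h = \<zero>\<^bsub>Sec E U\<^esub>"
    using lincomb_diff[OF J h U c d] lincomb_closed[OF J h U d] eq by (simp add: M.minus_eq M.r_neg)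
  moreover have "(\<lambda>i. c i \<ominus>\<^bsub>Sec A U\<^esub> d i) \<in> J \<rightarrow> carrier (Sec A U)"
    using c d by auto
  ultimately have "c i \<ominus>\<^bsub>Sec A U\<^esub> d i = \<zero>\<^bsub>Sec A U\<^esub>"
    using ind U i unfolding lin_indep_def by blast
  then show ?thesis
    using c d i by (simp add: Pi_iff)
qed

lemma span_sheafI: "c \<in> J \<rightarrow> carrier (Sec A U) \<Longrightarrow> lincomb U J c h \<in> span_sheaf J h U"
  by (auto simp: span_sheaf_def)

lemma span_sheafE:
  assumes "x \<in> span_sheaf J h U"
  obtains c where "c \<in> J \<rightarrow> carrier (Sec A U)" "x = lincomb U J c h"
  using assms by (auto simp: span_sheaf_def)

lemma submodule_span_sheaf:
  assumes J: "finite J" and h: "h \<in> J \<rightarrow> carrier (Sec E (topspace T))" and U: "openin T U"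
  shows "submodule (span_sheaf J h U) (Sec A U) (Sec E U)"
proof -
  interpret module "Sec A U" "Sec E U" by (rule sec_module[OF U])
  note cl = lincomb_closed[OF J h U]
  have smult: "a \<odot>\<^bsub>Sec E U\<^esub> x \<in> span_sheaf J h U"
    if a: "a \<in> carrier (Sec A U)" and x: "x \<in> span_sheaf J h U" for a x
  proof -
    obtain c where c: "c \<in> J \<rightarrow> carrier (Sec A U)" "x = lincomb U J c h"
      using span_sheafE[OF x] .
    have "(\<lambda>i. a \<otimes>\<^bsub>Sec A U\<^esub> c i) \<in> J \<rightarrow> carrier (Sec A U)" using a c by auto
    from span_sheafI[OF this, of h] show ?thesis
      using lincomb_smult[OF J h U a c(1)] c(2) by simp
  qed
  show ?thesis
  proof (rule submoduleI)
    show "span_sheaf J h U \<subseteq> carrier (Sec E U)"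
      using cl by (auto simp: span_sheaf_def)
    show "\<zero>\<^bsub>Sec E U\<^esub> \<in> span_sheaf J h U"
      using span_sheafI[of "\<lambda>i. \<zero>\<^bsub>Sec A U\<^esub>" J U h] lincomb_zero[OF J h U] by simp
  next
    fix x assume x: "x \<in> span_sheaf J h U"
    then have "x \<in> carrier (Sec E U)" using cl by (auto simp: span_sheaf_def)
    then have "\<ominus>\<^bsub>Sec E U\<^esub> x = (\<ominus>\<^bsub>Sec A U\<^esub> \<one>\<^bsub>Sec A U\<^esub>) \<odot>\<^bsub>Sec E U\<^esub> x"
      by (simp add: smult_l_minus)
    then show "\<ominus>\<^bsub>Sec E U\<^esub> x \<in> span_sheaf J h U"
      using smult[OF _ x] by simp
  next
    fix x y assume x: "x \<in> span_sheaf J h U" and y: "y \<in> span_sheaf J h U"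
    obtain c where c: "c \<in> J \<rightarrow> carrier (Sec A U)" "x = lincomb U J c h"
      using span_sheafE[OF x] .
    obtain d where d: "d \<in> J \<rightarrow> carrier (Sec A U)" "y = lincomb U J d h"
      using span_sheafE[OF y] .
    have "(\<lambda>i. c i \<oplus>\<^bsub>Sec A U\<^esub> d i) \<in> J \<rightarrow> carrier (Sec A U)" using c d by auto
    from span_sheafI[OF this, of h] show "x \<oplus>\<^bsub>Sec E U\<^esub> y \<in> span_sheaf J h U"
      using lincomb_add[OF J h U c(1) d(1)] c(2) d(2) by simp
  qed (rule smult)
qed

text \<open>By independence the coefficients of compatible sections agree on overlaps, so they glue, and
  with them the sections.  This is why combinations over each open set need no sheafification.\<close>

lemma span_sheaf_is_sheaf:
  assumes J: "finite J" and h: "h \<in> J \<rightarrow> carrier (Sec E (topspace T))" and ind: "lin_indep J h"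
  shows "sheaf_of_sets T (span_sheaf J h) (Res E)"
proof
  have sub: "span_sheaf J h U \<subseteq> carrier (Sec E U)" if "openin T U" for U
    using lincomb_closed[OF J h that] by (auto simp: span_sheaf_def)
  show closed: "Res E U V s \<in> span_sheaf J h V"
    if UV: "openin T U" "openin T V" "V \<subseteq> U" and s: "s \<in> span_sheaf J h U" for U V s
  proof -
    obtain c where c: "c \<in> J \<rightarrow> carrier (Sec A U)" "s = lincomb U J c h"
      using span_sheafE[OF s] .
    have "(\<lambda>i. Res A U V (c i)) \<in> J \<rightarrow> carrier (Sec A V)"
      using c res_closed[OF UV] by auto
    from span_sheafI[OF this, of h] show ?thesis
      using res_lincomb[OF J h UV c(1)] c(2) by simp
  qed
  show "Res E U U s = s" if "openin T U" "s \<in> span_sheaf J h U" for U s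
    using that sub E.res_id by blast
  show "Res E V W (Res E U V s) = Res E U W s"
    if "openin T U" "openin T V" "openin T W" "W \<subseteq> V" "V \<subseteq> U" "s \<in> span_sheaf J h U" for U V W s
    using that sub E.res_comp by blast
  fix C f
  assume C: "\<And>V. V \<in> C \<Longrightarrow> openin T V" and f: "\<And>V. V \<in> C \<Longrightarrow> f V \<in> span_sheaf J h V"
    and compat: "\<And>V W. \<lbrakk>V \<in> C; W \<in> C\<rbrakk> \<Longrightarrow> Res E V (V \<inter> W) (f V) = Res E W (V \<inter> W) (f W)"
  have UC: "openin T (\<Union>C)" using C by blast
  have "\<forall>V\<in>C. \<exists>c. c \<in> J \<rightarrow> carrier (Sec A V) \<and> f V = lincomb V J c h"
    using f unfolding span_sheaf_def by blast
  then obtain c where c: "\<And>V. V \<in> C \<Longrightarrow> c V \<in> J \<rightarrow> carrier (Sec A V)"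
    and fc: "\<And>V. V \<in> C \<Longrightarrow> f V = lincomb V J (c V) h"
    by metis
  have "\<exists>d. d \<in> carrier (Sec A (\<Union>C)) \<and> (\<forall>V\<in>C. Res A (\<Union>C) V d = c V i)" if i: "i \<in> J" for i
  proof -
    have "\<exists>!d. d \<in> carrier (Sec A (\<Union>C)) \<and> (\<forall>V\<in>C. Res A (\<Union>C) V d = c V i)"
    proof (rule glue)
      fix V assume "V \<in> C"
      then show "openin T V" "c V i \<in> carrier (Sec A V)" using C c i by auto
    next
      fix V W assume V: "V \<in> C" and W: "W \<in> C"
      have VW: "openin T (V \<inter> W)" using C V W by blast
      have "lincomb (V \<inter> W) J (\<lambda>i. Res A V (V \<inter> W) (c V i)) h =
            lincomb (V \<inter> W) J (\<lambda>i. Res A W (V \<inter> W) (c W i)) h"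
        using compat[OF V W] fc[OF V] fc[OF W]
          res_lincomb[OF J h C[OF V] VW _ c[OF V]] res_lincomb[OF J h C[OF W] VW _ c[OF W]] by simp
      moreover have "(\<lambda>i. Res A V (V \<inter> W) (c V i)) \<in> J \<rightarrow> carrier (Sec A (V \<inter> W))"
          "(\<lambda>i. Res A W (V \<inter> W) (c W i)) \<in> J \<rightarrow> carrier (Sec A (V \<inter> W))"
        using res_closed[OF C[OF V] VW] res_closed[OF C[OF W] VW] c[OF V] c[OF W] by auto
      ultimately show "Res A V (V \<inter> W) (c V i) = Res A W (V \<inter> W) (c W i)"
        using lin_indep_lincomb_inj[OF J h ind VW _ _ _ i] by blast
    qed
    then show ?thesis by blast
  qed
  then obtain d where d: "\<And>i. i \<in> J \<Longrightarrow> d i \<in> carrier (Sec A (\<Union>C))"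
    and dc: "\<And>i V. i \<in> J \<Longrightarrow> V \<in> C \<Longrightarrow> Res A (\<Union>C) V (d i) = c V i"
    by metis
  have dP: "d \<in> J \<rightarrow> carrier (Sec A (\<Union>C))" using d by blast
  have res_t: "Res E (\<Union>C) V (lincomb (\<Union>C) J d h) = f V" if V: "V \<in> C" for V
  proof -
    have "Res E (\<Union>C) V (lincomb (\<Union>C) J d h) = lincomb V J (\<lambda>i. Res A (\<Union>C) V (d i)) h"
      using V by (intro res_lincomb[OF J h UC C[OF V] _ dP]) blast
    also have "\<dots> = f V"
      using lincomb_cong[OF J h C[OF V] c[OF V]] dc[OF _ V] fc[OF V] by metis
    finally show ?thesis .
  qed
  show "\<exists>!t. t \<in> span_sheaf J h (\<Union>C) \<and> (\<forall>V\<in>C. Res E (\<Union>C) V t = f V)"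
  proof (rule ex1I)
    show "lincomb (\<Union>C) J d h \<in> span_sheaf J h (\<Union>C) \<and>
        (\<forall>V\<in>C. Res E (\<Union>C) V (lincomb (\<Union>C) J d h) = f V)"
      using span_sheafI[OF dP] res_t by blast
  next
    fix t assume t: "t \<in> span_sheaf J h (\<Union>C) \<and> (\<forall>V\<in>C. Res E (\<Union>C) V t = f V)"
    show "t = lincomb (\<Union>C) J d h"
    proof (rule E.separated[OF UC])
      show "t \<in> carrier (Sec E (\<Union>C))" using t sub[OF UC] by blast
      show "lincomb (\<Union>C) J d h \<in> carrier (Sec E (\<Union>C))" by (rule lincomb_closed[OF J h UC dP])
      fix x assume "x \<in> \<Union>C"
      then obtain V where "V \<in> C" "x \<in> V" by blast
      then show "\<exists>V. openin T V \<and> x \<in> V \<and> V \<subseteq> \<Union>C \<and>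
          Res E (\<Union>C) V t = Res E (\<Union>C) V (lincomb (\<Union>C) J d h)"
        using C t res_t by (intro exI[of _ V]) auto
    qed
  qed
qed

lemma free_submodule_span_sheaf:
  fixes J :: "'m set"
  assumes J: "finite J" and h: "h \<in> J \<rightarrow> carrier (Sec E (topspace T))" and ind: "lin_indep J h"
  shows "free_submodule T A E (span_sheaf J h)"
proof -
  let ?\<tau> = "\<lambda>U f. lincomb U J f h"
  have "sheaf_iso T A (direct_sum T A J) (sub_sheaf E (span_sheaf J h)) ?\<tau>"
    unfolding sheaf_iso_def sheaf_morphism_def
  proof (intro conjI allI impI ballI)
    fix U assume U: "openin T U"
    interpret module "Sec A U" "Sec E U" by (rule sec_module[OF U])
    note ds = direct_sum_carrier_finite[OF J U]
    show "?\<tau> U \<in> carrier (Sec (direct_sum T A J) U) \<rightarrow> carrier (Sec (sub_sheaf E (span_sheaf J h)) U)"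
      using span_sheafI by (auto simp: ds sub_sheaf_def PiE_def)
    show "?\<tau> U (s \<oplus>\<^bsub>Sec (direct_sum T A J) U\<^esub> t) =
        ?\<tau> U s \<oplus>\<^bsub>Sec (sub_sheaf E (span_sheaf J h)) U\<^esub> ?\<tau> U t"
      if s: "s \<in> carrier (Sec (direct_sum T A J) U)" and t: "t \<in> carrier (Sec (direct_sum T A J) U)" for s t
    proof -
      have st: "s \<in> J \<rightarrow> carrier (Sec A U)" "t \<in> J \<rightarrow> carrier (Sec A U)"
        using s t by (auto simp: ds PiE_def)
      then have "(\<lambda>i. s i \<oplus>\<^bsub>Sec A U\<^esub> t i) \<in> J \<rightarrow> carrier (Sec A U)" by auto
      then have "?\<tau> U (\<lambda>i\<in>J. s i \<oplus>\<^bsub>Sec A U\<^esub> t i) = ?\<tau> U (\<lambda>i. s i \<oplus>\<^bsub>Sec A U\<^esub> t i)"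
        by (rule lincomb_cong[OF J h U]) simp
      then show ?thesis
        using lincomb_add[OF J h U st] by (simp add: direct_sum_def sub_sheaf_def)
    qed
    show "?\<tau> U (a \<odot>\<^bsub>Sec (direct_sum T A J) U\<^esub> s) = a \<odot>\<^bsub>Sec (sub_sheaf E (span_sheaf J h)) U\<^esub> ?\<tau> U s"
      if a: "a \<in> carrier (Sec A U)" and s: "s \<in> carrier (Sec (direct_sum T A J) U)" for a s
    proof -
      have s: "s \<in> J \<rightarrow> carrier (Sec A U)"
        using s by (auto simp: ds PiE_def)
      then have "(\<lambda>i. a \<otimes>\<^bsub>Sec A U\<^esub> s i) \<in> J \<rightarrow> carrier (Sec A U)" using a by auto
      then have "?\<tau> U (\<lambda>i\<in>J. a \<otimes>\<^bsub>Sec A U\<^esub> s i) = ?\<tau> U (\<lambda>i. a \<otimes>\<^bsub>Sec A U\<^esub> s i)"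
        by (rule lincomb_cong[OF J h U]) simp
      then show ?thesis
        using lincomb_smult[OF J h U a s] by (simp add: direct_sum_def sub_sheaf_def)
    qed
    show "bij_betw (?\<tau> U) (carrier (Sec (direct_sum T A J) U)) (carrier (Sec (sub_sheaf E (span_sheaf J h)) U))"
      unfolding bij_betw_def
    proof
      show "inj_on (?\<tau> U) (carrier (Sec (direct_sum T A J) U))"
      proof (rule inj_onI)
        fix c d assume cd: "c \<in> carrier (Sec (direct_sum T A J) U)" "d \<in> carrier (Sec (direct_sum T A J) U)"
          and eq: "?\<tau> U c = ?\<tau> U d"
        then have "c \<in> J \<rightarrow> carrier (Sec A U)" "d \<in> J \<rightarrow> carrier (Sec A U)"
          by (auto simp: ds PiE_def)
        then have "\<And>i. i \<in> J \<Longrightarrow> c i = d i"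
          using lin_indep_lincomb_inj[OF J h ind U _ _ eq] by blast
        then show "c = d" using cd by (auto simp: ds intro: PiE_ext)
      qed
      show "?\<tau> U ` carrier (Sec (direct_sum T A J) U) = carrier (Sec (sub_sheaf E (span_sheaf J h)) U)"
      proof (intro subset_antisym subsetI)
        fix x assume "x \<in> carrier (Sec (sub_sheaf E (span_sheaf J h)) U)"
        then have "x \<in> span_sheaf J h U" by (simp add: sub_sheaf_def)
        then obtain c where c: "c \<in> J \<rightarrow> carrier (Sec A U)" "x = lincomb U J c h"
          by (rule span_sheafE)
        have "x = ?\<tau> U (restrict c J)"
          using lincomb_cong[OF J h U c(1), of "restrict c J"] c(2) by simp
        moreover have "restrict c J \<in> carrier (Sec (direct_sum T A J) U)"
          using c(1) by (auto simp: ds)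
        ultimately show "x \<in> ?\<tau> U ` carrier (Sec (direct_sum T A J) U)" by blast
      qed (auto simp: ds sub_sheaf_def PiE_def intro: span_sheafI)
    qed
  next
    fix U V s
    assume UV: "openin T U \<and> openin T V \<and> V \<subseteq> U" and s: "s \<in> carrier (Sec (direct_sum T A J) U)"
    then have U: "openin T U" and V: "openin T V" and VU: "V \<subseteq> U" by auto
    have s: "s \<in> J \<rightarrow> carrier (Sec A U)"
      using s by (auto simp: direct_sum_carrier_finite[OF J U] PiE_def)
    have "(\<lambda>i. Res A U V (s i)) \<in> J \<rightarrow> carrier (Sec A V)"
      using res_closed[OF U V VU] s by auto
    then have "?\<tau> V (\<lambda>i\<in>J. Res A U V (s i)) = ?\<tau> V (\<lambda>i. Res A U V (s i))"
      by (rule lincomb_cong[OF J h V]) simp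
    then show "?\<tau> V (Res (direct_sum T A J) U V s) = Res (sub_sheaf E (span_sheaf J h)) U V (?\<tau> U s)"
      using res_lincomb[OF J h U V VU s] by (simp add: direct_sum_def sub_sheaf_def)
  qed
  then show ?thesis
    unfolding free_submodule_def sub_sheaf_of_modules_def free_sheaf_def
    using submodule_span_sheaf[OF J h] span_sheaf_is_sheaf[OF J h ind] by blast
qed

end

section \<open>Frames of free submodules\<close>

lemma
  assumes "sheaf_morphism T A E E' \<sigma>" and "openin T U"
  shows sheaf_morphism_closed: "s \<in> carrier (Sec E U) \<Longrightarrow> \<sigma> U s \<in> carrier (Sec E' U)"
    and sheaf_morphism_add: "\<lbrakk>s \<in> carrier (Sec E U); t \<in> carrier (Sec E U)\<rbrakk>
      \<Longrightarrow> \<sigma> U (s \<oplus>\<^bsub>Sec E U\<^esub> t) = \<sigma> U s \<oplus>\<^bsub>Sec E' U\<^esub> \<sigma> U t"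
    and sheaf_morphism_smult: "\<lbrakk>a \<in> carrier (Sec A U); s \<in> carrier (Sec E U)\<rbrakk>
      \<Longrightarrow> \<sigma> U (a \<odot>\<^bsub>Sec E U\<^esub> s) = a \<odot>\<^bsub>Sec E' U\<^esub> \<sigma> U s"
    and sheaf_morphism_res: "\<lbrakk>openin T V; V \<subseteq> U; s \<in> carrier (Sec E U)\<rbrakk>
      \<Longrightarrow> \<sigma> V (Res E U V s) = Res E' U V (\<sigma> U s)"
  using assms unfolding sheaf_morphism_def by (simp_all add: Pi_iff)

lemma sheaf_isoD:
  assumes "sheaf_iso T A E E' \<sigma>"
  shows "sheaf_morphism T A E E' \<sigma>"
    and "openin T U \<Longrightarrow> inj_on (\<sigma> U) (carrier (Sec E U))"
    and "openin T U \<Longrightarrow> \<sigma> U ` carrier (Sec E U) = carrier (Sec E' U)"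
  using assms unfolding sheaf_iso_def bij_betw_def by simp_all

text \<open>A trivialization \<open>\<tau>\<close> of \<open>F\<close>.  The index type is left open because free submodules are indexed
  by sections of \<open>E\<close>, whereas \<open>E\<close> itself is indexed by natural numbers.\<close>

locale free_frame = sheaf_of_modules T A E
  for T :: "'x topology" and A :: "('x, complex, 'a) sheaf_data" and E :: "('x, 'a, 'm) sheaf_data" +
  fixes F :: "'x set \<Rightarrow> 'm set" and I :: "'i set" and \<tau> :: "'x set \<Rightarrow> ('i \<Rightarrow> 'a) \<Rightarrow> 'm"
  assumes sub: "sub_sheaf_of_modules T A E F"
    and iso: "sheaf_iso T A (direct_sum T A I) (sub_sheaf E F) \<tau>"
begin

definition unit_family :: "'x set \<Rightarrow> 'i \<Rightarrow> 'i \<Rightarrow> 'a" where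
  "unit_family U i = (\<lambda>k\<in>I. if k = i then \<one>\<^bsub>Sec A U\<^esub> else \<zero>\<^bsub>Sec A U\<^esub>)"

definition frame :: "'i \<Rightarrow> 'm" where
  "frame i = \<tau> (topspace T) (unit_family (topspace T) i)"

lemma sub_subset: "openin T U \<Longrightarrow> F U \<subseteq> carrier (Sec E U)"
  using sub module.submoduleE(1)[OF sec_module] unfolding sub_sheaf_of_modules_def by blast

lemma finite_support_carrier:
  assumes U: "openin T U" and K: "finite K" and f: "f \<in> I \<rightarrow>\<^sub>E carrier (Sec A U)"
    and supp: "\<And>i. i \<in> I - K \<Longrightarrow> f i = \<zero>\<^bsub>Sec A U\<^esub>"
  shows "f \<in> carrier (Sec (direct_sum T A I) U)"
proof -
  have "Res A U U \<zero>\<^bsub>Sec A U\<^esub> = \<zero>\<^bsub>Sec A U\<^esub>" using res_zero[OF U U] by simp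
  then have "{i \<in> I. Res A U U (f i) \<noteq> \<zero>\<^bsub>Sec A U\<^esub>} \<subseteq> K"
  proof (intro subsetI, elim CollectE conjE)
    fix i assume i: "i \<in> I" "Res A U U (f i) \<noteq> \<zero>\<^bsub>Sec A U\<^esub>"
    then have "f i \<noteq> \<zero>\<^bsub>Sec A U\<^esub>"
      using \<open>Res A U U \<zero>\<^bsub>Sec A U\<^esub> = \<zero>\<^bsub>Sec A U\<^esub>\<close> by auto
    then show "i \<in> K" using supp[of i] i(1) by blast
  qed
  then have "finite {i \<in> I. Res A U U (f i) \<noteq> \<zero>\<^bsub>Sec A U\<^esub>}"
    using K finite_subset by blast
  then show ?thesis
    using U f by (auto simp: direct_sum_def)
qed

lemma unit_family_carrier: "openin T U \<Longrightarrow> unit_family U i \<in> carrier (Sec (direct_sum T A I) U)"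
proof -
  assume U: "openin T U"
  interpret cring "Sec A U" by (rule sec_cring[OF U])
  show ?thesis
    by (rule finite_support_carrier[OF U, of "{i}"]) (auto simp: unit_family_def)
qed

lemma iso_closed: "\<lbrakk>openin T U; f \<in> carrier (Sec (direct_sum T A I) U)\<rbrakk> \<Longrightarrow> \<tau> U f \<in> F U"
  using sheaf_morphism_closed[OF sheaf_isoD(1)[OF iso]] by (simp add: sub_sheaf_def)

lemma iso_add:
  assumes "openin T U" "f \<in> carrier (Sec (direct_sum T A I) U)" "g \<in> carrier (Sec (direct_sum T A I) U)"
  shows "\<tau> U (\<lambda>i\<in>I. f i \<oplus>\<^bsub>Sec A U\<^esub> g i) = \<tau> U f \<oplus>\<^bsub>Sec E U\<^esub> \<tau> U g"
proof -
  have "\<tau> U (f \<oplus>\<^bsub>Sec (direct_sum T A I) U\<^esub> g) = \<tau> U f \<oplus>\<^bsub>Sec (sub_sheaf E F) U\<^esub> \<tau> U g"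
    by (rule sheaf_morphism_add[OF sheaf_isoD(1)[OF iso]]) fact+
  then show ?thesis by (simp add: direct_sum_def sub_sheaf_def)
qed

lemma iso_smult:
  assumes "openin T U" "a \<in> carrier (Sec A U)" "f \<in> carrier (Sec (direct_sum T A I) U)"
  shows "\<tau> U (\<lambda>i\<in>I. a \<otimes>\<^bsub>Sec A U\<^esub> f i) = a \<odot>\<^bsub>Sec E U\<^esub> \<tau> U f"
proof -
  have "\<tau> U (a \<odot>\<^bsub>Sec (direct_sum T A I) U\<^esub> f) = a \<odot>\<^bsub>Sec (sub_sheaf E F) U\<^esub> \<tau> U f"
    by (rule sheaf_morphism_smult[OF sheaf_isoD(1)[OF iso]]) fact+
  then show ?thesis by (simp add: direct_sum_def sub_sheaf_def)
qed

lemma iso_res: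
  assumes "openin T U" "openin T V" "V \<subseteq> U" "f \<in> carrier (Sec (direct_sum T A I) U)"
  shows "\<tau> V (\<lambda>i\<in>I. Res A U V (f i)) = Res E U V (\<tau> U f)"
proof -
  have "\<tau> V (Res (direct_sum T A I) U V f) = Res (sub_sheaf E F) U V (\<tau> U f)"
    by (rule sheaf_morphism_res[OF sheaf_isoD(1)[OF iso]]) fact+
  then show ?thesis by (simp add: direct_sum_def sub_sheaf_def)
qed

lemma frame_in: "frame i \<in> F (topspace T)"
  unfolding frame_def by (simp add: iso_closed unit_family_carrier)

lemma frame_closed: "frame i \<in> carrier (Sec E (topspace T))"
  using frame_in sub_subset by blast

lemma restr_frame:
  assumes U: "openin T U"
  shows "restr U (frame i) = \<tau> U (unit_family U i)"
proof -
  have X: "U \<subseteq> topspace T" by (rule openin_subset[OF U])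
  have "(\<lambda>k\<in>I. Res A (topspace T) U (unit_family (topspace T) i k)) = unit_family U i"
    using res_one[OF _ U X] res_zero[OF _ U X] by (auto simp: unit_family_def)
  then show ?thesis
    using iso_res[OF openin_topspace U X unit_family_carrier[OF openin_topspace, of i]]
    by (simp add: frame_def)
qed

lemma iso_zero:
  assumes U: "openin T U"
  shows "\<tau> U (\<lambda>i\<in>I. \<zero>\<^bsub>Sec A U\<^esub>) = \<zero>\<^bsub>Sec E U\<^esub>"
proof -
  interpret module "Sec A U" "Sec E U" by (rule sec_module[OF U])
  let ?z = "\<lambda>i\<in>I. \<zero>\<^bsub>Sec A U\<^esub>"
  have z: "?z \<in> carrier (Sec (direct_sum T A I) U)"
    by (rule finite_support_carrier[OF U, of "{}"]) auto
  have "(\<lambda>i\<in>I. \<zero>\<^bsub>Sec A U\<^esub> \<otimes>\<^bsub>Sec A U\<^esub> ?z i) = ?z" by auto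
  then have "\<tau> U ?z = \<zero>\<^bsub>Sec A U\<^esub> \<odot>\<^bsub>Sec E U\<^esub> \<tau> U ?z"
    using iso_smult[OF U R.zero_closed z] by metis
  also have "\<dots> = \<zero>\<^bsub>Sec E U\<^esub>"
    using iso_closed[OF U z] sub_subset[OF U] by (simp add: subset_iff)
  finally show ?thesis .
qed

text \<open>The values of \<open>\<tau>\<close> on families of finite support are determined by the frame: split off one
  coordinate of the support at a time.\<close>

lemma iso_eq_lincomb:
  assumes U: "openin T U"
  shows "\<lbrakk>finite K; K \<subseteq> I; f \<in> I \<rightarrow>\<^sub>E carrier (Sec A U); \<And>i. i \<in> I - K \<Longrightarrow> f i = \<zero>\<^bsub>Sec A U\<^esub>\<rbrakk>
    \<Longrightarrow> \<tau> U f = lincomb U K f frame"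
proof (induction K arbitrary: f rule: finite_induct)
  case empty
  then have "f = (\<lambda>i\<in>I. \<zero>\<^bsub>Sec A U\<^esub>)"
    by (intro PiE_ext[of f I "\<lambda>_. carrier (Sec A U)"])
      (auto simp: cring.cring_simprules(2)[OF sec_cring[OF U]])
  then show ?case
    using iso_zero[OF U] by (simp only: lincomb_empty[OF U])
next
  case (insert j K)
  interpret module "Sec A U" "Sec E U" by (rule sec_module[OF U])
  have j: "j \<in> I" and K: "K \<subseteq> I" using insert.prems by auto
  have fP: "f \<in> insert j K \<rightarrow> carrier (Sec A U)" using insert.prems by auto
  then have fj: "f j \<in> carrier (Sec A U)" by auto
  let ?g = "f(j := \<zero>\<^bsub>Sec A U\<^esub>)"
  have g: "?g \<in> I \<rightarrow>\<^sub>E carrier (Sec A U)"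
    using insert.prems(2) j by (auto simp: PiE_iff extensional_def)
  have gsupp: "?g i = \<zero>\<^bsub>Sec A U\<^esub>" if "i \<in> I - K" for i
    using that insert.prems(3) by auto
  have gc: "?g \<in> carrier (Sec (direct_sum T A I) U)"
    by (rule finite_support_carrier[OF U insert.hyps(1) g gsupp])
  let ?u = "\<lambda>i\<in>I. f j \<otimes>\<^bsub>Sec A U\<^esub> unit_family U j i"
  have uc: "?u \<in> carrier (Sec (direct_sum T A I) U)"
    using fj by (intro finite_support_carrier[OF U, of "{j}"]) (auto simp: unit_family_def)
  have "f = (\<lambda>i\<in>I. ?u i \<oplus>\<^bsub>Sec A U\<^esub> ?g i)"
    using insert.prems(2) fj
    by (intro PiE_ext[OF insert.prems(2)]) (auto simp: unit_family_def PiE_iff)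
  then have "\<tau> U f = \<tau> U ?u \<oplus>\<^bsub>Sec E U\<^esub> \<tau> U ?g"
    using iso_add[OF U uc gc] by metis
  also have "\<tau> U ?u = f j \<odot>\<^bsub>Sec E U\<^esub> restr U (frame j)"
    using iso_smult[OF U fj unit_family_carrier[OF U]] restr_frame[OF U] by simp
  also have "\<tau> U ?g = lincomb U K ?g frame"
    by (rule insert.IH[OF K g gsupp])
  also have "\<dots> = lincomb U K f frame"
    by (rule lincomb_cong[OF insert.hyps(1) _ U]) (use frame_closed fP insert.hyps in auto)
  also have "f j \<odot>\<^bsub>Sec E U\<^esub> restr U (frame j) \<oplus>\<^bsub>Sec E U\<^esub> lincomb U K f frame =
      lincomb U (insert j K) f frame"
    by (rule lincomb_insert[OF insert.hyps _ U fP, symmetric]) (use frame_closed in auto)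
  finally show ?case .
qed

lemma lin_indep_frame:
  assumes K: "finite K" "K \<subseteq> I"
  shows "lin_indep K frame"
  unfolding lin_indep_def
proof (intro allI impI ballI)
  fix U c i
  assume U: "openin T U" and c: "c \<in> K \<rightarrow> carrier (Sec A U)"
    and 0: "lincomb U K c frame = \<zero>\<^bsub>Sec E U\<^esub>" and i: "i \<in> K"
  interpret module "Sec A U" "Sec E U" by (rule sec_module[OF U])
  let ?f = "\<lambda>i\<in>I. if i \<in> K then c i else \<zero>\<^bsub>Sec A U\<^esub>"
  let ?z = "\<lambda>i\<in>I. \<zero>\<^bsub>Sec A U\<^esub>"
  have f: "?f \<in> I \<rightarrow>\<^sub>E carrier (Sec A U)" using c by auto
  have "\<tau> U ?f = lincomb U K ?f frame"
    by (rule iso_eq_lincomb[OF U K f]) auto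
  also have "\<dots> = lincomb U K c frame"
    by (rule lincomb_cong[OF K(1) _ U c]) (use K frame_closed in auto)
  finally have "\<tau> U ?f = \<tau> U ?z" using 0 iso_zero[OF U] by simp
  moreover have "?f \<in> carrier (Sec (direct_sum T A I) U)"
    by (rule finite_support_carrier[OF U K(1) f]) auto
  moreover have "?z \<in> carrier (Sec (direct_sum T A I) U)"
    by (rule finite_support_carrier[OF U, of "{}"]) auto
  moreover have "inj_on (\<tau> U) (carrier (Sec (direct_sum T A I) U))"
    by (rule sheaf_isoD(2)[OF iso U])
  ultimately have "?f = ?z" by (auto dest: inj_onD)
  then have "?f i = ?z i" by simp
  then show "c i = \<zero>\<^bsub>Sec A U\<^esub>" using K i by auto
qed

lemma sub_eq_span:
  assumes I: "finite I" and U: "openin T U"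
  shows "F U = span_sheaf I frame U"
proof -
  have "F U = \<tau> U ` (I \<rightarrow>\<^sub>E carrier (Sec A U))"
    using sheaf_isoD(3)[OF iso U] by (simp add: direct_sum_carrier_finite[OF I U] sub_sheaf_def)
  also have "\<dots> = (\<lambda>f. lincomb U I f frame) ` (I \<rightarrow>\<^sub>E carrier (Sec A U))"
    using iso_eq_lincomb[OF U I] by (intro image_cong) auto
  also have "\<dots> = span_sheaf I frame U"
  proof (intro subset_antisym subsetI)
    fix x assume "x \<in> span_sheaf I frame U"
    then obtain c where c: "c \<in> I \<rightarrow> carrier (Sec A U)" "x = lincomb U I c frame"
      by (rule span_sheafE)
    have "x = lincomb U I (restrict c I) frame"
      using lincomb_cong[OF I _ U c(1), of frame "restrict c I"] c(2) frame_closed by simp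
    then show "x \<in> (\<lambda>f. lincomb U I f frame) ` (I \<rightarrow>\<^sub>E carrier (Sec A U))"
      using c(1) by auto
  qed (auto intro: span_sheafI)
  finally show ?thesis .
qed

text \<open>Sections of an infinite direct sum have locally finite support, hence they are combinations of
  the frame only locally.\<close>

lemma sections_locally_span:
  assumes U: "openin T U" and s: "s \<in> F U" and x: "x \<in> U"
  obtains V K where "openin T V" "x \<in> V" "V \<subseteq> U" "finite K" "K \<subseteq> I"
    "Res E U V s \<in> span_sheaf K frame V"
proof -
  have "F U = \<tau> U ` carrier (Sec (direct_sum T A I) U)"
    using sheaf_isoD(3)[OF iso U] by (simp add: sub_sheaf_def)
  then obtain f where fc: "f \<in> carrier (Sec (direct_sum T A I) U)" and sf: "s = \<tau> U f"
    using s by blast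
  then obtain V where V: "openin T V" "x \<in> V" "V \<subseteq> U"
    and fin: "finite {i \<in> I. Res A U V (f i) \<noteq> \<zero>\<^bsub>Sec A V\<^esub>}"
    and f: "f \<in> I \<rightarrow>\<^sub>E carrier (Sec A U)"
    using x by (auto simp: direct_sum_def)
  let ?K = "{i \<in> I. Res A U V (f i) \<noteq> \<zero>\<^bsub>Sec A V\<^esub>}"
  let ?g = "\<lambda>i\<in>I. Res A U V (f i)"
  have g: "?g \<in> I \<rightarrow>\<^sub>E carrier (Sec A V)"
    using f res_closed[OF U V(1,3)] by (auto simp: PiE_iff)
  have "Res E U V s = \<tau> V ?g"
    using iso_res[OF U V(1,3) fc] sf by simp
  also have "\<dots> = lincomb V ?K ?g frame"
    by (rule iso_eq_lincomb[OF V(1) fin _ g]) auto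
  finally have "Res E U V s \<in> span_sheaf ?K frame V"
    using g by (auto intro!: span_sheafI)
  then show thesis
    using that[of V ?K] V fin by blast
qed

end

text \<open>Rule induction along the frame: a local property that is closed under the module operations
  passes from the global frame sections to all sections of \<open>F\<close>.\<close>

lemma (in free_frame) sections_induct:
  assumes zero: "\<And>U. openin T U \<Longrightarrow> \<zero>\<^bsub>Sec E U\<^esub> \<in> N U"
    and add: "\<And>U s t. \<lbrakk>openin T U; s \<in> N U; t \<in> N U\<rbrakk> \<Longrightarrow> s \<oplus>\<^bsub>Sec E U\<^esub> t \<in> N U"
    and smult: "\<And>U a s. \<lbrakk>openin T U; a \<in> carrier (Sec A U); s \<in> N U\<rbrakk> \<Longrightarrow> a \<odot>\<^bsub>Sec E U\<^esub> s \<in> N U"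
    and loc: "\<And>U s. \<lbrakk>openin T U; s \<in> F U;
        \<And>x. x \<in> U \<Longrightarrow> \<exists>V. openin T V \<and> x \<in> V \<and> V \<subseteq> U \<and> Res E U V s \<in> N V\<rbrakk> \<Longrightarrow> s \<in> N U"
    and gen: "\<And>U i. \<lbrakk>openin T U; i \<in> I\<rbrakk> \<Longrightarrow> restr U (frame i) \<in> N U"
    and U: "openin T U" and s: "s \<in> F U"
  shows "s \<in> N U"
proof (rule loc[OF U s])
  fix x assume "x \<in> U"
  then obtain V K where V: "openin T V" "x \<in> V" "V \<subseteq> U" and K: "finite K" "K \<subseteq> I"
    and sV: "Res E U V s \<in> span_sheaf K frame V"
    by (rule sections_locally_span[OF U s])
  obtain c where c: "c \<in> K \<rightarrow> carrier (Sec A V)" "Res E U V s = lincomb V K c frame"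
    using span_sheafE[OF sV] .
  have "lincomb V K c frame \<in> N V"
    by (rule lincomb_induct[OF V(1) K(1) _ c(1)])
      (use V K zero add smult gen frame_closed in auto)
  then show "\<exists>V. openin T V \<and> x \<in> V \<and> V \<subseteq> U \<and> Res E U V s \<in> N V"
    using V c by auto
qed

context sheaf_of_modules
begin

lemma free_submodule_frame:
  assumes "free_submodule T A E F"
  obtains I :: "'m set" and \<tau> where "free_frame T A E F I \<tau>"
proof -
  obtain I :: "'m set" and \<tau> where "sheaf_iso T A (direct_sum T A I) (sub_sheaf E F) \<tau>"
    using assms unfolding free_submodule_def free_sheaf_def by (elim conjE exE)
  moreover have "sub_sheaf_of_modules T A E F"
    using assms unfolding free_submodule_def by (rule conjunct1)
  ultimately have "free_frame T A E F I \<tau>"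
    by (intro free_frame.intro free_frame_axioms.intro sheaf_of_modules_axioms)
  then show thesis by (rule that)
qed

lemma whole_sub_sheaf: "sub_sheaf_of_modules T A E (\<lambda>U. carrier (Sec E U))"
  unfolding sub_sheaf_of_modules_def
  by (intro conjI allI impI module.carrier_is_submodule sec_module E.sheaf_of_sets_axioms)

lemma free_of_rank_frame:
  assumes "free_of_rank T A E m"
  obtains \<tau> where "free_frame T A E (\<lambda>U. carrier (Sec E U)) {..<m} \<tau>"
proof -
  have "sub_sheaf E (\<lambda>U. carrier (Sec E U)) = E" by (simp add: sub_sheaf_def)
moreover obtain \<tau> where "sheaf_iso T A (direct_sum T A {..<m}) E \<tau>"
    using assms unfolding free_of_rank_def by (elim exE)
  ultimately have "free_frame T A E (\<lambda>U. carrier (Sec E U)) {..<m} \<tau>"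
    by (intro free_frame.intro free_frame_axioms.intro sheaf_of_modules_axioms whole_sub_sheaf) simp
  then show thesis by (rule that)
qed

definition torsion_free :: "'m \<Rightarrow> bool" where
  "torsion_free t \<longleftrightarrow> t \<in> carrier (Sec E (topspace T)) \<and>
    (\<forall>U a. openin T U \<longrightarrow> a \<in> carrier (Sec A U) \<longrightarrow> a \<odot>\<^bsub>Sec E U\<^esub> restr U t = \<zero>\<^bsub>Sec E U\<^esub>
      \<longrightarrow> a = \<zero>\<^bsub>Sec A U\<^esub>)"

definition cyclic :: "'m \<Rightarrow> 'x set \<Rightarrow> 'm set" where
  "cyclic t = span_sheaf {t} (\<lambda>_. t)"

lemma cyclic_eq:
  assumes "openin T U" "t \<in> carrier (Sec E (topspace T))"
  shows "cyclic t U = {a \<odot>\<^bsub>Sec E U\<^esub> restr U t |a. a \<in> carrier (Sec A U)}"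
  unfolding cyclic_def using span_sheaf_singleton[of U "\<lambda>_. t" t] assms by simp

lemma free_submodule_cyclic: "torsion_free t \<Longrightarrow> free_submodule T A E (cyclic t)"
  unfolding cyclic_def torsion_free_def
  by (rule free_submodule_span_sheaf[OF _ _ lin_indep_singletonI]) simp_all

end

section \<open>Orthogonality\<close>

context bilinear_sheaf_form
begin

lemma form_zero_left:
  assumes U: "openin T U" and s: "s \<in> carrier (Sec E U)"
  shows "\<phi> U \<zero>\<^bsub>Sec E U\<^esub> s = \<zero>\<^bsub>Sec A U\<^esub>"
proof -
  interpret module "Sec A U" "Sec E U" by (rule sec_module[OF U])
  have "\<phi> U (\<zero>\<^bsub>Sec A U\<^esub> \<odot>\<^bsub>Sec E U\<^esub> \<zero>\<^bsub>Sec E U\<^esub>) s = \<zero>\<^bsub>Sec A U\<^esub>"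
    using form_smult_left[OF U R.zero_closed M.zero_closed s] form_closed[OF U M.zero_closed s] by simp
  then show ?thesis by simp
qed

text \<open>Orthogonality to a span need only be tested on the generators, and only over the open set in
  question, because restriction and bilinearity give the rest.\<close>

lemma orthogonal_span_sheaf:
  assumes J: "finite J" and h: "h \<in> J \<rightarrow> carrier (Sec E (topspace T))" and U: "openin T U"
  shows "orthogonal_sheaf T A E \<phi> (span_sheaf J h) U =
    {t \<in> carrier (Sec E U). \<forall>i\<in>J. \<phi> U (restr U (h i)) t = \<zero>\<^bsub>Sec A U\<^esub>}"
proof (intro subset_antisym subsetI CollectI conjI ballI)
  fix t assume t: "t \<in> orthogonal_sheaf T A E \<phi> (span_sheaf J h) U"
  then show tc: "t \<in> carrier (Sec E U)" by (simp add: orthogonal_sheaf_def)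
  fix i assume i: "i \<in> J"
  interpret module "Sec A U" "Sec E U" by (rule sec_module[OF U])
  let ?c = "\<lambda>k. if k \<in> {i} then \<one>\<^bsub>Sec A U\<^esub> else \<zero>\<^bsub>Sec A U\<^esub>"
  have hi: "h i \<in> carrier (Sec E (topspace T))" using h i by auto
  have "lincomb U J ?c h =
      lincomb U {i} (\<lambda>_. \<one>\<^bsub>Sec A U\<^esub>) h"
    by (rule lincomb_mono_neutral[OF J _ h U]) (use i in auto)
  also have "\<dots> = restr U (h i)"
    using lincomb_singleton[of U "\<lambda>_. \<one>\<^bsub>Sec A U\<^esub>" i h] U hi restr_closed[OF U hi] by simp
  finally have "restr U (h i) \<in> span_sheaf J h U"
    using span_sheafI[of ?c J U h] by simp
  then have "\<phi> U (restr U (h i)) (Res E U U t) = \<zero>\<^bsub>Sec A U\<^esub>"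
    using t U unfolding orthogonal_sheaf_def by blast
  then show "\<phi> U (restr U (h i)) t = \<zero>\<^bsub>Sec A U\<^esub>"
    using E.res_id[OF U tc] by simp
next
  fix t assume "t \<in> {t \<in> carrier (Sec E U). \<forall>i\<in>J. \<phi> U (restr U (h i)) t = \<zero>\<^bsub>Sec A U\<^esub>}"
  then have t: "t \<in> carrier (Sec E U)" and ht: "\<And>i. i \<in> J \<Longrightarrow> \<phi> U (restr U (h i)) t = \<zero>\<^bsub>Sec A U\<^esub>"
    by auto
  have "\<phi> V s (Res E U V t) = \<zero>\<^bsub>Sec A V\<^esub>"
    if V: "openin T V" and VU: "V \<subseteq> U" and s: "s \<in> span_sheaf J h V" for V s
  proof -
    interpret module "Sec A V" "Sec E V" by (rule sec_module[OF V])
    have tV: "Res E U V t \<in> carrier (Sec E V)" by (rule E.res_closed[OF U V VU t])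
    obtain c where c: "c \<in> J \<rightarrow> carrier (Sec A V)" "s = lincomb V J c h"
      using span_sheafE[OF s] .
    have "lincomb V J c h \<in> {s \<in> carrier (Sec E V). \<phi> V s (Res E U V t) = \<zero>\<^bsub>Sec A V\<^esub>}"
    proof (rule lincomb_induct[OF V J h c(1)])
      fix i assume i: "i \<in> J"
      then have hi: "h i \<in> carrier (Sec E (topspace T))" using h by auto
      have "\<phi> V (Res E U V (restr U (h i))) (Res E U V t) = \<zero>\<^bsub>Sec A V\<^esub>"
        using form_res[OF U V VU restr_closed[OF U hi] t] ht[OF i] res_zero[OF U V VU] by simp
      then show "restr V (h i) \<in> {s \<in> carrier (Sec E V). \<phi> V s (Res E U V t) = \<zero>\<^bsub>Sec A V\<^esub>}"
        using restr_restr[OF U V VU hi] restr_closed[OF V hi] by simp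
    qed (use tV form_zero_left[OF V] form_add_left[OF V] form_smult_left[OF V] in auto)
    then show ?thesis using c by simp
  qed
  then show "t \<in> orthogonal_sheaf T A E \<phi> (span_sheaf J h) U"
    using t by (auto simp: orthogonal_sheaf_def)
qed

end

locale symplectic_module = bilinear_sheaf_form T A E \<phi>
  for T :: "'x topology" and A :: "('x, complex, 'a) sheaf_data"
    and E :: "('x, 'a, 'm) sheaf_data" and \<phi> :: "('x, 'm, 'a) sheaf_form" +
  assumes skew: "skew_symmetric T A E \<phi>"
    and nondegenerate: "non_isotropic T A E \<phi> (\<lambda>U. carrier (Sec E U))"
    and convenient: "convenient_module T A E \<phi>"
begin

lemma form_swap:
  assumes "openin T U" "r \<in> carrier (Sec E U)" "s \<in> carrier (Sec E U)"
  shows "\<phi> U r s = \<ominus>\<^bsub>Sec A U\<^esub> \<phi> U s r"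
  using skew assms unfolding skew_symmetric_def by blast

lemma form_zero_commute:
  assumes U: "openin T U" and "r \<in> carrier (Sec E U)" "s \<in> carrier (Sec E U)"
  shows "\<phi> U r s = \<zero>\<^bsub>Sec A U\<^esub> \<longleftrightarrow> \<phi> U s r = \<zero>\<^bsub>Sec A U\<^esub>"
proof -
  have "orthosymmetric T A E \<phi>" using convenient unfolding convenient_module_def by (elim conjE)
  then show ?thesis using assms unfolding orthosymmetric_def by simp
qed

lemma form_self:
  assumes U: "openin T U" and s: "s \<in> carrier (Sec E U)"
  shows "\<phi> U s s = \<zero>\<^bsub>Sec A U\<^esub>"
proof (rule double_eq_zero_imp[OF U])
  interpret cring "Sec A U" by (rule sec_cring[OF U])
  show c: "\<phi> U s s \<in> carrier (Sec A U)" by (rule form_closed[OF U s s])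
  then show "\<phi> U s s \<oplus>\<^bsub>Sec A U\<^esub> \<phi> U s s = \<zero>\<^bsub>Sec A U\<^esub>"
    using form_swap[OF U s s] r_neg by metis
qed

lemma biorthogonal:
  assumes "free_submodule T A E F" "openin T U"
  shows "orthogonal_sheaf T A E \<phi> (orthogonal_sheaf T A E \<phi> F) U = F U"
proof -
  have "\<forall>F. free_submodule T A E F \<longrightarrow> (\<forall>U. openin T U \<longrightarrow>
      orthogonal_sheaf T A E \<phi> (orthogonal_sheaf T A E \<phi> F) U = F U)"
    using convenient unfolding convenient_module_def by (elim conjE)
  then show ?thesis using assms by simp
qed

lemma free_orthogonal: "free_submodule T A E F \<Longrightarrow> free_submodule T A E (orthogonal_sheaf T A E \<phi> F)"
  using convenient unfolding convenient_module_def by simp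

lemma free_Int: "\<lbrakk>free_submodule T A E F; free_submodule T A E G\<rbrakk> \<Longrightarrow> free_submodule T A E (\<lambda>U. F U \<inter> G U)"
  using convenient unfolding convenient_module_def by simp

text \<open>Let \<open>H\<close> be the span.  As \<open>v\<close> is not in \<open>H = H\<^sup>\<bottom>\<^sup>\<bottom>\<close>, some section of \<open>H\<^sup>\<bottom>\<close> over some
  open set pairs nontrivially with \<open>v\<close>.  A global one exists because \<open>H\<^sup>\<bottom>\<close> is free, hence locally
  spanned by its global frame.\<close>

lemma separating_section:
  fixes J :: "'m set"
  assumes J: "finite J" and h: "h \<in> J \<rightarrow> carrier (Sec E (topspace T))" and ind: "lin_indep J h"
    and v: "v \<in> carrier (Sec E (topspace T))" and nv: "v \<notin> span_sheaf J h (topspace T)"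
  obtains y where "y \<in> carrier (Sec E (topspace T))"
    "\<And>i. i \<in> J \<Longrightarrow> \<phi> (topspace T) (h i) y = \<zero>\<^bsub>Sec A (topspace T)\<^esub>"
    "\<phi> (topspace T) v y \<noteq> \<zero>\<^bsub>Sec A (topspace T)\<^esub>"
proof (rule ccontr)
  let ?X = "topspace T"
  let ?G = "orthogonal_sheaf T A E \<phi> (span_sheaf J h)"
  note witness = that
  assume "\<not> thesis"
  then have no: "\<phi> ?X v y = \<zero>\<^bsub>Sec A ?X\<^esub>"
    if "y \<in> carrier (Sec E ?X)" "\<forall>i\<in>J. \<phi> ?X (h i) y = \<zero>\<^bsub>Sec A ?X\<^esub>" for y
    using witness[OF that(1)] that(2) by blast
  have X: "openin T ?X" by simp
  have free: "free_submodule T A E (span_sheaf J h)"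
    by (rule free_submodule_span_sheaf[OF J h ind])
  obtain I :: "'m set" and \<tau> where "free_frame T A E ?G I \<tau>"
    using free_submodule_frame[OF free_orthogonal[OF free]] .
  then interpret G: free_frame T A E ?G I \<tau> .
  have perp: "\<phi> U s (restr U v) = \<zero>\<^bsub>Sec A U\<^esub>" if U: "openin T U" and s: "s \<in> ?G U" for U s
  proof -
    let ?N = "\<lambda>U. {s \<in> carrier (Sec E U). \<phi> U s (restr U v) = \<zero>\<^bsub>Sec A U\<^esub>}"
    have "s \<in> ?N U"
    proof (rule G.sections_induct[where N = ?N, OF _ _ _ _ _ U s])
      fix U assume U: "openin T U"
      interpret module "Sec A U" "Sec E U" by (rule sec_module[OF U])
      note vU = restr_closed[OF U v]
      show "\<zero>\<^bsub>Sec E U\<^esub> \<in> ?N U"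
        using form_zero_left[OF U vU] by simp
      show "s \<oplus>\<^bsub>Sec E U\<^esub> t \<in> ?N U" if "s \<in> ?N U" "t \<in> ?N U" for s t
        using that form_add_left[OF U _ _ vU] by simp
      show "a \<odot>\<^bsub>Sec E U\<^esub> s \<in> ?N U" if "a \<in> carrier (Sec A U)" "s \<in> ?N U" for a s
        using that form_smult_left[OF U _ _ vU] by simp
      show "restr U (G.frame i) \<in> ?N U" if "i \<in> I" for i
      proof -
        note fc = G.frame_closed[of i]
        have "\<forall>i'\<in>J. \<phi> ?X (h i') (G.frame i) = \<zero>\<^bsub>Sec A ?X\<^esub>"
          using G.frame_in[of i] h E.res_id[OF X] unfolding orthogonal_span_sheaf[OF J h X]
          by (auto simp: Pi_iff)
        then have "\<phi> ?X v (G.frame i) = \<zero>\<^bsub>Sec A ?X\<^esub>" by (rule no[OF fc])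
        then have "\<phi> ?X (G.frame i) v = \<zero>\<^bsub>Sec A ?X\<^esub>"
          using form_zero_commute[OF X v fc] by simp
        then have "\<phi> U (restr U (G.frame i)) (restr U v) = \<zero>\<^bsub>Sec A U\<^esub>"
          using form_res[OF X U openin_subset[OF U] fc v] res_zero[OF X U openin_subset[OF U]] by simp
        then show ?thesis using restr_closed[OF U fc] by simp
      qed
      fix s assume s: "s \<in> ?G U"
        and loc: "\<And>x. x \<in> U \<Longrightarrow> \<exists>V. openin T V \<and> x \<in> V \<and> V \<subseteq> U \<and> Res E U V s \<in> ?N V"
      have sc: "s \<in> carrier (Sec E U)" using s G.sub_subset[OF U] by blast
      have "\<phi> U s (restr U v) = \<zero>\<^bsub>Sec A U\<^esub>"
      proof (rule separated[OF U])
        show "\<phi> U s (restr U v) \<in> carrier (Sec A U)" by (rule form_closed[OF U sc vU])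
        fix x assume "x \<in> U"
        then obtain V where V: "openin T V" "x \<in> V" "V \<subseteq> U" and sV: "Res E U V s \<in> ?N V"
          using loc by blast
        have "Res A U V (\<phi> U s (restr U v)) = \<phi> V (Res E U V s) (Res E U V (restr U v))"
          by (rule form_res[OF U V(1,3) sc vU, symmetric])
        also have "\<dots> = Res A U V \<zero>\<^bsub>Sec A U\<^esub>"
          using sV restr_restr[OF U V(1,3) v] res_zero[OF U V(1,3)] by simp
        finally show "\<exists>V. openin T V \<and> x \<in> V \<and> V \<subseteq> U \<and>
            Res A U V (\<phi> U s (restr U v)) = Res A U V \<zero>\<^bsub>Sec A U\<^esub>"
          using V by blast
      qed simp
      then show "s \<in> ?N U" using sc by simp
    qed
    then show ?thesis by simp
  qed
  have "v \<in> orthogonal_sheaf T A E \<phi> ?G ?X"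
    unfolding orthogonal_sheaf_def[of T A E \<phi> ?G] using v perp by auto
  then show False using biorthogonal[OF free X] nv by simp
qed

text \<open>A nonzero \<open>E\<close> has rank at least 2: on a module with a single generator \<open>e\<close> the form vanishes,
  since \<open>\<phi>(e, e) = 0\<close>.\<close>

lemma two_independent_sections:
  assumes nontrivial: "openin T W" "carrier (Sec E W) \<noteq> {\<zero>\<^bsub>Sec E W\<^esub>}"
  obtains e0 e1 where "e0 \<in> carrier (Sec E (topspace T))" "e1 \<in> carrier (Sec E (topspace T))"
    "\<And>U a b. \<lbrakk>openin T U; a \<in> carrier (Sec A U); b \<in> carrier (Sec A U);
       a \<odot>\<^bsub>Sec E U\<^esub> restr U e0 \<oplus>\<^bsub>Sec E U\<^esub> b \<odot>\<^bsub>Sec E U\<^esub> restr U e1 = \<zero>\<^bsub>Sec E U\<^esub>\<rbrakk>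
       \<Longrightarrow> a = \<zero>\<^bsub>Sec A U\<^esub> \<and> b = \<zero>\<^bsub>Sec A U\<^esub>"
proof -
  let ?X = "topspace T"
  have X: "openin T ?X" by simp
  interpret X: module "Sec A ?X" "Sec E ?X" by (rule sec_module[OF X])
  obtain m where "free_of_rank T A E m"
    using convenient unfolding convenient_module_def by (elim conjE exE)
  then obtain \<tau> where "free_frame T A E (\<lambda>U. carrier (Sec E U)) {..<m} \<tau>"
    by (rule free_of_rank_frame)
  then interpret B: free_frame T A E "\<lambda>U. carrier (Sec E U)" "{..<m}" \<tau> .
  have span: "carrier (Sec E U) = span_sheaf {..<m} B.frame U" if "openin T U" for U
    by (rule B.sub_eq_span[OF _ that]) simp
  have "m \<noteq> 0"
  proof
    assume "m = 0"
    then have "carrier (Sec E W) = {\<zero>\<^bsub>Sec E W\<^esub>}"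
      using span[OF nontrivial(1)] by (auto simp: span_sheaf_def lincomb_empty[OF nontrivial(1)])
    then show False using nontrivial(2) by simp
  qed
  moreover have "m \<noteq> 1"
  proof
    assume "m = 1"
    then have m: "{..<m} = {0}" by auto
    let ?e = "B.frame 0"
    note e = B.frame_closed[of 0]
    have "\<phi> V s (restr V ?e) = \<zero>\<^bsub>Sec A V\<^esub>" if V: "openin T V" and s: "s \<in> carrier (Sec E V)" for V s
    proof -
      interpret module "Sec A V" "Sec E V" by (rule sec_module[OF V])
      obtain a where a: "a \<in> carrier (Sec A V)" "s = a \<odot>\<^bsub>Sec E V\<^esub> restr V ?e"
        using s span[OF V] span_sheaf_singleton[OF V, of B.frame 0] e unfolding m by blast
      then show ?thesis
        using form_smult_left[OF V a(1) restr_closed[OF V e] restr_closed[OF V e]]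
          form_self[OF V restr_closed[OF V e]] by simp
    qed
    then have "?e \<in> radical T A E \<phi> (\<lambda>U. carrier (Sec E U)) ?X"
      unfolding radical_def orthogonal_sheaf_def using e by auto
    then have "?e = \<zero>\<^bsub>Sec E ?X\<^esub>"
      using nondegenerate X unfolding non_isotropic_def by blast
    then have "lincomb ?X {0} (\<lambda>_. \<one>\<^bsub>Sec A ?X\<^esub>) B.frame = \<zero>\<^bsub>Sec E ?X\<^esub>"
      using lincomb_singleton[OF X, of "\<lambda>_. \<one>\<^bsub>Sec A ?X\<^esub>" 0 B.frame] e E.res_id[OF X e] by simp
    then have "\<one>\<^bsub>Sec A ?X\<^esub> = \<zero>\<^bsub>Sec A ?X\<^esub>"
      using B.lin_indep_frame[of "{0}"] m
      by (intro lin_indepD[of "{0}" B.frame ?X "\<lambda>_. \<one>\<^bsub>Sec A ?X\<^esub>" 0]) simp_all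
    then show False
      using zero_ring_imp_zero_module[OF _ nontrivial(1)] nontrivial(2) by blast
  qed
  ultimately have m: "{0, 1} \<subseteq> {..<m}" by auto
  show thesis
  proof (rule that[OF B.frame_closed[of 0] B.frame_closed[of 1]])
    fix U a b
    assume U: "openin T U" and a: "a \<in> carrier (Sec A U)" and b: "b \<in> carrier (Sec A U)"
      and 0: "a \<odot>\<^bsub>Sec E U\<^esub> restr U (B.frame 0) \<oplus>\<^bsub>Sec E U\<^esub> b \<odot>\<^bsub>Sec E U\<^esub> restr U (B.frame 1) = \<zero>\<^bsub>Sec E U\<^esub>"
    let ?c = "\<lambda>i::nat. if i = 0 then a else b"
    have "lincomb U {0, 1} ?c B.frame = ?c 0 \<odot>\<^bsub>Sec E U\<^esub> restr U (B.frame 0) \<oplus>\<^bsub>Sec E U\<^esub> lincomb U {1} ?c B.frame"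
      by (rule lincomb_insert[OF _ _ _ U]) (use a b B.frame_closed in auto)
    also have "lincomb U {1} ?c B.frame = ?c 1 \<odot>\<^bsub>Sec E U\<^esub> restr U (B.frame 1)"
      by (rule lincomb_singleton[OF U]) (use b B.frame_closed in auto)
    finally have "lincomb U {0, 1} ?c B.frame = \<zero>\<^bsub>Sec E U\<^esub>" using 0 by simp
    moreover have c: "?c \<in> {0, 1} \<rightarrow> carrier (Sec A U)" using a b by auto
    moreover have "lin_indep {0, 1} B.frame" by (rule B.lin_indep_frame[OF _ m]) simp
    ultimately have "?c 0 = \<zero>\<^bsub>Sec A U\<^esub>" "?c 1 = \<zero>\<^bsub>Sec A U\<^esub>"
      using lin_indepD[of "{0, 1}" B.frame U ?c] U by blast+
    then show "a = \<zero>\<^bsub>Sec A U\<^esub> \<and> b = \<zero>\<^bsub>Sec A U\<^esub>" by simp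
  qed
qed

end

section \<open>The field of global sections\<close>

context symplectic_module
begin

text \<open>With independent \<open>e0\<close>, \<open>e1\<close> and \<open>g = e0 + a e1\<close>, the intersection of \<open>A e0\<close> and \<open>A g\<close> consists of
  the \<open>c e0\<close> with \<open>c a = 0\<close>.  It is free, but every element of it is killed by \<open>a \<noteq> 0\<close>, so its frame
  must be empty and \<open>a\<close> is not a zero divisor over any open set.  Therefore \<open>A (a e0)\<close> is free and has
  the same orthogonal as \<open>e0\<close>; biorthogonality yields \<open>e0 = b a e0\<close> for some \<open>b\<close>.\<close>

lemma nonzero_global_unit:
  assumes nontrivial: "openin T W" "carrier (Sec E W) \<noteq> {\<zero>\<^bsub>Sec E W\<^esub>}"
    and a: "a \<in> carrier (Sec A (topspace T))" and a0: "a \<noteq> \<zero>\<^bsub>Sec A (topspace T)\<^esub>"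
  shows "a \<in> Units (Sec A (topspace T))"
proof -
  let ?X = "topspace T"
  let ?a = "\<lambda>U. Res A ?X U a"
  have X: "openin T ?X" by simp
  interpret X: module "Sec A ?X" "Sec E ?X" by (rule sec_module[OF X])
  obtain e0 e1 where e0: "e0 \<in> carrier (Sec E ?X)" and e1: "e1 \<in> carrier (Sec E ?X)"
    and ind: "\<And>U b c. \<lbrakk>openin T U; b \<in> carrier (Sec A U); c \<in> carrier (Sec A U);
       b \<odot>\<^bsub>Sec E U\<^esub> restr U e0 \<oplus>\<^bsub>Sec E U\<^esub> c \<odot>\<^bsub>Sec E U\<^esub> restr U e1 = \<zero>\<^bsub>Sec E U\<^esub>\<rbrakk>
       \<Longrightarrow> b = \<zero>\<^bsub>Sec A U\<^esub> \<and> c = \<zero>\<^bsub>Sec A U\<^esub>"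
    using two_independent_sections[OF nontrivial] by blast
  have aU: "?a U \<in> carrier (Sec A U)" if "openin T U" for U
    by (rule res_closed[OF X that openin_subset[OF that] a])
  define g where "g = e0 \<oplus>\<^bsub>Sec E ?X\<^esub> a \<odot>\<^bsub>Sec E ?X\<^esub> e1"
  have g: "g \<in> carrier (Sec E ?X)" using e0 e1 a by (simp add: g_def)
  have mult_g: "b \<odot>\<^bsub>Sec E U\<^esub> restr U g =
      b \<odot>\<^bsub>Sec E U\<^esub> restr U e0 \<oplus>\<^bsub>Sec E U\<^esub> (b \<otimes>\<^bsub>Sec A U\<^esub> ?a U) \<odot>\<^bsub>Sec E U\<^esub> restr U e1"
    if U: "openin T U" and b: "b \<in> carrier (Sec A U)" for U b
  proof -
    interpret module "Sec A U" "Sec E U" by (rule sec_module[OF U])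
    have "restr U g = restr U e0 \<oplus>\<^bsub>Sec E U\<^esub> ?a U \<odot>\<^bsub>Sec E U\<^esub> restr U e1"
      unfolding g_def using e0 e1 a
      by (simp add: res_add[OF X U openin_subset[OF U]] res_smult[OF X U openin_subset[OF U]])
    then show ?thesis
      using b aU[OF U] restr_closed[OF U e0] restr_closed[OF U e1]
      by (simp add: smult_r_distr smult_assoc1)
  qed
  have tf_e0: "b = \<zero>\<^bsub>Sec A U\<^esub>"
    if U: "openin T U" and b: "b \<in> carrier (Sec A U)" and 0: "b \<odot>\<^bsub>Sec E U\<^esub> restr U e0 = \<zero>\<^bsub>Sec E U\<^esub>" for U b
  proof -
    interpret module "Sec A U" "Sec E U" by (rule sec_module[OF U])
    show ?thesis
      using ind[OF U b R.zero_closed] 0 restr_closed[OF U e1] by simp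
  qed
  have free_e0: "free_submodule T A E (cyclic e0)"
    by (rule free_submodule_cyclic) (use e0 tf_e0 in \<open>auto simp: torsion_free_def\<close>)
  have free_g: "free_submodule T A E (cyclic g)"
  proof (rule free_submodule_cyclic)
    have "b = \<zero>\<^bsub>Sec A U\<^esub>"
      if U: "openin T U" and b: "b \<in> carrier (Sec A U)" and 0: "b \<odot>\<^bsub>Sec E U\<^esub> restr U g = \<zero>\<^bsub>Sec E U\<^esub>" for U b
    proof -
      interpret module "Sec A U" "Sec E U" by (rule sec_module[OF U])
      show ?thesis
        using ind[OF U b R.m_closed[OF b aU[OF U]]] mult_g[OF U b] 0 by simp
    qed
    then show "torsion_free g" using g by (auto simp: torsion_free_def)
  qed
  obtain I :: "'m set" and \<tau> where "free_frame T A E (\<lambda>U. cyclic e0 U \<inter> cyclic g U) I \<tau>"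
    using free_submodule_frame[OF free_Int[OF free_e0 free_g]] .
  then interpret K: free_frame T A E "\<lambda>U. cyclic e0 U \<inter> cyclic g U" I \<tau> .
  have "I = {}"
  proof (rule ccontr)
    assume "I \<noteq> {}"
    then obtain j where j: "j \<in> I" by blast
    let ?k = "K.frame j"
    note k = K.frame_closed[of j]
    obtain b where b: "b \<in> carrier (Sec A ?X)" "?k = b \<odot>\<^bsub>Sec E ?X\<^esub> e0"
      using K.frame_in[of j] cyclic_eq[OF X e0] E.res_id[OF X e0] by auto
    obtain c where c: "c \<in> carrier (Sec A ?X)" "?k = c \<odot>\<^bsub>Sec E ?X\<^esub> restr ?X g"
      using K.frame_in[of j] cyclic_eq[OF X g] by auto
    have ca: "c \<otimes>\<^bsub>Sec A ?X\<^esub> a \<in> carrier (Sec A ?X)" using c a by simp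
    have "(c \<ominus>\<^bsub>Sec A ?X\<^esub> b) \<odot>\<^bsub>Sec E ?X\<^esub> e0 \<oplus>\<^bsub>Sec E ?X\<^esub> (c \<otimes>\<^bsub>Sec A ?X\<^esub> a) \<odot>\<^bsub>Sec E ?X\<^esub> e1
        = (c \<odot>\<^bsub>Sec E ?X\<^esub> e0 \<oplus>\<^bsub>Sec E ?X\<^esub> (c \<otimes>\<^bsub>Sec A ?X\<^esub> a) \<odot>\<^bsub>Sec E ?X\<^esub> e1) \<ominus>\<^bsub>Sec E ?X\<^esub> b \<odot>\<^bsub>Sec E ?X\<^esub> e0"
      using b(1) c(1) ca e0 e1
      by (simp add: X.R.minus_eq X.M.minus_eq X.smult_l_distr X.smult_l_minus X.M.a_ac)
    also have "c \<odot>\<^bsub>Sec E ?X\<^esub> e0 \<oplus>\<^bsub>Sec E ?X\<^esub> (c \<otimes>\<^bsub>Sec A ?X\<^esub> a) \<odot>\<^bsub>Sec E ?X\<^esub> e1 = ?k"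
      using mult_g[OF X c(1)] c(2) E.res_id[OF X e0] E.res_id[OF X e1] res_id[OF X a] by simp
    also have "?k \<ominus>\<^bsub>Sec E ?X\<^esub> b \<odot>\<^bsub>Sec E ?X\<^esub> e0 = \<zero>\<^bsub>Sec E ?X\<^esub>"
      using k b(2) by (simp add: X.M.minus_eq X.M.r_neg)
    finally have "(c \<ominus>\<^bsub>Sec A ?X\<^esub> b) \<odot>\<^bsub>Sec E ?X\<^esub> restr ?X e0
        \<oplus>\<^bsub>Sec E ?X\<^esub> (c \<otimes>\<^bsub>Sec A ?X\<^esub> a) \<odot>\<^bsub>Sec E ?X\<^esub> restr ?X e1 = \<zero>\<^bsub>Sec E ?X\<^esub>"
      by (simp only: E.res_id[OF X e0] E.res_id[OF X e1])
    then have "c \<ominus>\<^bsub>Sec A ?X\<^esub> b = \<zero>\<^bsub>Sec A ?X\<^esub> \<and> c \<otimes>\<^bsub>Sec A ?X\<^esub> a = \<zero>\<^bsub>Sec A ?X\<^esub>"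
      by (rule ind[OF X X.R.minus_closed[OF c(1) b(1)] ca])
    then have ba: "a \<otimes>\<^bsub>Sec A ?X\<^esub> b = \<zero>\<^bsub>Sec A ?X\<^esub>"
      using b(1) c(1) a X.R.m_comm by (metis X.R.r_right_minus_eq)
    have "a \<odot>\<^bsub>Sec E ?X\<^esub> ?k = (a \<otimes>\<^bsub>Sec A ?X\<^esub> b) \<odot>\<^bsub>Sec E ?X\<^esub> e0"
      using b a e0 by (simp add: X.smult_assoc1)
    then have "a \<odot>\<^bsub>Sec E ?X\<^esub> ?k = \<zero>\<^bsub>Sec E ?X\<^esub>" using ba e0 by simp
    then have "lincomb ?X {j} (\<lambda>_. a) K.frame = \<zero>\<^bsub>Sec E ?X\<^esub>"
      using lincomb_singleton[OF X, of "\<lambda>_. a" j K.frame] a k E.res_id[OF X k] by simp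
    then have "a = \<zero>\<^bsub>Sec A ?X\<^esub>"
      using K.lin_indep_frame[of "{j}"] j a
      by (intro lin_indepD[of "{j}" K.frame ?X "\<lambda>_. a" j]) simp_all
    then show False using a0 by simp
  qed
  have faithful: "c = \<zero>\<^bsub>Sec A U\<^esub>"
    if U: "openin T U" and c: "c \<in> carrier (Sec A U)" and 0: "c \<otimes>\<^bsub>Sec A U\<^esub> ?a U = \<zero>\<^bsub>Sec A U\<^esub>" for U c
  proof -
    interpret module "Sec A U" "Sec E U" by (rule sec_module[OF U])
    let ?s = "c \<odot>\<^bsub>Sec E U\<^esub> restr U e0"
    have "?s = c \<odot>\<^bsub>Sec E U\<^esub> restr U g"
      using mult_g[OF U c] 0 c restr_closed[OF U e0] restr_closed[OF U e1] by simp
    then have "?s \<in> cyclic e0 U \<inter> cyclic g U"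
      using c cyclic_eq[OF U e0] cyclic_eq[OF U g] by auto
    also have "\<dots> = {\<zero>\<^bsub>Sec E U\<^esub>}"
      using K.sub_eq_span[OF _ U] \<open>I = {}\<close> by (auto simp: span_sheaf_def lincomb_empty[OF U])
    finally show ?thesis using tf_e0[OF U c] by simp
  qed
  define t where "t = a \<odot>\<^bsub>Sec E ?X\<^esub> e0"
  have t: "t \<in> carrier (Sec E ?X)" using a e0 by (simp add: t_def)
  have restr_t: "restr U t = ?a U \<odot>\<^bsub>Sec E U\<^esub> restr U e0" if "openin T U" for U
    unfolding t_def by (rule res_smult[OF X that openin_subset[OF that] a e0])
  have free_t: "free_submodule T A E (cyclic t)"
  proof (rule free_submodule_cyclic)
    have "c = \<zero>\<^bsub>Sec A U\<^esub>"
      if U: "openin T U" and c: "c \<in> carrier (Sec A U)" and 0: "c \<odot>\<^bsub>Sec E U\<^esub> restr U t = \<zero>\<^bsub>Sec E U\<^esub>" for U c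
    proof (rule faithful[OF U c])
      interpret module "Sec A U" "Sec E U" by (rule sec_module[OF U])
      have "(c \<otimes>\<^bsub>Sec A U\<^esub> ?a U) \<odot>\<^bsub>Sec E U\<^esub> restr U e0 = \<zero>\<^bsub>Sec E U\<^esub>"
        using 0 c aU[OF U] restr_closed[OF U e0] by (simp add: restr_t[OF U] smult_assoc1)
      then show "c \<otimes>\<^bsub>Sec A U\<^esub> ?a U = \<zero>\<^bsub>Sec A U\<^esub>"
        using tf_e0[OF U] c aU[OF U] by simp
    qed
    then show "torsion_free t" using t by (auto simp: torsion_free_def)
  qed
  have perp: "\<phi> V s (restr V e0) = \<zero>\<^bsub>Sec A V\<^esub>"
    if V: "openin T V" and s: "s \<in> orthogonal_sheaf T A E \<phi> (cyclic t) V" for V s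
  proof -
    interpret module "Sec A V" "Sec E V" by (rule sec_module[OF V])
    note e0V = restr_closed[OF V e0]
    have sc: "s \<in> carrier (Sec E V)" and "\<phi> V (restr V t) s = \<zero>\<^bsub>Sec A V\<^esub>"
      using s orthogonal_span_sheaf[of "{t}" "\<lambda>_. t" V] t V unfolding cyclic_def by auto
    then have "\<phi> V (restr V e0) s \<otimes>\<^bsub>Sec A V\<^esub> ?a V = \<zero>\<^bsub>Sec A V\<^esub>"
      using form_smult_left[OF V aU[OF V] e0V sc] restr_t[OF V] form_closed[OF V e0V sc] aU[OF V]
      by (simp add: m_comm)
    then have "\<phi> V (restr V e0) s = \<zero>\<^bsub>Sec A V\<^esub>"
      by (rule faithful[OF V form_closed[OF V e0V sc]])
    then show ?thesis using form_zero_commute[OF V e0V sc] by simp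
  qed
  have "e0 \<in> orthogonal_sheaf T A E \<phi> (orthogonal_sheaf T A E \<phi> (cyclic t)) ?X"
    unfolding orthogonal_sheaf_def[of T A E \<phi> "orthogonal_sheaf T A E \<phi> (cyclic t)"]
    using e0 perp by auto
  then have "e0 \<in> cyclic t ?X" using biorthogonal[OF free_t X] by simp
  then obtain b where b: "b \<in> carrier (Sec A ?X)" "e0 = b \<odot>\<^bsub>Sec E ?X\<^esub> t"
    using cyclic_eq[OF X t] E.res_id[OF X t] by auto
  have "(b \<otimes>\<^bsub>Sec A ?X\<^esub> a \<ominus>\<^bsub>Sec A ?X\<^esub> \<one>\<^bsub>Sec A ?X\<^esub>) \<odot>\<^bsub>Sec E ?X\<^esub> e0 = b \<odot>\<^bsub>Sec E ?X\<^esub> t \<ominus>\<^bsub>Sec E ?X\<^esub> e0"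
    unfolding t_def using a b(1) e0
    by (simp add: X.R.minus_eq X.M.minus_eq X.smult_l_distr X.smult_l_minus X.smult_assoc1)
  also have "\<dots> = \<zero>\<^bsub>Sec E ?X\<^esub>"
    using b(2) e0 by (simp add: X.M.minus_eq X.M.r_neg)
  finally have "b \<otimes>\<^bsub>Sec A ?X\<^esub> a \<ominus>\<^bsub>Sec A ?X\<^esub> \<one>\<^bsub>Sec A ?X\<^esub> = \<zero>\<^bsub>Sec A ?X\<^esub>"
    using tf_e0[OF X] a b(1) E.res_id[OF X e0] by simp
  then have "b \<otimes>\<^bsub>Sec A ?X\<^esub> a = \<one>\<^bsub>Sec A ?X\<^esub>"
    using a b(1) by simp
  then show ?thesis
    using a b(1) X.R.m_comm[OF b(1) a] unfolding Units_def by (auto intro!: bexI[of _ b])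
qed

end

section \<open>Isometries and transvections\<close>

lemma isometry_ontoI:
  assumes "sheaf_morphism T A E E' \<sigma>"
    and "\<And>U. openin T U \<Longrightarrow> bij_betw (\<sigma> U) (carrier (Sec E U)) (carrier (Sec E' U))"
    and "\<And>U r s. \<lbrakk>openin T U; r \<in> carrier (Sec E U); s \<in> carrier (Sec E U)\<rbrakk>
      \<Longrightarrow> \<phi>' U (\<sigma> U r) (\<sigma> U s) = \<phi> U r s"
  shows "isometry_onto T A E \<phi> E' \<phi>' \<sigma>"
  using assms unfolding isometry_onto_def isometry_def sheaf_mono_def sheaf_iso_def
  by (auto intro: bij_betw_imp_inj_on)

lemma isometryD:
  assumes "isometry T A E \<phi> E' \<phi>' \<sigma>"
  shows isometry_morphism: "sheaf_morphism T A E E' \<sigma>"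
    and isometry_inj_on: "openin T U \<Longrightarrow> inj_on (\<sigma> U) (carrier (Sec E U))"
    and isometry_form: "\<lbrakk>openin T U; r \<in> carrier (Sec E U); s \<in> carrier (Sec E U)\<rbrakk>
      \<Longrightarrow> \<phi>' U (\<sigma> U r) (\<sigma> U s) = \<phi> U r s"
  using assms unfolding isometry_def sheaf_mono_def by simp_all

lemma isometry_onto_imp_isometry: "isometry_onto T A E \<phi> E' \<phi>' \<sigma> \<Longrightarrow> isometry T A E \<phi> E' \<phi>' \<sigma>"
  unfolding isometry_onto_def by simp

lemma isometry_onto_bij_betw:
  "\<lbrakk>isometry_onto T A E \<phi> E' \<phi>' \<sigma>; openin T U\<rbrakk> \<Longrightarrow> bij_betw (\<sigma> U) (carrier (Sec E U)) (carrier (Sec E' U))"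
  unfolding isometry_onto_def sheaf_iso_def by simp

lemma sheaf_morphism_comp:
  assumes \<sigma>: "sheaf_morphism T A E E' \<sigma>" and \<tau>: "sheaf_morphism T A E' E'' \<tau>"
  shows "sheaf_morphism T A E E'' (\<lambda>U. \<tau> U \<circ> \<sigma> U)"
proof -
  note s = sheaf_morphism_closed[OF \<sigma>] sheaf_morphism_add[OF \<sigma>] sheaf_morphism_smult[OF \<sigma>]
  note t = sheaf_morphism_closed[OF \<tau>] sheaf_morphism_add[OF \<tau>] sheaf_morphism_smult[OF \<tau>]
  show ?thesis
    unfolding sheaf_morphism_def
    by (simp add: s t sheaf_morphism_res[OF \<sigma>] sheaf_morphism_res[OF \<tau>])
qed

lemma isometry_comp:
  assumes \<sigma>: "isometry T A E \<phi> E' \<phi>' \<sigma>" and \<tau>: "isometry T A E' \<phi>' E'' \<phi>'' \<tau>"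
  shows "isometry T A E \<phi> E'' \<phi>'' (\<lambda>U. \<tau> U \<circ> \<sigma> U)"
proof -
  note closed = sheaf_morphism_closed[OF isometry_morphism[OF \<sigma>]]
  have "inj_on (\<tau> U \<circ> \<sigma> U) (carrier (Sec E U))" if U: "openin T U" for U
  proof (rule comp_inj_on[OF isometry_inj_on[OF \<sigma> U]])
    show "inj_on (\<tau> U) (\<sigma> U ` carrier (Sec E U))"
      by (rule inj_on_subset[OF isometry_inj_on[OF \<tau> U]]) (auto simp: closed[OF U])
  qed
  then show ?thesis
    unfolding isometry_def sheaf_mono_def
    using sheaf_morphism_comp[OF isometry_morphism[OF \<sigma>] isometry_morphism[OF \<tau>]]
    by (simp add: isometry_form[OF \<sigma>] isometry_form[OF \<tau>] closed)
qed

lemma isometry_onto_comp: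
  assumes \<sigma>: "isometry_onto T A E \<phi> E' \<phi>' \<sigma>" and \<tau>: "isometry_onto T A E' \<phi>' E'' \<phi>'' \<tau>"
  shows "isometry_onto T A E \<phi> E'' \<phi>'' (\<lambda>U. \<tau> U \<circ> \<sigma> U)"
proof -
  have i: "isometry T A E \<phi> E'' \<phi>'' (\<lambda>U. \<tau> U \<circ> \<sigma> U)"
    by (rule isometry_comp[OF isometry_onto_imp_isometry[OF \<sigma>] isometry_onto_imp_isometry[OF \<tau>]])
  show ?thesis
  proof (rule isometry_ontoI)
    show "bij_betw (\<tau> U \<circ> \<sigma> U) (carrier (Sec E U)) (carrier (Sec E'' U))" if "openin T U" for U
      by (rule bij_betw_trans[OF isometry_onto_bij_betw[OF \<sigma> that] isometry_onto_bij_betw[OF \<tau> that]])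
  qed (rule isometry_morphism[OF i], rule isometry_form[OF i])
qed

lemma isometry_onto_inv:
  assumes E: "sheaf_of_modules T A E" and \<iota>: "isometry_onto T A E \<phi> E' \<phi>' \<iota>"
  shows "isometry_onto T A E' \<phi>' E \<phi> (\<lambda>U. inv_into (carrier (Sec E U)) (\<iota> U))"
proof -
  interpret sheaf_of_modules T A E by (rule E)
  note i = isometry_onto_imp_isometry[OF \<iota>]
  note m = isometry_morphism[OF i]
  let ?j = "\<lambda>U. inv_into (carrier (Sec E U)) (\<iota> U)"
  note bij = isometry_onto_bij_betw[OF \<iota>]
  have jc: "?j U s \<in> carrier (Sec E U)" if "openin T U" "s \<in> carrier (Sec E' U)" for U s
    using bij_betw_imp_surj_on[OF bij[OF that(1)]] that(2) inv_into_into by metis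
  have ij: "\<iota> U (?j U s) = s" if "openin T U" "s \<in> carrier (Sec E' U)" for U s
    by (rule bij_betw_inv_into_right[OF bij[OF that(1)] that(2)])
  have ji: "?j U s = t" if "openin T U" "t \<in> carrier (Sec E U)" "\<iota> U t = s" for U s t
    using bij_betw_inv_into_left[OF bij[OF that(1)] that(2)] that(3) by simp
  show ?thesis
  proof (rule isometry_ontoI)
    show "sheaf_morphism T A E' E ?j"
      unfolding sheaf_morphism_def
    proof (intro conjI allI impI ballI)
      fix U assume U: "openin T U"
      interpret module "Sec A U" "Sec E U" by (rule sec_module[OF U])
      show "?j U \<in> carrier (Sec E' U) \<rightarrow> carrier (Sec E U)" using jc[OF U] by simp
      show "?j U (s \<oplus>\<^bsub>Sec E' U\<^esub> t) = ?j U s \<oplus>\<^bsub>Sec E U\<^esub> ?j U t"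
        if s: "s \<in> carrier (Sec E' U)" and t: "t \<in> carrier (Sec E' U)" for s t
        by (rule ji[OF U]) (simp_all add: sheaf_morphism_add[OF m U] jc[OF U] ij[OF U] s t)
      show "?j U (a \<odot>\<^bsub>Sec E' U\<^esub> s) = a \<odot>\<^bsub>Sec E U\<^esub> ?j U s"
        if a: "a \<in> carrier (Sec A U)" and s: "s \<in> carrier (Sec E' U)" for a s
        by (rule ji[OF U]) (simp_all add: sheaf_morphism_smult[OF m U] jc[OF U] ij[OF U] s a)
    next
      fix U V s assume "openin T U \<and> openin T V \<and> V \<subseteq> U" and s: "s \<in> carrier (Sec E' U)"
      then have U: "openin T U" and V: "openin T V" and VU: "V \<subseteq> U" by auto
      have "\<iota> V (Res E U V (?j U s)) = Res E' U V s"
        using sheaf_morphism_res[OF m U V VU jc[OF U s]] ij[OF U s] by simp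
      then show "?j V (Res E' U V s) = Res E U V (?j U s)"
        by (rule ji[OF V E.res_closed[OF U V VU jc[OF U s]]])
    qed
    show "bij_betw (?j U) (carrier (Sec E' U)) (carrier (Sec E U))" if "openin T U" for U
      by (rule bij_betw_inv_into[OF bij[OF that]])
    show "\<phi> U (?j U r) (?j U s) = \<phi>' U r s"
      if "openin T U" "r \<in> carrier (Sec E' U)" "s \<in> carrier (Sec E' U)" for U r s
      using isometry_form[OF i that(1) jc[OF that(1,2)] jc[OF that(1,3)]] ij that by simp
  qed
qed

lemma isometry_onto_id: "isometry_onto T A E \<phi> E \<phi> (\<lambda>U. id)"
  by (rule isometry_ontoI) (auto simp: sheaf_morphism_def)

context symplectic_module
begin

definition transvection :: "'a \<Rightarrow> 'm \<Rightarrow> 'x set \<Rightarrow> 'm \<Rightarrow> 'm" where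
  "transvection a u U s = s \<oplus>\<^bsub>Sec E U\<^esub>
     (Res A (topspace T) U a \<otimes>\<^bsub>Sec A U\<^esub> \<phi> U s (restr U u)) \<odot>\<^bsub>Sec E U\<^esub> restr U u"

context
  fixes a u
  assumes a: "a \<in> carrier (Sec A (topspace T))" and u: "u \<in> carrier (Sec E (topspace T))"
begin

lemma transvection_coeff_closed:
  assumes U: "openin T U" and s: "s \<in> carrier (Sec E U)"
  shows "Res A (topspace T) U a \<otimes>\<^bsub>Sec A U\<^esub> \<phi> U s (restr U u) \<in> carrier (Sec A U)"
proof -
  interpret module "Sec A U" "Sec E U" by (rule sec_module[OF U])
  show ?thesis
    using res_closed[OF openin_topspace U openin_subset[OF U] a]
      form_closed[OF U s restr_closed[OF U u]] by simp
qed

lemma transvection_closed: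
  assumes U: "openin T U" and s: "s \<in> carrier (Sec E U)"
  shows "transvection a u U s \<in> carrier (Sec E U)"
proof -
  interpret module "Sec A U" "Sec E U" by (rule sec_module[OF U])
  show ?thesis
    unfolding transvection_def
    using transvection_coeff_closed[OF U s] s restr_closed[OF U u] by simp
qed

lemma form_transvection_right:
  assumes U: "openin T U" and s: "s \<in> carrier (Sec E U)"
  shows "\<phi> U (transvection a u U s) (restr U u) = \<phi> U s (restr U u)"
proof -
  interpret module "Sec A U" "Sec E U" by (rule sec_module[OF U])
  note uU = restr_closed[OF U u] and cs = transvection_coeff_closed[OF U s]
  show ?thesis
    unfolding transvection_def
    using form_add_left[OF U s smult_closed[OF cs uU] uU] form_smult_left[OF U cs uU uU]
      form_self[OF U uU] cs form_closed[OF U s uU] by simp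
qed

lemma transvection_morphism: "sheaf_morphism T A E E (transvection a u)"
  unfolding sheaf_morphism_def
proof (intro conjI allI impI ballI)
  let ?X = "topspace T"
  fix U assume U: "openin T U"
  interpret module "Sec A U" "Sec E U" by (rule sec_module[OF U])
  note uU = restr_closed[OF U u]
  have aU: "Res A ?X U a \<in> carrier (Sec A U)"
    by (rule res_closed[OF openin_topspace U openin_subset[OF U] a])
  show "transvection a u U \<in> carrier (Sec E U) \<rightarrow> carrier (Sec E U)"
    using transvection_closed[OF U] by simp
  show "transvection a u U (s \<oplus>\<^bsub>Sec E U\<^esub> t) = transvection a u U s \<oplus>\<^bsub>Sec E U\<^esub> transvection a u U t"
    if s: "s \<in> carrier (Sec E U)" and t: "t \<in> carrier (Sec E U)" for s t
    unfolding transvection_def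
    using s t uU aU form_closed[OF U s uU] form_closed[OF U t uU]
    by (simp add: form_add_left[OF U s t uU] R.r_distr smult_l_distr M.a_ac)
  show "transvection a u U (b \<odot>\<^bsub>Sec E U\<^esub> s) = b \<odot>\<^bsub>Sec E U\<^esub> transvection a u U s"
    if b: "b \<in> carrier (Sec A U)" and s: "s \<in> carrier (Sec E U)" for b s
    unfolding transvection_def
    using s uU aU b form_closed[OF U s uU]
    by (simp add: form_smult_left[OF U b s uU] smult_r_distr R.m_lcomm flip: smult_assoc1)
next
  let ?X = "topspace T"
  fix U V s assume "openin T U \<and> openin T V \<and> V \<subseteq> U" and s: "s \<in> carrier (Sec E U)"
  then have U: "openin T U" and V: "openin T V" and VU: "V \<subseteq> U" by auto
  interpret U: module "Sec A U" "Sec E U" by (rule sec_module[OF U])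
  interpret h: ring_hom_cring "Sec A U" "Sec A V" "Res A U V" by (rule res_ring_hom_cring[OF U V VU])
  note uU = restr_closed[OF U u]
  have aU: "Res A ?X U a \<in> carrier (Sec A U)"
    by (rule res_closed[OF openin_topspace U openin_subset[OF U] a])
  have aV: "Res A U V (Res A ?X U a) = Res A ?X V a"
    by (rule res_comp[OF openin_topspace U V VU openin_subset[OF U] a])
  have "Res E U V (transvection a u U s) = Res E U V s \<oplus>\<^bsub>Sec E V\<^esub>
      Res A U V (Res A ?X U a \<otimes>\<^bsub>Sec A U\<^esub> \<phi> U s (restr U u)) \<odot>\<^bsub>Sec E V\<^esub> Res E U V (restr U u)"
    unfolding transvection_def
    using transvection_coeff_closed[OF U s] s uU
    by (simp add: res_add[OF U V VU] res_smult[OF U V VU])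
  also have "Res A U V (Res A ?X U a \<otimes>\<^bsub>Sec A U\<^esub> \<phi> U s (restr U u)) =
      Res A ?X V a \<otimes>\<^bsub>Sec A V\<^esub> \<phi> V (Res E U V s) (restr V u)"
    using aU form_closed[OF U s uU] form_res[OF U V VU s uU] restr_restr[OF U V VU u] aV by simp
  also have "Res E U V (restr U u) = restr V u" by (rule restr_restr[OF U V VU u])
  finally show "transvection a u V (Res E U V s) = Res E U V (transvection a u U s)"
    by (simp add: transvection_def)
qed

text \<open>Expanding leaves two correction terms, which cancel because \<open>\<phi>(u, s) = - \<phi>(s, u)\<close>; the term with
  \<open>\<phi>(u, u)\<close> vanishes.\<close>

lemma form_transvection:
  assumes U: "openin T U" and r: "r \<in> carrier (Sec E U)" and s: "s \<in> carrier (Sec E U)"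
  shows "\<phi> U (transvection a u U r) (transvection a u U s) = \<phi> U r s"
proof -
  interpret module "Sec A U" "Sec E U" by (rule sec_module[OF U])
  let ?u = "restr U u" and ?a = "Res A (topspace T) U a"
  note uU = restr_closed[OF U u] and cs = transvection_coeff_closed[OF U s]
    and cr = transvection_coeff_closed[OF U r] and rs = form_closed[OF U r s]
    and ru = form_closed[OF U r uU] and su = form_closed[OF U s uU]
  have aU: "?a \<in> carrier (Sec A U)"
    by (rule res_closed[OF openin_topspace U openin_subset[OF U] a])
  have us: "\<phi> U ?u s = \<ominus>\<^bsub>Sec A U\<^esub> \<phi> U s ?u" by (rule form_swap[OF U uU s])
  have "\<phi> U (transvection a u U r) (transvection a u U s) =
      \<phi> U (transvection a u U r) s \<oplus>\<^bsub>Sec A U\<^esub> (?a \<otimes>\<^bsub>Sec A U\<^esub> \<phi> U s ?u) \<otimes>\<^bsub>Sec A U\<^esub> \<phi> U (transvection a u U r) ?u"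
    unfolding transvection_def[of a u U s]
    using form_add_right[OF U transvection_closed[OF U r] s smult_closed[OF cs uU]]
      form_smult_right[OF U cs transvection_closed[OF U r] uU] by simp
  also have "\<phi> U (transvection a u U r) ?u = \<phi> U r ?u"
    by (rule form_transvection_right[OF U r])
  also have "\<phi> U (transvection a u U r) s = \<phi> U r s \<oplus>\<^bsub>Sec A U\<^esub> (?a \<otimes>\<^bsub>Sec A U\<^esub> \<phi> U r ?u) \<otimes>\<^bsub>Sec A U\<^esub> \<phi> U ?u s"
    unfolding transvection_def
    using form_add_left[OF U r smult_closed[OF cr uU] s] form_smult_left[OF U cr uU s] by simp
  also have "(?a \<otimes>\<^bsub>Sec A U\<^esub> \<phi> U r ?u) \<otimes>\<^bsub>Sec A U\<^esub> \<phi> U ?u s =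
      \<ominus>\<^bsub>Sec A U\<^esub> ((?a \<otimes>\<^bsub>Sec A U\<^esub> \<phi> U s ?u) \<otimes>\<^bsub>Sec A U\<^esub> \<phi> U r ?u)"
    unfolding us using aU ru su by (simp add: R.r_minus R.m_ac)
  also have "\<phi> U r s \<oplus>\<^bsub>Sec A U\<^esub> \<ominus>\<^bsub>Sec A U\<^esub> ((?a \<otimes>\<^bsub>Sec A U\<^esub> \<phi> U s ?u) \<otimes>\<^bsub>Sec A U\<^esub> \<phi> U r ?u)
      \<oplus>\<^bsub>Sec A U\<^esub> (?a \<otimes>\<^bsub>Sec A U\<^esub> \<phi> U s ?u) \<otimes>\<^bsub>Sec A U\<^esub> \<phi> U r ?u = \<phi> U r s"
    using rs cs ru by (simp add: R.a_assoc R.l_neg)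
  finally show ?thesis .
qed

end

lemma transvection_cancel:
  assumes a: "a \<in> carrier (Sec A (topspace T))" and u: "u \<in> carrier (Sec E (topspace T))"
    and U: "openin T U" and s: "s \<in> carrier (Sec E U)"
  shows "transvection (\<ominus>\<^bsub>Sec A (topspace T)\<^esub> a) u U (transvection a u U s) = s"
proof -
  interpret module "Sec A U" "Sec E U" by (rule sec_module[OF U])
  interpret h: ring_hom_cring "Sec A (topspace T)" "Sec A U" "Res A (topspace T) U"
    by (rule res_ring_hom_cring[OF openin_topspace U openin_subset[OF U]])
  let ?c = "Res A (topspace T) U a \<otimes>\<^bsub>Sec A U\<^esub> \<phi> U s (restr U u)"
  note uU = restr_closed[OF U u] and c = transvection_coeff_closed[OF a u U s]
  have "transvection (\<ominus>\<^bsub>Sec A (topspace T)\<^esub> a) u U (transvection a u U s) =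
      (s \<oplus>\<^bsub>Sec E U\<^esub> ?c \<odot>\<^bsub>Sec E U\<^esub> restr U u) \<oplus>\<^bsub>Sec E U\<^esub> (\<ominus>\<^bsub>Sec A U\<^esub> ?c) \<odot>\<^bsub>Sec E U\<^esub> restr U u"
    unfolding transvection_def[of "\<ominus>\<^bsub>Sec A (topspace T)\<^esub> a"] form_transvection_right[OF a u U s]
    using a form_closed[OF U s uU] by (simp add: transvection_def R.l_minus)
  also have "\<dots> = s"
    using s c uU by (simp add: smult_l_minus M.a_assoc M.r_neg)
  finally show ?thesis .
qed

lemma transvection_isometry:
  assumes a: "a \<in> carrier (Sec A (topspace T))" and u: "u \<in> carrier (Sec E (topspace T))"
  shows "isometry_onto T A E \<phi> E \<phi> (transvection a u)"
proof (rule isometry_ontoI[OF transvection_morphism[OF a u]])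
  interpret X: cring "Sec A (topspace T)" by (rule sec_cring) simp
  have na: "\<ominus>\<^bsub>Sec A (topspace T)\<^esub> a \<in> carrier (Sec A (topspace T))" using a by simp
  show "bij_betw (transvection a u U) (carrier (Sec E U)) (carrier (Sec E U))" if U: "openin T U" for U
  proof (rule bij_betw_byWitness[where f' = "transvection (\<ominus>\<^bsub>Sec A (topspace T)\<^esub> a) u U"])
    show "\<forall>s\<in>carrier (Sec E U). transvection (\<ominus>\<^bsub>Sec A (topspace T)\<^esub> a) u U (transvection a u U s) = s"
      using transvection_cancel[OF a u U] by simp
    show "\<forall>s\<in>carrier (Sec E U). transvection a u U (transvection (\<ominus>\<^bsub>Sec A (topspace T)\<^esub> a) u U s) = s"
      using transvection_cancel[OF na u U] a by simp
  qed (use transvection_closed[OF a u U] transvection_closed[OF na u U] in auto)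
qed (rule form_transvection[OF a u])

text \<open>Take \<open>u = w - v\<close> and \<open>a = 1/\<phi>(v, w)\<close>.  Then \<open>\<phi>(v, u) = \<phi>(v, w)\<close>, so \<open>v\<close> goes to \<open>v + u = w\<close>, and
  every \<open>h\<close> that pairs equally with \<open>v\<close> and \<open>w\<close> is orthogonal to \<open>u\<close>, hence fixed.\<close>

lemma transvection_move:
  assumes v: "v \<in> carrier (Sec E (topspace T))" and w: "w \<in> carrier (Sec E (topspace T))"
    and unit: "\<phi> (topspace T) v w \<in> Units (Sec A (topspace T))"
  obtains \<tau> where "isometry_onto T A E \<phi> E \<phi> \<tau>" "\<tau> (topspace T) v = w"
    "\<And>h. \<lbrakk>h \<in> carrier (Sec E (topspace T)); \<phi> (topspace T) h v = \<phi> (topspace T) h w\<rbrakk>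
      \<Longrightarrow> \<tau> (topspace T) h = h"
proof -
  let ?X = "topspace T"
  have X: "openin T ?X" by simp
  interpret module "Sec A ?X" "Sec E ?X" by (rule sec_module[OF X])
  define u where "u = w \<ominus>\<^bsub>Sec E ?X\<^esub> v"
  define a where "a = inv\<^bsub>Sec A ?X\<^esub> (\<phi> ?X v w)"
  have u: "u \<in> carrier (Sec E ?X)" using v w by (simp add: u_def)
  have a: "a \<in> carrier (Sec A ?X)" using unit by (simp add: a_def)
  have hu: "\<phi> ?X h u = \<phi> ?X h w \<ominus>\<^bsub>Sec A ?X\<^esub> \<phi> ?X h v" if h: "h \<in> carrier (Sec E ?X)" for h
  proof -
    have "u \<oplus>\<^bsub>Sec E ?X\<^esub> v = w" using v w by (simp add: u_def M.minus_eq M.a_assoc M.l_neg)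
    then have sum: "\<phi> ?X h w = \<phi> ?X h u \<oplus>\<^bsub>Sec A ?X\<^esub> \<phi> ?X h v"
      using form_add_right[OF X h u v] by simp
    then show ?thesis
      using form_closed[OF X h u] form_closed[OF X h v] 
      by (simp add: sum R.minus_eq R.a_assoc R.r_neg)
  qed
  have T: "transvection a u ?X h = h \<oplus>\<^bsub>Sec E ?X\<^esub> (a \<otimes>\<^bsub>Sec A ?X\<^esub> \<phi> ?X h u) \<odot>\<^bsub>Sec E ?X\<^esub> u" for h
    by (simp add: transvection_def res_id[OF X a] E.res_id[OF X u])
  show thesis
  proof (rule that[OF transvection_isometry[OF a u]])
    have "\<phi> ?X v u = \<phi> ?X v w"
      using hu[OF v] form_self[OF X v] form_closed[OF X v w] by (simp add: R.minus_eq)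
    then have "a \<otimes>\<^bsub>Sec A ?X\<^esub> \<phi> ?X v u = \<one>\<^bsub>Sec A ?X\<^esub>" using unit by (simp add: a_def)
    moreover have "v \<oplus>\<^bsub>Sec E ?X\<^esub> u = w"
      using v w M.a_comm[OF v u] by (simp add: u_def M.minus_eq M.a_assoc M.l_neg)
    ultimately show "transvection a u ?X v = w"
      using u unfolding T by simp
  next
    fix h assume h: "h \<in> carrier (Sec E ?X)" and eq: "\<phi> ?X h v = \<phi> ?X h w"
    have "\<phi> ?X h u = \<zero>\<^bsub>Sec A ?X\<^esub>"
      using hu[OF h] eq form_closed[OF X h w] by (simp add: R.minus_eq R.r_neg)
    then show "transvection a u ?X h = h" using a u h unfolding T by simp
  qed
qed

end

section \<open>Linear relations between global sections\<close>

text \<open>More than \<open>n\<close> vectors with \<open>n\<close> coordinates are linearly dependent, by Gaussian elimination of the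
  last coordinate with pivot row \<open>p\<close>.\<close>

lemma (in field) exists_nontrivial_relation:
  fixes x :: "'j \<Rightarrow> nat \<Rightarrow> 'a"
  assumes "finite J" "n < card J" "\<And>j i. \<lbrakk>j \<in> J; i < n\<rbrakk> \<Longrightarrow> x j i \<in> carrier R"
  shows "\<exists>c \<in> J \<rightarrow> carrier R. (\<exists>j\<in>J. c j \<noteq> \<zero>) \<and> (\<forall>i<n. (\<Oplus>j\<in>J. c j \<otimes> x j i) = \<zero>)"
  using assms
proof (induction n arbitrary: J x)
  case 0
  then have "J \<noteq> {}" by auto
  then show ?case by (intro bexI[of _ "\<lambda>_. \<one>"]) auto
next
  case (Suc n)
  show ?case
  proof (cases "\<exists>p\<in>J. x p n \<noteq> \<zero>")
    case False
    have "n < card J" using Suc.prems(2) by simp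
    then obtain c where c: "c \<in> J \<rightarrow> carrier R" "\<exists>j\<in>J. c j \<noteq> \<zero>"
      and rel: "\<And>i. i < n \<Longrightarrow> (\<Oplus>j\<in>J. c j \<otimes> x j i) = \<zero>"
      using Suc.IH[of J x] Suc.prems by (auto simp: Pi_iff)
    have "(\<Oplus>j\<in>J. c j \<otimes> x j n) = (\<Oplus>j\<in>J. \<zero>)"
      by (rule finsum_cong') (use False c in \<open>auto simp: Pi_iff\<close>)
    then have "(\<Oplus>j\<in>J. c j \<otimes> x j n) = \<zero>" by simp
    then show ?thesis
      using c rel by (intro bexI[of _ c]) (auto simp: less_Suc_eq)
  next
    case True
    then obtain p where p: "p \<in> J" "x p n \<noteq> \<zero>" by blast
    define K where "K = J - {p}"
    have K: "finite K" "p \<notin> K" "J = insert p K" using Suc.prems(1) p by (auto simp: K_def)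
    have xc: "x j i \<in> carrier R" if "j \<in> J" "i \<le> n" for j i using Suc.prems(3) that by simp
    define r where "r j = x j n \<otimes> inv (x p n)" for j
    have inv_p: "inv (x p n) \<in> carrier R" "inv (x p n) \<otimes> x p n = \<one>"
      using xc[OF p(1)] p(2) by (simp_all add: field_Units)
    have rc: "r j \<in> carrier R" if "j \<in> J" for j using xc[OF that] inv_p by (simp add: r_def)
    define y where "y j i = x j i \<ominus> r j \<otimes> x p i" for j i
    have yc: "y j i \<in> carrier R" if "j \<in> J" "i \<le> n" for j i
      using xc[OF that] rc[OF that(1)] xc[OF p(1) that(2)] by (simp add: y_def)
    have "n < card K" using Suc.prems(2) K by simp
    then obtain c where c: "c \<in> K \<rightarrow> carrier R" "\<exists>j\<in>K. c j \<noteq> \<zero>"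
      and rel: "\<And>i. i < n \<Longrightarrow> (\<Oplus>j\<in>K. c j \<otimes> y j i) = \<zero>"
      using Suc.IH[of K y] K yc by (auto simp: Pi_iff)
    have yn: "y j n = \<zero>" if "j \<in> J" for j
    proof -
      have "r j \<otimes> x p n = x j n"
        using xc[OF that] xc[OF p(1)] inv_p by (simp add: r_def m_assoc)
      then show ?thesis using xc[OF that] by (simp add: y_def minus_eq r_neg)
    qed
    have rel_n: "(\<Oplus>j\<in>K. c j \<otimes> y j n) = \<zero>"
    proof -
      have "(\<Oplus>j\<in>K. c j \<otimes> y j n) = (\<Oplus>j\<in>K. \<zero>)"
        by (rule finsum_cong') (use yn c K in \<open>auto simp: Pi_iff\<close>)
      then show ?thesis by simp
    qed
    define b where "b = (\<Oplus>j\<in>K. c j \<otimes> r j)"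
    have crc: "(\<lambda>j. c j \<otimes> r j) \<in> K \<rightarrow> carrier R" using c rc K by auto
    have bc: "b \<in> carrier R" unfolding b_def by (rule finsum_closed[OF crc])
    \<comment> \<open>the relation \<open>c\<close> between the reduced rows \<open>y\<close>, rewritten in terms of the rows \<open>x\<close>\<close>
    define d where "d = c(p := \<ominus> b)"
    have "(\<Oplus>j\<in>J. d j \<otimes> x j i) = \<zero>" if i: "i \<le> n" for i
    proof -
      have xpi: "x p i \<in> carrier R" by (rule xc[OF p(1) i])
      have "(\<Oplus>j\<in>J. d j \<otimes> x j i) = d p \<otimes> x p i \<oplus> (\<Oplus>j\<in>K. d j \<otimes> x j i)"
        unfolding K(3) by (rule finsum_insert) (use K c xc i bc in \<open>auto simp: d_def Pi_iff\<close>)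
      also have "(\<Oplus>j\<in>K. d j \<otimes> x j i) = (\<Oplus>j\<in>K. c j \<otimes> y j i \<oplus> (c j \<otimes> r j) \<otimes> x p i)"
      proof (rule finsum_cong')
        fix j assume j: "j \<in> K"
        then have cc: "c j \<in> carrier R" "r j \<in> carrier R" "x j i \<in> carrier R" "y j i \<in> carrier R" "j \<noteq> p"
          using c rc K xc yc i by auto
        have "y j i \<oplus> r j \<otimes> x p i = x j i"
          using cc xpi by (simp add: y_def minus_eq a_assoc l_neg)
        then have "c j \<otimes> x j i = c j \<otimes> y j i \<oplus> c j \<otimes> (r j \<otimes> x p i)"
          using cc xpi by (metis m_closed r_distr)
        then show "d j \<otimes> x j i = c j \<otimes> y j i \<oplus> (c j \<otimes> r j) \<otimes> x p i"
          using cc xpi by (simp add: d_def m_assoc)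
      qed (use c yc rc K i xpi in \<open>auto simp: Pi_iff\<close>)
      also have "\<dots> = (\<Oplus>j\<in>K. c j \<otimes> y j i) \<oplus> (\<Oplus>j\<in>K. (c j \<otimes> r j) \<otimes> x p i)"
        by (rule finsum_addf) (use c yc rc K i xpi in \<open>auto simp: Pi_iff\<close>)
      also have "(\<Oplus>j\<in>K. (c j \<otimes> r j) \<otimes> x p i) = b \<otimes> x p i"
        unfolding b_def by (rule finsum_ldistr[OF K(1) xpi crc, symmetric])
      also have "(\<Oplus>j\<in>K. c j \<otimes> y j i) = \<zero>"
        using rel rel_n i by (cases "i = n") auto
      also have "d p \<otimes> x p i \<oplus> (\<zero> \<oplus> b \<otimes> x p i) = \<zero>"
        using bc xpi by (simp add: d_def l_minus l_neg)
      finally show ?thesis .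
    qed
    moreover have "d \<in> J \<rightarrow> carrier R" using c bc K by (auto simp: d_def)
    moreover have "\<exists>j\<in>J. d j \<noteq> \<zero>" using c(2) K by (auto simp: d_def)
    ultimately show ?thesis by (intro bexI[of _ d]) auto
  qed
qed

context sheaf_of_modules
begin

lemma lincomb_lincomb:
  assumes U: "openin T U" and J: "finite J" and K: "finite K"
    and e: "e \<in> K \<rightarrow> carrier (Sec E (topspace T))" and h: "h \<in> J \<rightarrow> carrier (Sec E (topspace T))"
    and c: "c \<in> J \<rightarrow> carrier (Sec A U)" and x: "\<And>j. j \<in> J \<Longrightarrow> x j \<in> K \<rightarrow> carrier (Sec A U)"
    and hx: "\<And>j. j \<in> J \<Longrightarrow> restr U (h j) = lincomb U K (x j) e"
  shows "lincomb U J c h = lincomb U K (\<lambda>i. \<Oplus>\<^bsub>Sec A U\<^esub>j\<in>J. c j \<otimes>\<^bsub>Sec A U\<^esub> x j i) e"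
  using J h c x hx
proof (induction J rule: finite_induct)
  case empty
  interpret module "Sec A U" "Sec E U" by (rule sec_module[OF U])
  show ?case by (simp add: lincomb_empty[OF U] lincomb_zero[OF K e U])
next
  case (insert j J)
  interpret module "Sec A U" "Sec E U" by (rule sec_module[OF U])
  let ?s = "\<lambda>i. \<Oplus>\<^bsub>Sec A U\<^esub>j\<in>J. c j \<otimes>\<^bsub>Sec A U\<^esub> x j i"
  have cx: "(\<lambda>k. c k \<otimes>\<^bsub>Sec A U\<^esub> x k i) \<in> insert j J \<rightarrow> carrier (Sec A U)" if "i \<in> K" for i
    using insert.prems(2) insert.prems(3) that by (simp add: Pi_iff)
  have cj: "c j \<in> carrier (Sec A U)" and xj: "x j \<in> K \<rightarrow> carrier (Sec A U)"
    using insert.prems by auto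
  have s: "?s \<in> K \<rightarrow> carrier (Sec A U)"
    using cx by (intro funcsetI R.finsum_closed) auto
  have cxj: "(\<lambda>i. c j \<otimes>\<^bsub>Sec A U\<^esub> x j i) \<in> K \<rightarrow> carrier (Sec A U)"
    using cj xj by auto
  have "lincomb U (insert j J) c h = c j \<odot>\<^bsub>Sec E U\<^esub> restr U (h j) \<oplus>\<^bsub>Sec E U\<^esub> lincomb U J c h"
    by (rule lincomb_insert[OF insert.hyps insert.prems(1) U insert.prems(2)])
  also have "lincomb U J c h = lincomb U K ?s e"
    using insert by auto
  also have "c j \<odot>\<^bsub>Sec E U\<^esub> restr U (h j) = lincomb U K (\<lambda>i. c j \<otimes>\<^bsub>Sec A U\<^esub> x j i) e"
    using lincomb_smult[OF K e U cj xj] insert.prems(4)[of j] by simp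
  also have "\<dots> \<oplus>\<^bsub>Sec E U\<^esub> lincomb U K ?s e =
      lincomb U K (\<lambda>i. c j \<otimes>\<^bsub>Sec A U\<^esub> x j i \<oplus>\<^bsub>Sec A U\<^esub> ?s i) e"
    by (rule lincomb_add[OF K e U cxj s, symmetric])
  also have "\<dots> = lincomb U K (\<lambda>i. \<Oplus>\<^bsub>Sec A U\<^esub>j\<in>insert j J. c j \<otimes>\<^bsub>Sec A U\<^esub> x j i) e"
  proof (rule lincomb_cong[OF K e U])
    show "(\<lambda>i. \<Oplus>\<^bsub>Sec A U\<^esub>j\<in>insert j J. c j \<otimes>\<^bsub>Sec A U\<^esub> x j i) \<in> K \<rightarrow> carrier (Sec A U)"
      by (intro funcsetI R.finsum_closed cx)
    show "c j \<otimes>\<^bsub>Sec A U\<^esub> x j i \<oplus>\<^bsub>Sec A U\<^esub> ?s i = (\<Oplus>\<^bsub>Sec A U\<^esub>j\<in>insert j J. c j \<otimes>\<^bsub>Sec A U\<^esub> x j i)"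
      if "i \<in> K" for i
      using cx[OF that] insert.hyps by (subst R.finsum_insert) auto
  qed
  finally show ?case .
qed

end

context sheaf_of_modules
begin

lemma not_in_span_sheaf:
  assumes J: "finite J" "j \<notin> J" and h: "h \<in> insert j J \<rightarrow> carrier (Sec E (topspace T))"
    and ind: "lin_indep (insert j J) h"
    and one: "\<one>\<^bsub>Sec A (topspace T)\<^esub> \<noteq> \<zero>\<^bsub>Sec A (topspace T)\<^esub>"
  shows "h j \<notin> span_sheaf J h (topspace T)"
proof
  let ?X = "topspace T"
  have X: "openin T ?X" by simp
  interpret module "Sec A ?X" "Sec E ?X" by (rule sec_module[OF X])
  assume "h j \<in> span_sheaf J h ?X"
  then obtain c where c: "c \<in> J \<rightarrow> carrier (Sec A ?X)" "h j = lincomb ?X J c h"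
    by (rule span_sheafE)
  have hJ: "h \<in> J \<rightarrow> carrier (Sec E ?X)" and hj: "h j \<in> carrier (Sec E ?X)" using h by auto
  let ?d = "c(j := \<ominus>\<^bsub>Sec A ?X\<^esub> \<one>\<^bsub>Sec A ?X\<^esub>)"
  have d: "?d \<in> insert j J \<rightarrow> carrier (Sec A ?X)" using c(1) by auto
  have "lincomb ?X (insert j J) ?d h = ?d j \<odot>\<^bsub>Sec E ?X\<^esub> restr ?X (h j) \<oplus>\<^bsub>Sec E ?X\<^esub> lincomb ?X J ?d h"
    by (rule lincomb_insert[OF J h X d])
  also have "lincomb ?X J ?d h = lincomb ?X J c h"
    by (rule lincomb_cong[OF J(1) hJ X c(1)]) (use J(2) in auto)
  also have "\<dots> = h j" using c(2) by simp
  also have "?d j \<odot>\<^bsub>Sec E ?X\<^esub> restr ?X (h j) = \<ominus>\<^bsub>Sec E ?X\<^esub> h j"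
    using hj E.res_id[OF X hj] by (simp add: smult_l_minus)
  also have "\<ominus>\<^bsub>Sec E ?X\<^esub> h j \<oplus>\<^bsub>Sec E ?X\<^esub> h j = \<zero>\<^bsub>Sec E ?X\<^esub>" by (rule M.l_neg[OF hj])
  finally have "?d j = \<zero>\<^bsub>Sec A ?X\<^esub>"
    by (rule lin_indepD[OF ind X d _ insertI1])
  then have "\<one>\<^bsub>Sec A ?X\<^esub> = \<zero>\<^bsub>Sec A ?X\<^esub>"
    by (metis R.minus_minus R.minus_zero R.one_closed fun_upd_same)
  then show False using one by simp
qed

lemma morphism_lincomb:
  assumes sub: "sub_sheaf_of_modules T A E F" and \<sigma>: "sheaf_morphism T A (sub_sheaf E F) E \<sigma>"
    and U: "openin T U" and J: "finite J" and f: "f \<in> J \<rightarrow> F (topspace T)" and c: "c \<in> J \<rightarrow> carrier (Sec A U)"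
  shows "lincomb U J c f \<in> F U \<and> \<sigma> U (lincomb U J c f) = lincomb U J c (\<lambda>i. \<sigma> (topspace T) (f i))"
  using J f c
proof (induction J rule: finite_induct)
  case empty
  interpret module "Sec A U" "Sec E U" by (rule sec_module[OF U])
  have Fsub: "submodule (F U) (Sec A U) (Sec E U)"
    using sub U by (simp add: sub_sheaf_of_modules_def)
  have z: "\<zero>\<^bsub>Sec E U\<^esub> \<in> F U" using submodule.axioms(1)[OF Fsub] subgroup.one_closed by fastforce
  have "\<sigma> U (\<zero>\<^bsub>Sec A U\<^esub> \<odot>\<^bsub>Sec (sub_sheaf E F) U\<^esub> \<zero>\<^bsub>Sec E U\<^esub>) = \<zero>\<^bsub>Sec A U\<^esub> \<odot>\<^bsub>Sec E U\<^esub> \<sigma> U \<zero>\<^bsub>Sec E U\<^esub>"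
    by (rule sheaf_morphism_smult[OF \<sigma> U]) (use z in \<open>simp_all add: sub_sheaf_def\<close>)
  moreover have "\<sigma> U \<zero>\<^bsub>Sec E U\<^esub> \<in> carrier (Sec E U)"
    by (rule sheaf_morphism_closed[OF \<sigma> U]) (use z in \<open>simp add: sub_sheaf_def\<close>)
  ultimately have "\<sigma> U \<zero>\<^bsub>Sec E U\<^esub> = \<zero>\<^bsub>Sec E U\<^esub>" by (simp add: sub_sheaf_def)
  then show ?case using z by (simp add: lincomb_empty[OF U])
next
  case (insert j J)
  let ?X = "topspace T"
  have X: "openin T ?X" by simp
  interpret module "Sec A U" "Sec E U" by (rule sec_module[OF U])
  have Fsub: "submodule (F V) (Sec A V) (Sec E V)" if "openin T V" for V
    using sub that by (simp add: sub_sheaf_of_modules_def)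
  have FX: "F ?X \<subseteq> carrier (Sec E ?X)" by (rule module.submoduleE(1)[OF sec_module[OF X] Fsub[OF X]])
  interpret F: sheaf_of_sets T F "Res E"
    using sub by (simp add: sub_sheaf_of_modules_def)
  have fj: "f j \<in> F ?X" and cj: "c j \<in> carrier (Sec A U)" using insert.prems by auto
  have fjU: "restr U (f j) \<in> F U" by (rule F.res_closed[OF X U openin_subset[OF U] fj])
  have cfU: "c j \<odot>\<^bsub>Sec E U\<^esub> restr U (f j) \<in> F U"
    by (rule submoduleE(4)[OF Fsub[OF U] cj fjU])
  have IH: "lincomb U J c f \<in> F U" "\<sigma> U (lincomb U J c f) = lincomb U J c (\<lambda>i. \<sigma> ?X (f i))"
    using insert by auto
  have fE: "f \<in> insert j J \<rightarrow> carrier (Sec E ?X)" using insert.prems(1) FX by auto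
  have \<sigma>c: "\<sigma> ?X s \<in> carrier (Sec E ?X)" if "s \<in> F ?X" for s
    using sheaf_morphism_closed[OF \<sigma> X] that by (simp add: sub_sheaf_def)
  have \<sigma>f: "(\<lambda>i. \<sigma> ?X (f i)) \<in> insert j J \<rightarrow> carrier (Sec E ?X)"
    using insert.prems(1) \<sigma>c by auto
  have l: "lincomb U (insert j J) c f = c j \<odot>\<^bsub>Sec E U\<^esub> restr U (f j) \<oplus>\<^bsub>Sec E U\<^esub> lincomb U J c f"
    by (rule lincomb_insert[OF insert.hyps fE U insert.prems(2)])
  have "\<sigma> U (c j \<odot>\<^bsub>Sec E U\<^esub> restr U (f j) \<oplus>\<^bsub>Sec E U\<^esub> lincomb U J c f) =
      \<sigma> U (c j \<odot>\<^bsub>Sec E U\<^esub> restr U (f j)) \<oplus>\<^bsub>Sec E U\<^esub> \<sigma> U (lincomb U J c f)"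
    using sheaf_morphism_add[OF \<sigma> U, of "c j \<odot>\<^bsub>Sec E U\<^esub> restr U (f j)" "lincomb U J c f"] cfU IH(1)
    by (simp add: sub_sheaf_def)
  also have "\<sigma> U (c j \<odot>\<^bsub>Sec E U\<^esub> restr U (f j)) = c j \<odot>\<^bsub>Sec E U\<^esub> \<sigma> U (restr U (f j))"
    using sheaf_morphism_smult[OF \<sigma> U cj, of "restr U (f j)"] fjU by (simp add: sub_sheaf_def)
  also have "\<sigma> U (restr U (f j)) = restr U (\<sigma> ?X (f j))"
    using sheaf_morphism_res[OF \<sigma> X U openin_subset[OF U], of "f j"] fj by (simp add: sub_sheaf_def)
  also note IH(2)
  also have "c j \<odot>\<^bsub>Sec E U\<^esub> restr U (\<sigma> ?X (f j)) \<oplus>\<^bsub>Sec E U\<^esub> lincomb U J c (\<lambda>i. \<sigma> ?X (f i)) =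
      lincomb U (insert j J) c (\<lambda>i. \<sigma> ?X (f i))"
    by (rule lincomb_insert[OF insert.hyps \<sigma>f U insert.prems(2), symmetric])
  finally show ?case
    using l submoduleE(5)[OF Fsub[OF U] cfU IH(1)] by simp
qed

end

section \<open>Extension of isometries\<close>

context symplectic_module
begin

text \<open>If \<open>\<phi>(v, w) \<noteq> 0\<close>, a single transvection moves \<open>v\<close> to \<open>w\<close>.  Otherwise two of them do, through
  \<open>z = v + y\<close>, where \<open>y\<close> is orthogonal to the family \<open>h\<close> but to neither \<open>v\<close> nor \<open>w\<close>.\<close>

lemma exchange_isometry:
  fixes J :: "'m set"
  assumes nontrivial: "openin T W" "carrier (Sec E W) \<noteq> {\<zero>\<^bsub>Sec E W\<^esub>}"
    and J: "finite J" and h: "h \<in> J \<rightarrow> carrier (Sec E (topspace T))" and ind: "lin_indep J h"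
    and v: "v \<in> carrier (Sec E (topspace T))" and nv: "v \<notin> span_sheaf J h (topspace T)"
    and w: "w \<in> carrier (Sec E (topspace T))" and nw: "w \<notin> span_sheaf J h (topspace T)"
    and vw: "\<And>i. i \<in> J \<Longrightarrow> \<phi> (topspace T) (h i) v = \<phi> (topspace T) (h i) w"
  obtains \<tau> where "isometry_onto T A E \<phi> E \<phi> \<tau>" "\<tau> (topspace T) v = w"
    "\<And>i. i \<in> J \<Longrightarrow> \<tau> (topspace T) (h i) = h i"
proof -
  let ?X = "topspace T"
  have X: "openin T ?X" by simp
  interpret module "Sec A ?X" "Sec E ?X" by (rule sec_module[OF X])
  have hc: "h i \<in> carrier (Sec E ?X)" if "i \<in> J" for i using h that by auto
  note unit = nonzero_global_unit[OF nontrivial form_closed[OF X]]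
  show thesis
  proof (cases "\<phi> ?X v w = \<zero>\<^bsub>Sec A ?X\<^esub>")
    case False
    show thesis
      by (rule transvection_move[OF v w unit[OF v w False]]) (use that vw hc in blast)
  next
    case True
    obtain y1 where y1: "y1 \<in> carrier (Sec E ?X)" "\<And>i. i \<in> J \<Longrightarrow> \<phi> ?X (h i) y1 = \<zero>\<^bsub>Sec A ?X\<^esub>"
      "\<phi> ?X v y1 \<noteq> \<zero>\<^bsub>Sec A ?X\<^esub>"
      using separating_section[OF J h ind v nv] by blast
    obtain y2 where y2: "y2 \<in> carrier (Sec E ?X)" "\<And>i. i \<in> J \<Longrightarrow> \<phi> ?X (h i) y2 = \<zero>\<^bsub>Sec A ?X\<^esub>"
      "\<phi> ?X w y2 \<noteq> \<zero>\<^bsub>Sec A ?X\<^esub>"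
      using separating_section[OF J h ind w nw] by blast
    \<comment> \<open>one of \<open>y1\<close>, \<open>y2\<close>, \<open>y1 + y2\<close> pairs nontrivially with both \<open>v\<close> and \<open>w\<close>\<close>
    have "\<exists>y. y \<in> carrier (Sec E ?X) \<and> (\<forall>i\<in>J. \<phi> ?X (h i) y = \<zero>\<^bsub>Sec A ?X\<^esub>) \<and>
        \<phi> ?X v y \<noteq> \<zero>\<^bsub>Sec A ?X\<^esub> \<and> \<phi> ?X w y \<noteq> \<zero>\<^bsub>Sec A ?X\<^esub>"
    proof (cases "\<phi> ?X w y1 = \<zero>\<^bsub>Sec A ?X\<^esub> \<and> \<phi> ?X v y2 = \<zero>\<^bsub>Sec A ?X\<^esub>")
      case False
      then show ?thesis using y1 y2 by metis
    next
      case True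
      have "\<phi> ?X v (y1 \<oplus>\<^bsub>Sec E ?X\<^esub> y2) = \<phi> ?X v y1"
        using form_add_right[OF X v y1(1) y2(1)] True form_closed[OF X v y1(1)] by simp
      moreover have "\<phi> ?X w (y1 \<oplus>\<^bsub>Sec E ?X\<^esub> y2) = \<phi> ?X w y2"
        using form_add_right[OF X w y1(1) y2(1)] True form_closed[OF X w y2(1)] by simp
      moreover have "\<phi> ?X (h i) (y1 \<oplus>\<^bsub>Sec E ?X\<^esub> y2) = \<zero>\<^bsub>Sec A ?X\<^esub>" if "i \<in> J" for i
        using form_add_right[OF X hc[OF that] y1(1) y2(1)] y1(2)[OF that] y2(2)[OF that] by simp
      ultimately show ?thesis
        using y1(1,3) y2(1,3) by (intro exI[of _ "y1 \<oplus>\<^bsub>Sec E ?X\<^esub> y2"]) simp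
    qed
    then obtain y where y: "y \<in> carrier (Sec E ?X)" and hy: "\<And>i. i \<in> J \<Longrightarrow> \<phi> ?X (h i) y = \<zero>\<^bsub>Sec A ?X\<^esub>"
      and vy: "\<phi> ?X v y \<noteq> \<zero>\<^bsub>Sec A ?X\<^esub>" and wy: "\<phi> ?X w y \<noteq> \<zero>\<^bsub>Sec A ?X\<^esub>" by blast
    define z where "z = v \<oplus>\<^bsub>Sec E ?X\<^esub> y"
    have z: "z \<in> carrier (Sec E ?X)" using v y by (simp add: z_def)
    have hz: "\<phi> ?X (h i) v = \<phi> ?X (h i) z" if "i \<in> J" for i
      using form_add_right[OF X hc[OF that] v y] hy[OF that] form_closed[OF X hc[OF that] v]
      by (simp add: z_def)
    have "\<phi> ?X v z = \<phi> ?X v y"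
      using form_add_right[OF X v v y] form_self[OF X v] form_closed[OF X v y] by (simp add: z_def)
    then have vz: "\<phi> ?X v z \<noteq> \<zero>\<^bsub>Sec A ?X\<^esub>" using vy by simp
    have "\<phi> ?X z w = \<phi> ?X y w"
      using form_add_left[OF X v y w] True form_closed[OF X y w] by (simp add: z_def)
    then have zw: "\<phi> ?X z w \<noteq> \<zero>\<^bsub>Sec A ?X\<^esub>"
      using wy form_zero_commute[OF X y w] by simp
    obtain \<tau>1 where t1: "isometry_onto T A E \<phi> E \<phi> \<tau>1" "\<tau>1 ?X v = z"
      "\<And>i. i \<in> J \<Longrightarrow> \<tau>1 ?X (h i) = h i"
      by (rule transvection_move[OF v z unit[OF v z vz]]) (use hz hc in blast)
    obtain \<tau>2 where t2: "isometry_onto T A E \<phi> E \<phi> \<tau>2" "\<tau>2 ?X z = w"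
      "\<And>i. i \<in> J \<Longrightarrow> \<tau>2 ?X (h i) = h i"
      by (rule transvection_move[OF z w unit[OF z w zw]]) (use hz vw hc in metis)
    show thesis
      by (rule that[OF isometry_onto_comp[OF t1(1) t2(1)]]) (use t1 t2 in auto)
  qed
qed

text \<open>A dimension count over the field of global sections: \<open>E\<close> has a frame of \<open>m\<close> global sections, so
  \<open>m + 1\<close> global sections of \<open>F\<close> satisfy a linear relation.\<close>

lemma finite_frame:
  assumes nontrivial: "openin T W" "carrier (Sec E W) \<noteq> {\<zero>\<^bsub>Sec E W\<^esub>}"
    and frame: "free_frame T A E F I \<tau>"
  shows "finite I"
proof (rule ccontr)
  assume "infinite I"
  let ?X = "topspace T"
  have X: "openin T ?X" by simp
  interpret module "Sec A ?X" "Sec E ?X" by (rule sec_module[OF X])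
  interpret F: free_frame T A E F I \<tau> by (rule frame)
  obtain m where "free_of_rank T A E m"
    using convenient unfolding convenient_module_def by (elim conjE exE)
  then obtain \<tau>' where "free_frame T A E (\<lambda>U. carrier (Sec E U)) {..<m} \<tau>'"
    by (rule free_of_rank_frame)
  then interpret B: free_frame T A E "\<lambda>U. carrier (Sec E U)" "{..<m}" \<tau>' .
  have "field (Sec A ?X)"
  proof (rule R.cring_fieldI)
    have "\<zero>\<^bsub>Sec A ?X\<^esub> \<notin> Units (Sec A ?X)"
    proof
      assume "\<zero>\<^bsub>Sec A ?X\<^esub> \<in> Units (Sec A ?X)"
      then have "\<one>\<^bsub>Sec A ?X\<^esub> = \<zero>\<^bsub>Sec A ?X\<^esub>"
        by (metis R.Units_inv_closed R.Units_l_inv R.r_null)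
      then show False using zero_ring_imp_zero_module[OF _ nontrivial(1)] nontrivial(2) by simp
    qed
    then show "Units (Sec A ?X) = carrier (Sec A ?X) - {\<zero>\<^bsub>Sec A ?X\<^esub>}"
      using nonzero_global_unit[OF nontrivial] R.Units_closed by blast
  qed
  then interpret K: field "Sec A ?X" .
  obtain J where J: "J \<subseteq> I" "finite J" "card J = Suc m"
    using infinite_arbitrarily_large[OF \<open>infinite I\<close>, of "Suc m"] by blast
  have h: "F.frame \<in> J \<rightarrow> carrier (Sec E ?X)" and e: "B.frame \<in> {..<m} \<rightarrow> carrier (Sec E ?X)"
    using F.frame_closed B.frame_closed by auto
  have "\<exists>x. x \<in> {..<m} \<rightarrow> carrier (Sec A ?X) \<and> restr ?X (F.frame j) = lincomb ?X {..<m} x B.frame" for j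
    using B.sub_eq_span[OF _ X] E.res_closed[OF X X subset_refl F.frame_closed[of j]]
    unfolding span_sheaf_def by blast
  then obtain x where x: "\<And>j. x j \<in> {..<m} \<rightarrow> carrier (Sec A ?X)"
    and hx: "\<And>j. restr ?X (F.frame j) = lincomb ?X {..<m} (x j) B.frame"
    by metis
  have xc: "x j i \<in> carrier (Sec A ?X)" if "i < m" for j i using x[of j] that by auto
  have "m < card J" using J(3) by simp
  then have "\<exists>c \<in> J \<rightarrow> carrier (Sec A ?X). (\<exists>j\<in>J. c j \<noteq> \<zero>\<^bsub>Sec A ?X\<^esub>) \<and>
      (\<forall>i<m. (\<Oplus>\<^bsub>Sec A ?X\<^esub>j\<in>J. c j \<otimes>\<^bsub>Sec A ?X\<^esub> x j i) = \<zero>\<^bsub>Sec A ?X\<^esub>)"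
    by (rule K.exists_nontrivial_relation[OF J(2)]) (rule xc)
  then obtain c where c: "c \<in> J \<rightarrow> carrier (Sec A ?X)" and nz: "\<exists>j\<in>J. c j \<noteq> \<zero>\<^bsub>Sec A ?X\<^esub>"
    and rel: "\<forall>i<m. (\<Oplus>\<^bsub>Sec A ?X\<^esub>j\<in>J. c j \<otimes>\<^bsub>Sec A ?X\<^esub> x j i) = \<zero>\<^bsub>Sec A ?X\<^esub>"
    by blast
  have "lincomb ?X J c F.frame =
      lincomb ?X {..<m} (\<lambda>i. \<Oplus>\<^bsub>Sec A ?X\<^esub>j\<in>J. c j \<otimes>\<^bsub>Sec A ?X\<^esub> x j i) B.frame"
    by (rule lincomb_lincomb[OF X J(2) _ e h c x hx]) simp
  also have "\<dots> = lincomb ?X {..<m} (\<lambda>i. \<zero>\<^bsub>Sec A ?X\<^esub>) B.frame"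
    by (rule lincomb_cong[OF _ e X]) (use rel in auto)
  also have "\<dots> = \<zero>\<^bsub>Sec E ?X\<^esub>" by (rule lincomb_zero[OF _ e X]) simp
  finally have "lincomb ?X J c F.frame = \<zero>\<^bsub>Sec E ?X\<^esub>" .
  then have "c j = \<zero>\<^bsub>Sec A ?X\<^esub>" if "j \<in> J" for j
    by (rule lin_indepD[OF F.lin_indep_frame[OF J(2,1)] X c _ that])
  then show False using nz by blast
qed

text \<open>Induction on the number of matched vectors.  Once \<open>\<tau>\<close> is correct on \<open>J\<close>, the vectors \<open>\<tau>(f j)\<close> and
  \<open>g j\<close> pair equally with every \<open>g i\<close>, \<open>i \<in> J\<close>, and neither lies in the span of these, so an exchange
  isometry that fixes them corrects \<open>\<tau>\<close> at \<open>j\<close>.\<close>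

lemma isometry_matching_families:
  fixes I :: "'m set"
  assumes nontrivial: "openin T W" "carrier (Sec E W) \<noteq> {\<zero>\<^bsub>Sec E W\<^esub>}"
    and I: "finite I" and f: "f \<in> I \<rightarrow> carrier (Sec E (topspace T))" and indf: "lin_indep I f"
    and g: "g \<in> I \<rightarrow> carrier (Sec E (topspace T))" and indg: "lin_indep I g"
    and fg: "\<And>i j. \<lbrakk>i \<in> I; j \<in> I\<rbrakk> \<Longrightarrow> \<phi> (topspace T) (g i) (g j) = \<phi> (topspace T) (f i) (f j)"
  shows "\<exists>\<tau>. isometry_onto T A E \<phi> E \<phi> \<tau> \<and> (\<forall>i\<in>I. \<tau> (topspace T) (f i) = g i)"
proof -
  let ?X = "topspace T"
  have X: "openin T ?X" by simp
  have one: "\<one>\<^bsub>Sec A ?X\<^esub> \<noteq> \<zero>\<^bsub>Sec A ?X\<^esub>"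
    using zero_ring_imp_zero_module[OF _ nontrivial(1)] nontrivial(2) by auto
  have "\<exists>\<tau>. isometry_onto T A E \<phi> E \<phi> \<tau> \<and> (\<forall>i\<in>J. \<tau> ?X (f i) = g i)" if "J \<subseteq> I" for J
    using finite_subset[OF that I] that
  proof (induction J rule: finite_induct)
    case empty
    show ?case using isometry_onto_id by blast
  next
    case (insert j J)
    then obtain \<tau> where \<tau>: "isometry_onto T A E \<phi> E \<phi> \<tau>" and \<tau>f: "\<And>i. i \<in> J \<Longrightarrow> \<tau> ?X (f i) = g i"
      by auto
    note iso = isometry_onto_imp_isometry[OF \<tau>]
    note mor = isometry_morphism[OF iso]
    have jI: "j \<in> I" and JI: "J \<subseteq> I" using insert.prems by auto
    have fj: "f j \<in> carrier (Sec E ?X)" and gj: "g j \<in> carrier (Sec E ?X)"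
      and fJ: "f \<in> J \<rightarrow> carrier (Sec E ?X)" and gJ: "g \<in> J \<rightarrow> carrier (Sec E ?X)"
      using f g jI JI by auto
    have fjJ: "f \<in> insert j J \<rightarrow> carrier (Sec E ?X)" and gjJ: "g \<in> insert j J \<rightarrow> carrier (Sec E ?X)"
      using fj gj fJ gJ by auto
    have nf: "f j \<notin> span_sheaf J f ?X"
      by (rule not_in_span_sheaf[OF insert.hyps fjJ lin_indep_subset[OF I insert.prems f indf] one])
    have ng: "g j \<notin> span_sheaf J g ?X"
      by (rule not_in_span_sheaf[OF insert.hyps gjJ lin_indep_subset[OF I insert.prems g indg] one])
    let ?v = "\<tau> ?X (f j)"
    have v: "?v \<in> carrier (Sec E ?X)" by (rule sheaf_morphism_closed[OF mor X fj])
    have nv: "?v \<notin> span_sheaf J g ?X"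
    proof
      assume "?v \<in> span_sheaf J g ?X"
      then obtain c where c: "c \<in> J \<rightarrow> carrier (Sec A ?X)" "?v = lincomb ?X J c g"
        by (rule span_sheafE)
      have mor': "sheaf_morphism T A (sub_sheaf E (\<lambda>U. carrier (Sec E U))) E \<tau>"
        using mor by (simp add: sub_sheaf_def)
      have "\<tau> ?X (lincomb ?X J c f) = lincomb ?X J c (\<lambda>i. \<tau> ?X (f i))"
        using morphism_lincomb[OF whole_sub_sheaf mor' X insert.hyps(1) fJ c(1)] by simp
      also have "\<dots> = lincomb ?X J c g"
        by (rule lincomb_family_cong[OF insert.hyps(1) gJ X c(1) \<tau>f])
      also have "\<dots> = ?v" using c(2) by simp
      finally have "lincomb ?X J c f = f j"
        using isometry_inj_on[OF iso X] lincomb_closed[OF insert.hyps(1) fJ X c(1)] fj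
        by (auto dest: inj_onD)
      then show False using nf span_sheafI[OF c(1), of f] by simp
    qed
    have eq: "\<phi> ?X (g i) ?v = \<phi> ?X (g i) (g j)" if i: "i \<in> J" for i
    proof -
      have "f i \<in> carrier (Sec E ?X)" using fJ i by auto
      then have "\<phi> ?X (g i) ?v = \<phi> ?X (f i) (f j)"
        using isometry_form[OF iso X _ fj] \<tau>f[OF i] by metis
      then show ?thesis using fg[OF _ jI] JI i by auto
    qed
    obtain \<rho> where \<rho>: "isometry_onto T A E \<phi> E \<phi> \<rho>" "\<rho> ?X ?v = g j" "\<And>i. i \<in> J \<Longrightarrow> \<rho> ?X (g i) = g i"
      using exchange_isometry[OF nontrivial insert.hyps(1) gJ lin_indep_subset[OF I JI g indg]
          v nv gj ng eq] by blast
    have "\<forall>i\<in>insert j J. (\<rho> ?X \<circ> \<tau> ?X) (f i) = g i" using \<rho> \<tau>f by auto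
    then show ?case using isometry_onto_comp[OF \<tau> \<rho>(1)] by blast
  qed
  then show ?thesis by blast
qed

text \<open>The case \<open>E' = E\<close>.  Injectivity of \<open>\<sigma>\<close> makes the images of a frame of \<open>F\<close> independent again; when
  \<open>E\<close> is zero the global scalars need not form a field, but then the identity works.\<close>

lemma extend_isometry:
  assumes F: "free_submodule T A E F" and \<sigma>: "isometry T A (sub_sheaf E F) \<phi> E \<phi> \<sigma>"
  shows "\<exists>\<tau>. isometry_onto T A E \<phi> E \<phi> \<tau> \<and> (\<forall>U. openin T U \<longrightarrow> (\<forall>s\<in>F U. \<tau> U s = \<sigma> U s))"
proof -
  let ?X = "topspace T"
  have X: "openin T ?X" by simp
  obtain I :: "'m set" and \<iota> where frame: "free_frame T A E F I \<iota>"
    using free_submodule_frame[OF F] .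
  then interpret F: free_frame T A E F I \<iota> .
  note mor = isometry_morphism[OF \<sigma>]
  have \<sigma>c: "\<sigma> U s \<in> carrier (Sec E U)" if "openin T U" "s \<in> F U" for U s
    using sheaf_morphism_closed[OF mor that(1), of s] that(2) by (simp add: sub_sheaf_def)
  show ?thesis
  proof (cases "\<exists>W. openin T W \<and> carrier (Sec E W) \<noteq> {\<zero>\<^bsub>Sec E W\<^esub>}")
    case False
    then have "id s = \<sigma> U s" if "openin T U" "s \<in> F U" for U s
      using \<sigma>c[OF that] F.sub_subset[OF that(1)] that by auto
    then show ?thesis using isometry_onto_id by blast
  next
    case True
    then obtain W where W: "openin T W" "carrier (Sec E W) \<noteq> {\<zero>\<^bsub>Sec E W\<^esub>}" by blast
    have I: "finite I" by (rule finite_frame[OF W frame])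
    let ?f = "F.frame"
    let ?g = "\<lambda>i. \<sigma> ?X (?f i)"
    have f: "?f \<in> I \<rightarrow> F ?X" "?f \<in> I \<rightarrow> carrier (Sec E ?X)"
      using F.frame_in F.frame_closed by auto
    have g: "?g \<in> I \<rightarrow> carrier (Sec E ?X)" using \<sigma>c[OF X] F.frame_in by auto
    have \<sigma>_lin: "lincomb U I c ?f \<in> F U" "\<sigma> U (lincomb U I c ?f) = lincomb U I c ?g"
      if "openin T U" "c \<in> I \<rightarrow> carrier (Sec A U)" for U c
      using morphism_lincomb[OF F.sub mor that(1) I f(1) that(2)] by auto
    have indf: "lin_indep I ?f" by (rule F.lin_indep_frame[OF I subset_refl])
    have indg: "lin_indep I ?g"
      unfolding lin_indep_def
    proof (intro allI impI)
      fix U c assume U: "openin T U" and c: "c \<in> I \<rightarrow> carrier (Sec A U)"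
        and 0: "lincomb U I c ?g = \<zero>\<^bsub>Sec E U\<^esub>"
      interpret module "Sec A U" "Sec E U" by (rule sec_module[OF U])
      let ?z = "\<lambda>i. \<zero>\<^bsub>Sec A U\<^esub>"
      have z: "?z \<in> I \<rightarrow> carrier (Sec A U)" by simp
      have "\<sigma> U (lincomb U I c ?f) = \<sigma> U (lincomb U I ?z ?f)"
        using \<sigma>_lin(2)[OF U c] \<sigma>_lin(2)[OF U z] 0 lincomb_zero[OF I g U] by simp
      moreover have "inj_on (\<sigma> U) (F U)"
        using isometry_inj_on[OF \<sigma> U] by (simp add: sub_sheaf_def)
      ultimately have "lincomb U I c ?f = lincomb U I ?z ?f"
        using \<sigma>_lin(1)[OF U c] \<sigma>_lin(1)[OF U z] by (auto dest: inj_onD)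
      then show "\<forall>i\<in>I. c i = \<zero>\<^bsub>Sec A U\<^esub>"
        using lin_indep_lincomb_inj[OF I f(2) indf U c z] by blast
    qed
    have fg: "\<phi> ?X (?g i) (?g j) = \<phi> ?X (?f i) (?f j)" for i j
      using isometry_form[OF \<sigma> X, of "?f i" "?f j"] F.frame_in by (simp add: sub_sheaf_def)
    obtain \<tau> where \<tau>: "isometry_onto T A E \<phi> E \<phi> \<tau>" and \<tau>f: "\<And>i. i \<in> I \<Longrightarrow> \<tau> ?X (?f i) = ?g i"
      using isometry_matching_families[OF W I f(2) indf g indg fg] by blast
    have mor': "sheaf_morphism T A (sub_sheaf E (\<lambda>U. carrier (Sec E U))) E \<tau>"
      using isometry_morphism[OF isometry_onto_imp_isometry[OF \<tau>]] by (simp add: sub_sheaf_def)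
    have "\<tau> U s = \<sigma> U s" if U: "openin T U" and s: "s \<in> F U" for U s
    proof -
      obtain c where c: "c \<in> I \<rightarrow> carrier (Sec A U)" "s = lincomb U I c ?f"
        using s F.sub_eq_span[OF I U] by (auto elim: span_sheafE)
      have "\<tau> U s = lincomb U I c (\<lambda>i. \<tau> ?X (?f i))"
        unfolding c(2) using morphism_lincomb[OF whole_sub_sheaf mor' U I f(2) c(1)] by simp
      also have "\<dots> = lincomb U I c ?g"
        by (rule lincomb_family_cong[OF I g U c(1) \<tau>f])
      also have "\<dots> = \<sigma> U s" using \<sigma>_lin(2)[OF U c(1)] c(2) by simp
      finally show ?thesis .
    qed
    then show ?thesis using \<tau> by blast
  qed
qed

end

theorem theorem2p3:
  fixes T :: "'x topology"
    and A :: "('x, complex, 'a) sheaf_data"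
    and P :: "'x set \<Rightarrow> 'a set"
    and E :: "('x, 'a, 'm) sheaf_data" and \<phi> :: "('x, 'm, 'a) sheaf_form"
    and E' :: "('x, 'a, 'n) sheaf_data" and \<phi>' :: "('x, 'n, 'a) sheaf_form"
    and F :: "'x set \<Rightarrow> 'm set"
    and \<sigma> :: "'x set \<Rightarrow> 'm \<Rightarrow> 'n"
  assumes "ordered_algebraized_space T A P"
    and "\<And>U s. \<lbrakk>openin T U; s \<in> carrier (Sec A U); nowhere_zero T A U s\<rbrakk> \<Longrightarrow> s \<in> Units (Sec A U)"
    and "convenient_module T A E \<phi>"
    and "skew_symmetric T A E \<phi>"
    and "non_isotropic T A E \<phi> (\<lambda>U. carrier (Sec E U))"
    and "convenient_module T A E' \<phi>'"
    and "skew_symmetric T A E' \<phi>'"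
    and "non_isotropic T A E' \<phi>' (\<lambda>U. carrier (Sec E' U))"
    and "isometric T A E \<phi> E' \<phi>'"
    and "free_submodule T A E F"
    and "isometry T A (sub_sheaf E F) \<phi> E' \<phi>' \<sigma>"
  shows "\<exists>\<tau>. isometry_onto T A E \<phi> E' \<phi>' \<tau> \<and>
    (\<forall>U. openin T U \<longrightarrow> (\<forall>s\<in>F U. \<tau> U s = \<sigma> U s))"
proof -
  have bil: "bilinear_sheaf_form T A E \<phi>"
    using assms(3) unfolding convenient_module_def by (elim conjE)
  interpret symplectic_module T A E \<phi>
    by (intro symplectic_module.intro bil symplectic_module_axioms.intro assms(3-5))
  obtain \<iota> where \<iota>: "isometry_onto T A E \<phi> E' \<phi>' \<iota>"
    using assms(9) unfolding isometric_def by (elim exE)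
  \<comment> \<open>pull \<open>\<sigma>\<close> back to an isometry of \<open>F\<close> into \<open>E\<close>\<close>
  let ?j = "\<lambda>U. inv_into (carrier (Sec E U)) (\<iota> U)"
  have j: "isometry_onto T A E' \<phi>' E \<phi> ?j"
    by (rule isometry_onto_inv[OF sheaf_of_modules_axioms \<iota>])
  have "isometry T A (sub_sheaf E F) \<phi> E \<phi> (\<lambda>U. ?j U \<circ> \<sigma> U)"
    by (rule isometry_comp[OF assms(11) isometry_onto_imp_isometry[OF j]])
  from extend_isometry[OF assms(10) this] obtain \<tau> where \<tau>: "isometry_onto T A E \<phi> E \<phi> \<tau>"
    and ext: "\<And>U s. \<lbrakk>openin T U; s \<in> F U\<rbrakk> \<Longrightarrow> \<tau> U s = ?j U (\<sigma> U s)"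
    by auto
  have "\<iota> U (\<tau> U s) = \<sigma> U s" if U: "openin T U" and s: "s \<in> F U" for U s
  proof -
    have "\<sigma> U s \<in> carrier (Sec E' U)"
      using sheaf_morphism_closed[OF isometry_morphism[OF assms(11)] U, of s] s
      by (simp add: sub_sheaf_def)
    then show ?thesis
      using ext[OF U s] bij_betw_inv_into_right[OF isometry_onto_bij_betw[OF \<iota> U]] by simp
  qed
  then show ?thesis
    using isometry_onto_comp[OF \<tau> \<iota>] by (intro exI[of _ "\<lambda>U. \<iota> U \<circ> \<tau> U"]) simp
qed

end
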